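(* Let $F$ be a field of characteristic zero, let $G$ be a finite group, and let $\mathrm{var}^G(A)$ be a unitary $G$-graded variety over $F$ (that is, a $G$-graded variety generated by a unitary $G$-graded algebra) with quadratic codimension growth. Then $A$ is $T_G$-equivalent to a finite direct sum of $G$-graded algebras belonging to the set $$\{F,\ C_2^q,\ C_3^q,\ K_7^{p,q},\ \mathcal{G}_2^{g,h},\ W_\alpha^{u,v} \mid \alpha\in F^*,\ p,q\in G-\{1\},\ p\neq q,\ g,h\in G,\ gh=hg,\ u,v\in G-\{1\},\ u\neq v,\ uv=vu\}$$ (where in $C_2^q$ and $C_3^q$ the element $q$ is any element of $G-\{1\}$), in which at least one algebra from the set $\{C_3^s,\ K_7^{p,q},\ \mathcal{G}_2^{g,h},\ W_\alpha^{u,v}\mid s\in G-\{1\}\}$ (with $p,q,g,h,u,v,\alpha$ subject to the same restrictions) appears as a direct summand.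
   Context: Algebras are associative over $F$. A $G$-graded algebra is $A=\bigoplus_{g\in G}A_g$ with $A_gA_h\subseteq A_{gh}$. $F\langle X,G\rangle$ is the free $G$-graded algebra on variables $x_{i,g}$ ($i\ge1$, $g\in G$), where $x_{i,g}$ is homogeneous of degree $g$. A polynomial $f\in F\langle X,G\rangle$ is a $G$-graded identity of $A$ if it vanishes whenever each $x_{i,g}$ is replaced by an element of $A_g$; $\mathrm{Id}^G(A)$ is the set of all $G$-graded identities. $\mathrm{var}^G(A)$ is the class of all $G$-graded algebras $B$ with $\mathrm{Id}^G(A)\subseteq \mathrm{Id}^G(B)$. $A$ and $B$ are $T_G$-equivalent if $\mathrm{Id}^G(A)=\mathrm{Id}^G(B)$. $P_n^G$ is the span of all $x_{\sigma(1),h_1}\cdots x_{\sigma(n),h_n}$, $\sigma\in S_n$, $h_i\in G$, and $c_n^G(A)=\dim_F P_n^G/(P_n^G\cap \mathrm{Id}^G(A))$. Quadratic codimension growth means $c_n^G(A)=\beta n^2+O(n)$ for some $\beta>0$. The algebras: $e_{ij}$ are matrix units, $UT_m$ is the algebra of upper triangular $m\times m$ matrices, $I_m$ is the identity matrix. $F$ has the trivial grading (everything in degree $1$). $C_m^g$ ($m\ge2$, $g\in G$): with $E_1=\sum_{i=1}^{m-1}e_{i,i+1}$, the algebra $\{\alpha I_m+\sum_{1\le i<m}\alpha_iE_1^i\mid \alpha,\alpha_i\in F\}\subset UT_m$ graded by $I_m$ of degree $1$ and $E_1^i$ of degree $g^i$. $K_7^{g,h}$ ($g,h\in G-\{1\}$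 distinct): the algebra $F(e_{11}+e_{22}+e_{33})+Fe_{12}+Fe_{13}+Fe_{23}\subset UT_3$ graded by $e_{11}+e_{22}+e_{33}$ of degree $1$, $e_{12}$ of degree $g$, $e_{23}$ of degree $h$, $e_{13}$ of degree $gh$. $\mathcal{G}_2^{g,h}$ ($g,h\in G$, $gh=hg$): the Grassmann algebra with basis $1,e_1,e_2,e_1e_2$ and relations $e_1^2=e_2^2=0$, $e_1e_2=-e_2e_1$, graded by $1$ of degree $1$, $e_1$ of degree $g$, $e_2$ of degree $h$, $e_1e_2$ of degree $gh$. $W_\alpha^{g,h}$ ($\alpha\in F^*=F\setminus\{0\}$, $g,h\in G-\{1\}$ distinct, $gh=hg$): the algebra $F(e_{11}+\cdots+e_{44})+F(e_{12}+e_{34})+F(\alpha e_{13}+e_{24})+Fe_{14}\subset UT_4$ graded by $e_{11}+\cdots+e_{44}$ of degree $1$, $e_{12}+e_{34}$ of degree $g$, $\alpha e_{13}+e_{24}$ of degree $h$, $e_{14}$ of degree $gh$. *)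

theory Defs
  imports
    Complex_Main
    "HOL-Library.Function_Algebras"
    "HOL-Library.Poly_Mapping"
    "HOL-Library.Landau_Symbols"
    "HOL-Combinatorics.Permutations"
begin

text \<open>
  The grading group \<open>G\<close> is a type of class \<open>{group_add, finite}\<close>. This class is not commutative; the
  group is merely written additively, so \<open>gh\<close>, \<open>1\<close>, \<open>g\<^sup>i\<close> of the usual multiplicative notation become
  \<open>g + h\<close>, \<open>0\<close>, \<open>sum_list (replicate i g)\<close>. The ground field is a type of class \<open>field\<close>.
\<close>

subsection \<open>Graded algebras\<close>

text \<open>
  The addition of an algebra is that of the ambient type \<open>'v\<close>; the other operations are only
  relevant on the carrier. Algebras need not have a unit.
\<close>

record ('g, 'a, 'v) graded_alg =
  alg_carrier :: "'v set"
  alg_scale :: "'a \<Rightarrow> 'v \<Rightarrow> 'v"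
  alg_mult :: "'v \<Rightarrow> 'v \<Rightarrow> 'v"
  homogeneous :: "'g \<Rightarrow> 'v set"

locale graded_algebra =
  fixes A :: "('g::{group_add,finite}, 'a::field, 'v::ab_group_add) graded_alg"
  assumes zero_closed: "0 \<in> alg_carrier A"
    and add_closed: "\<lbrakk>x \<in> alg_carrier A; y \<in> alg_carrier A\<rbrakk> \<Longrightarrow> x + y \<in> alg_carrier A"
    and scale_closed: "x \<in> alg_carrier A \<Longrightarrow> alg_scale A c x \<in> alg_carrier A"
    and mult_closed: "\<lbrakk>x \<in> alg_carrier A; y \<in> alg_carrier A\<rbrakk> \<Longrightarrow> alg_mult A x y \<in> alg_carrier A"
    and scale_add_right: "\<lbrakk>x \<in> alg_carrier A; y \<in> alg_carrier A\<rbrakk> \<Longrightarrow>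
          alg_scale A c (x + y) = alg_scale A c x + alg_scale A c y"
    and scale_add_left: "x \<in> alg_carrier A \<Longrightarrow>
          alg_scale A (c + d) x = alg_scale A c x + alg_scale A d x"
    and scale_scale: "x \<in> alg_carrier A \<Longrightarrow>
          alg_scale A c (alg_scale A d x) = alg_scale A (c * d) x"
    and scale_one: "x \<in> alg_carrier A \<Longrightarrow> alg_scale A 1 x = x"
    and mult_assoc: "\<lbrakk>x \<in> alg_carrier A; y \<in> alg_carrier A; z \<in> alg_carrier A\<rbrakk> \<Longrightarrow>
          alg_mult A (alg_mult A x y) z = alg_mult A x (alg_mult A y z)"
    and mult_add_left: "\<lbrakk>x \<in> alg_carrier A; y \<in> alg_carrier A; z \<in> alg_carrier A\<rbrakk> \<Longrightarrow>
          alg_mult A (x + y) z = alg_mult A x z + alg_mult A y z"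
    and mult_add_right: "\<lbrakk>x \<in> alg_carrier A; y \<in> alg_carrier A; z \<in> alg_carrier A\<rbrakk> \<Longrightarrow>
          alg_mult A x (y + z) = alg_mult A x y + alg_mult A x z"
    and mult_scale_left: "\<lbrakk>x \<in> alg_carrier A; y \<in> alg_carrier A\<rbrakk> \<Longrightarrow>
          alg_mult A (alg_scale A c x) y = alg_scale A c (alg_mult A x y)"
    and mult_scale_right: "\<lbrakk>x \<in> alg_carrier A; y \<in> alg_carrier A\<rbrakk> \<Longrightarrow>
          alg_mult A x (alg_scale A c y) = alg_scale A c (alg_mult A x y)"
    and homogeneous_subset: "homogeneous A g \<subseteq> alg_carrier A"
    and homogeneous_zero: "0 \<in> homogeneous A g"
    and homogeneous_add: "\<lbrakk>x \<in> homogeneous A g; y \<in> homogeneous A g\<rbrakk> \<Longrightarrow> x + y \<in> homogeneous A g"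
    and homogeneous_scale: "x \<in> homogeneous A g \<Longrightarrow> alg_scale A c x \<in> homogeneous A g"
    and homogeneous_decomposition: "x \<in> alg_carrier A \<Longrightarrow>
          \<exists>!f. (\<forall>g. f g \<in> homogeneous A g) \<and> x = (\<Sum>g\<in>UNIV. f g)"
    and homogeneous_mult: "\<lbrakk>x \<in> homogeneous A g; y \<in> homogeneous A h\<rbrakk> \<Longrightarrow>
          alg_mult A x y \<in> homogeneous A (g + h)"

definition unitary :: "('g, 'a, 'v) graded_alg \<Rightarrow> bool" where
  "unitary A \<longleftrightarrow>
     (\<exists>e\<in>alg_carrier A. \<forall>x\<in>alg_carrier A. alg_mult A e x = x \<and> alg_mult A x e = x)"

text \<open>The summands may have different operations, but live in the same ambient type.\<close>

definition direct_sum ::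
  "nat \<Rightarrow> (nat \<Rightarrow> ('g, 'a, 'v::zero) graded_alg) \<Rightarrow> ('g, 'a, nat \<Rightarrow> 'v) graded_alg" where
  "direct_sum n B =
    \<lparr>alg_carrier = {x. (\<forall>i<n. x i \<in> alg_carrier (B i)) \<and> (\<forall>i\<ge>n. x i = 0)},
     alg_scale = (\<lambda>c x i. if i < n then alg_scale (B i) c (x i) else 0),
     alg_mult = (\<lambda>x y i. if i < n then alg_mult (B i) (x i) (y i) else 0),
     homogeneous = (\<lambda>g. {x. (\<forall>i<n. x i \<in> homogeneous (B i) g) \<and> (\<forall>i\<ge>n. x i = 0)})\<rparr>"


subsection \<open>Graded polynomials and identities\<close>

text \<open>
  The variable \<open>x\<^sub>i\<^sub>,\<^sub>g\<close> is the pair \<open>(i, g)\<close> and a monomial is a word in these variables. As algebras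
  need not be unitary, the free algebra has no constant terms. (On unitary algebras other than zero
  this makes no difference: substituting 0 for all variables shows that an identity has zero
  constant term.)
\<close>

type_synonym ('g, 'a) graded_poly = "(nat \<times> 'g) list \<Rightarrow>\<^sub>0 'a"

definition poly_scale :: "'a::field \<Rightarrow> ('g, 'a) graded_poly \<Rightarrow> ('g, 'a) graded_poly" where
  "poly_scale c f = Poly_Mapping.map ((*) c) f"

definition free_graded_algebra :: "('g, 'a::field) graded_poly set" where
  "free_graded_algebra = {f. \<forall>w\<in>Poly_Mapping.keys f. w \<noteq> [] \<and> (\<forall>(i, g)\<in>set w. 1 \<le> i)}"

text \<open>The value on the empty list is irrelevant.\<close>

fun alg_prod_list :: "('g, 'a, 'v::zero) graded_alg \<Rightarrow> 'v list \<Rightarrow> 'v" where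
  "alg_prod_list A [] = 0"
| "alg_prod_list A [x] = x"
| "alg_prod_list A (x # y # ys) = alg_mult A x (alg_prod_list A (y # ys))"

definition poly_eval ::
  "('g, 'a::field, 'v::ab_group_add) graded_alg \<Rightarrow> (nat \<times> 'g \<Rightarrow> 'v) \<Rightarrow> ('g, 'a) graded_poly \<Rightarrow> 'v" where
  "poly_eval A \<phi> f = (\<Sum>w\<in>Poly_Mapping.keys f.
     alg_scale A (Poly_Mapping.lookup f w) (alg_prod_list A (map \<phi> w)))"

definition graded_identities ::
  "('g, 'a::field, 'v::ab_group_add) graded_alg \<Rightarrow> ('g, 'a) graded_poly set" where
  "graded_identities A = {f \<in> free_graded_algebra.
     \<forall>\<phi>. (\<forall>i g. \<phi> (i, g) \<in> homogeneous A g) \<longrightarrow> poly_eval A \<phi> f = 0}"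

definition T_equivalent ::
  "('g, 'a::field, 'v::ab_group_add) graded_alg \<Rightarrow> ('g, 'a, 'w::ab_group_add) graded_alg \<Rightarrow> bool" where
  "T_equivalent A B \<longleftrightarrow> graded_identities A = graded_identities B"

text \<open>
  The class of all algebras in a variety is represented by its members on each ambient type \<open>'w\<close>.
  Two algebras on different types generate the same variety if each lies in the variety of the other.
\<close>

definition graded_variety ::
  "('g::{group_add,finite}, 'a::field, 'v::ab_group_add) graded_alg \<Rightarrow>
   ('g, 'a, 'w::ab_group_add) graded_alg set" where
  "graded_variety A = {B. graded_algebra B \<and> graded_identities A \<subseteq> graded_identities B}"


subsection \<open>Codimensions\<close>

definition multilinear_polys :: "nat \<Rightarrow> ('g, 'a::field) graded_poly set" where
  "multilinear_polys n = module.span poly_scale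
     {Poly_Mapping.single (map (\<lambda>i. (\<sigma> i, h i)) [1..<Suc n]) 1 | \<sigma> h. \<sigma> permutes {1..n}}"

text \<open>
  The dimension of the quotient space \<open>V / W\<close>: the set \<open>B\<close> consists of representatives of the elements
  of a basis of \<open>V / W\<close>, one for each element.
\<close>

definition quotient_dim :: "('a::field \<Rightarrow> 'p::ab_group_add \<Rightarrow> 'p) \<Rightarrow> 'p set \<Rightarrow> 'p set \<Rightarrow> nat" where
  "quotient_dim scale V W = (THE d. \<exists>B. finite B \<and> card B = d \<and> B \<subseteq> V \<and>
     (\<forall>c. (\<Sum>b\<in>B. scale (c b) b) \<in> W \<longrightarrow> (\<forall>b\<in>B. c b = 0)) \<and>
     (\<forall>v\<in>V. \<exists>c. v - (\<Sum>b\<in>B. scale (c b) b) \<in> W))"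

definition graded_codim ::
  "('g, 'a::field, 'v::ab_group_add) graded_alg \<Rightarrow> nat \<Rightarrow> nat" where
  "graded_codim A n =
     quotient_dim poly_scale (multilinear_polys n) (multilinear_polys n \<inter> graded_identities A)"

definition quadratic_growth :: "('g, 'a::field, 'v::ab_group_add) graded_alg \<Rightarrow> bool" where
  "quadratic_growth A \<longleftrightarrow>
     (\<exists>\<beta>::real. \<beta> > 0 \<and> (\<lambda>n. real (graded_codim A n) - \<beta> * (real n)\<^sup>2) \<in> O(\<lambda>n. real n))"


subsection \<open>The algebras occurring in the classification\<close>

text \<open>
  All of them are realised on the type \<open>nat \<Rightarrow> nat \<Rightarrow> 'a\<close> of doubly indexed coefficient families, so
  that direct sums can be formed. An \<open>m \<times> m\<close> matrix is a family supported on \<open>{1..m} \<times> {1..m}\<close>, the field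
  itself consists of the \<open>1 \<times> 1\<close> matrices, and an element of the Grassmann algebra is given by
  the coefficients of \<open>e\<^sub>1\<^sup>i e\<^sub>2\<^sup>j\<close>, where \<open>i, j \<le> 1\<close>.
\<close>

definition coeff_scale :: "'a::field \<Rightarrow> (nat \<Rightarrow> nat \<Rightarrow> 'a) \<Rightarrow> nat \<Rightarrow> nat \<Rightarrow> 'a" where
  "coeff_scale c X = (\<lambda>i j. c * X i j)"

definition unit_at :: "nat \<Rightarrow> nat \<Rightarrow> nat \<Rightarrow> nat \<Rightarrow> 'a::field" where
  "unit_at i j = (\<lambda>k l. if k = i \<and> l = j then 1 else 0)"

definition mat_mult :: "nat \<Rightarrow> (nat \<Rightarrow> nat \<Rightarrow> 'a::field) \<Rightarrow> (nat \<Rightarrow> nat \<Rightarrow> 'a) \<Rightarrow> nat \<Rightarrow> nat \<Rightarrow> 'a" where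
  "mat_mult m X Y = (\<lambda>i j. \<Sum>k=1..m. X i k * Y k j)"

definition id_mat :: "nat \<Rightarrow> nat \<Rightarrow> nat \<Rightarrow> 'a::field" where
  "id_mat m = (\<Sum>i=1..m. unit_at i i)"

text \<open>
  By \<open>e\<^sub>2 e\<^sub>1 = - e\<^sub>1 e\<^sub>2\<close>, the product of \<open>e\<^sub>1\<^sup>k e\<^sub>2\<^sup>l\<close> and \<open>e\<^sub>1\<^sup>p e\<^sub>2\<^sup>q\<close> is \<open>(-1)\<^sup>l\<^sup>p e\<^sub>1\<^sup>k\<^sup>+\<^sup>p e\<^sub>2\<^sup>l\<^sup>+\<^sup>q\<close>, and this
  vanishes if an exponent exceeds 1.
\<close>

definition grassmann_mult :: "(nat \<Rightarrow> nat \<Rightarrow> 'a::field) \<Rightarrow> (nat \<Rightarrow> nat \<Rightarrow> 'a) \<Rightarrow> nat \<Rightarrow> nat \<Rightarrow> 'a" where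
  "grassmann_mult X Y = (\<lambda>i j. if i \<le> 1 \<and> j \<le> 1
     then \<Sum>k\<le>i. \<Sum>l\<le>j. (-1) ^ (l * (i - k)) * X k l * Y (i - k) (j - l) else 0)"

text \<open>The algebra spanned by a list of homogeneous basis elements paired with their degrees.\<close>

definition basis_algebra ::
  "((nat \<Rightarrow> nat \<Rightarrow> 'a::field) \<Rightarrow> (nat \<Rightarrow> nat \<Rightarrow> 'a) \<Rightarrow> nat \<Rightarrow> nat \<Rightarrow> 'a) \<Rightarrow>
   ((nat \<Rightarrow> nat \<Rightarrow> 'a) \<times> 'g) list \<Rightarrow> ('g, 'a, nat \<Rightarrow> nat \<Rightarrow> 'a) graded_alg" where
  "basis_algebra mul bs =
    \<lparr>alg_carrier = module.span coeff_scale (fst ` set bs),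
     alg_scale = coeff_scale,
     alg_mult = mul,
     homogeneous = (\<lambda>g. module.span coeff_scale {b. (b, g) \<in> set bs})\<rparr>"

definition F_alg :: "('g::group_add, 'a::field, nat \<Rightarrow> nat \<Rightarrow> 'a) graded_alg" where
  "F_alg = basis_algebra (mat_mult 1) [(unit_at 1 1, 0)]"

definition C_alg :: "nat \<Rightarrow> 'g::group_add \<Rightarrow> ('g, 'a::field, nat \<Rightarrow> nat \<Rightarrow> 'a) graded_alg" where
  "C_alg m g = (let E\<^sub>1 = (\<Sum>i=1..m - 1. unit_at i (i + 1)) in
     basis_algebra (mat_mult m)
       ((id_mat m, 0) #
        map (\<lambda>i. ((mat_mult m E\<^sub>1 ^^ i) (id_mat m), sum_list (replicate i g))) [1..<m]))"

definition K7_alg :: "'g::group_add \<Rightarrow> 'g \<Rightarrow> ('g, 'a::field, nat \<Rightarrow> nat \<Rightarrow> 'a) graded_alg" where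
  "K7_alg g h = basis_algebra (mat_mult 3)
     [(unit_at 1 1 + unit_at 2 2 + unit_at 3 3, 0),
      (unit_at 1 2, g), (unit_at 2 3, h), (unit_at 1 3, g + h)]"

definition Grassmann_alg :: "'g::group_add \<Rightarrow> 'g \<Rightarrow> ('g, 'a::field, nat \<Rightarrow> nat \<Rightarrow> 'a) graded_alg" where
  "Grassmann_alg g h = basis_algebra grassmann_mult
     [(unit_at 0 0, 0), (unit_at 1 0, g), (unit_at 0 1, h), (unit_at 1 1, g + h)]"

definition W_alg :: "'a::field \<Rightarrow> 'g::group_add \<Rightarrow> 'g \<Rightarrow> ('g, 'a, nat \<Rightarrow> nat \<Rightarrow> 'a) graded_alg" where
  "W_alg \<alpha> g h = basis_algebra (mat_mult 4)
     [(unit_at 1 1 + unit_at 2 2 + unit_at 3 3 + unit_at 4 4, 0),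
      (unit_at 1 2 + unit_at 3 4, g),
      (coeff_scale \<alpha> (unit_at 1 3) + unit_at 2 4, h),
      (unit_at 1 4, g + h)]"

definition quadratic_summands :: "('g::group_add, 'a::field, nat \<Rightarrow> nat \<Rightarrow> 'a) graded_alg set" where
  "quadratic_summands =
     {C_alg 3 s | s. s \<noteq> 0} \<union>
     {K7_alg p q | p q. p \<noteq> 0 \<and> q \<noteq> 0 \<and> p \<noteq> q} \<union>
     {Grassmann_alg g h | g h. g + h = h + g} \<union>
     {W_alg \<alpha> u v | \<alpha> u v. \<alpha> \<noteq> 0 \<and> u \<noteq> 0 \<and> v \<noteq> 0 \<and> u \<noteq> v \<and> u + v = v + u}"

definition summands :: "('g::group_add, 'a::field, nat \<Rightarrow> nat \<Rightarrow> 'a) graded_alg set" where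
  "summands = {F_alg} \<union> {C_alg 2 q | q. q \<noteq> 0} \<union> quadratic_summands"

end

theory Submission
  imports Defs "HOL-Combinatorics.Multiset_Permutations" "HOL-Real_Asymp.Real_Asymp"
begin

text \<open>
  In characteristic 0 the graded identities are determined by the multilinear ones. Call a multilinear
  polynomial proper for \<open>A\<close> if it vanishes on \<open>A\<close> whenever the unit is substituted for a variable of degree 0. A
  proper polynomial in \<open>k\<close> variables that is not an identity forces \<open>c\<^sub>n \<ge> n choose k\<close>, so quadratic growth
  makes every proper polynomial in at least 3 variables an identity. Inductively, a multilinear
  polynomial is then an identity as soon as it vanishes whenever all but two of its variables are
  replaced by the unit. The same is true for the algebras of the list, as they have the form \<open>F + J\<close> with
  \<open>J\<^sup>3 = 0\<close>. Hence all varieties involved are determined, for each pair of degrees \<open>g\<close>, \<open>h\<close>, by the space of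
  all \<open>(a, b)\<close> for which \<open>a x\<^sub>g y\<^sub>h + b y\<^sub>h x\<^sub>g\<close> is an identity, and it suffices to write each of these subspaces
  of \<open>F\<^sup>2\<close> as an intersection of the spaces belonging to summands that lie in the variety. If no
  summand of quadratic growth occurred, then homogeneous elements would commute and those of degree
  different from 0 would have products zero, which makes the codimensions grow at most linearly.
\<close>

subsection \<open>Multilinear polynomials\<close>

text \<open>For fixed degrees g and h, the type of the pair decides which subspaces of F^2 can
  occur. If g = 0 and the component of degree h is nonzero, the unit forces a + b = 0. If g = h,
  exchanging the variables swaps a and b, so the space is spanned by some of (1, 1) and (1, -1). If
  g + h \<noteq> h + g, the two products lie in different components, which leaves coordinate
  subspaces. If g and h are distinct, nonzero and commute, every subspace is possible, so each line
  off the axes needs its own summand: hence the parameter \<alpha>. The obstacle is that a summand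
  chosen for one pair of degrees has to satisfy the degree-two identities of \<open>A\<close> for
  all pairs. The way out is that one nonzero product in \<open>A\<close> makes the components of
  \<open>A\<close> nonzero in every degree of that summand; the condition a + b = 0, which is all
  that the unit of the summand demands, is then already forced by \<open>A\<close>. Identities are
  compared in both directions, from \<open>A\<close> to a summand and back, so both kinds of
  algebras are made instances of one locale.\<close>

locale unital_graded =
  fixes A :: "('g::{group_add,finite}, 'a::field_char_0, 'v::ab_group_add) graded_alg" and e :: 'v
  assumes zero_closed: "0 \<in> alg_carrier A"
    and add_closed: "\<lbrakk>x \<in> alg_carrier A; y \<in> alg_carrier A\<rbrakk> \<Longrightarrow> x + y \<in> alg_carrier A"
    and scale_closed: "x \<in> alg_carrier A \<Longrightarrow> alg_scale A c x \<in> alg_carrier A"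
    and mult_closed: "\<lbrakk>x \<in> alg_carrier A; y \<in> alg_carrier A\<rbrakk> \<Longrightarrow> alg_mult A x y \<in> alg_carrier A"
    and scale_add_right: "\<lbrakk>x \<in> alg_carrier A; y \<in> alg_carrier A\<rbrakk> \<Longrightarrow>
          alg_scale A c (x + y) = alg_scale A c x + alg_scale A c y"
    and scale_add_left: "x \<in> alg_carrier A \<Longrightarrow>
          alg_scale A (c + d) x = alg_scale A c x + alg_scale A d x"
    and scale_scale: "x \<in> alg_carrier A \<Longrightarrow>
          alg_scale A c (alg_scale A d x) = alg_scale A (c * d) x"
    and scale_one: "x \<in> alg_carrier A \<Longrightarrow> alg_scale A 1 x = x"
    and mult_add_left: "\<lbrakk>x \<in> alg_carrier A; y \<in> alg_carrier A; z \<in> alg_carrier A\<rbrakk> \<Longrightarrow>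
          alg_mult A (x + y) z = alg_mult A x z + alg_mult A y z"
    and mult_add_right: "\<lbrakk>x \<in> alg_carrier A; y \<in> alg_carrier A; z \<in> alg_carrier A\<rbrakk> \<Longrightarrow>
          alg_mult A x (y + z) = alg_mult A x y + alg_mult A x z"
    and mult_scale_left: "\<lbrakk>x \<in> alg_carrier A; y \<in> alg_carrier A\<rbrakk> \<Longrightarrow>
          alg_mult A (alg_scale A c x) y = alg_scale A c (alg_mult A x y)"
    and mult_scale_right: "\<lbrakk>x \<in> alg_carrier A; y \<in> alg_carrier A\<rbrakk> \<Longrightarrow>
          alg_mult A x (alg_scale A c y) = alg_scale A c (alg_mult A x y)"
    and homogeneous_subset: "homogeneous A g \<subseteq> alg_carrier A"
    and homogeneous_zero: "0 \<in> homogeneous A g"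
    and homogeneous_add: "\<lbrakk>x \<in> homogeneous A g; y \<in> homogeneous A g\<rbrakk> \<Longrightarrow> x + y \<in> homogeneous A g"
    and homogeneous_scale: "x \<in> homogeneous A g \<Longrightarrow> alg_scale A c x \<in> homogeneous A g"
    and unit_homogeneous: "e \<in> homogeneous A 0"
    and unit_left: "x \<in> alg_carrier A \<Longrightarrow> alg_mult A e x = x"
    and unit_right: "x \<in> alg_carrier A \<Longrightarrow> alg_mult A x e = x"

text \<open>The product ends in the unit, so that the empty word has the value \<open>e\<close>.
  Substituting units can delete every letter of a word, and \<open>alg_prod_list\<close> would give
  0 there.\<close>

definition unital_prod :: "('g, 'a, 'v) graded_alg \<Rightarrow> 'v \<Rightarrow> 'v list \<Rightarrow> 'v" where
  "unital_prod A e xs = foldr (alg_mult A) xs e"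

lemma unital_prod_Nil [simp]: "unital_prod A e [] = e"
  and unital_prod_Cons [simp]: "unital_prod A e (x # xs) = alg_mult A x (unital_prod A e xs)"
  by (simp_all add: unital_prod_def)

text \<open>Each variable has one fixed degree, so words are lists of indices only; the degrees are
  kept apart and enter in \<open>multilinear_identity\<close>.\<close>

definition multilinear_eval ::
  "('g, 'a, 'v::ab_group_add) graded_alg \<Rightarrow> 'v \<Rightarrow> nat set \<Rightarrow> (nat list \<Rightarrow> 'a) \<Rightarrow> (nat \<Rightarrow> 'v) \<Rightarrow> 'v" where
  "multilinear_eval A e S c u =
     (\<Sum>w\<in>permutations_of_set S. alg_scale A (c w) (unital_prod A e (map u w)))"

definition multilinear_identity ::
  "('g, 'a, 'v::ab_group_add) graded_alg \<Rightarrow> 'v \<Rightarrow> nat set \<Rightarrow> (nat \<Rightarrow> 'g) \<Rightarrow> (nat list \<Rightarrow> 'a) \<Rightarrow> bool" where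
  "multilinear_identity A e S h c \<longleftrightarrow>
     (\<forall>u. (\<forall>i\<in>S. u i \<in> homogeneous A (h i)) \<longrightarrow> multilinear_eval A e S c u = 0)"

definition bilinear_identity ::
  "('g, 'a, 'v::ab_group_add) graded_alg \<Rightarrow> 'g \<Rightarrow> 'g \<Rightarrow> 'a \<Rightarrow> 'a \<Rightarrow> bool" where
  "bilinear_identity A g h a b \<longleftrightarrow>
     (\<forall>x\<in>homogeneous A g. \<forall>y\<in>homogeneous A h.
        alg_scale A a (alg_mult A x y) + alg_scale A b (alg_mult A y x) = 0)"

text \<open>These are the coefficients left after the unit is substituted for all variables outside
  \<open>T\<close>: a word shrinks to its subword on \<open>T\<close>, and words with the same
  subword are collected.\<close>

definition restrict_coeffs :: "nat set \<Rightarrow> nat set \<Rightarrow> (nat list \<Rightarrow> 'a::comm_monoid_add) \<Rightarrow> nat list \<Rightarrow> 'a" where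
  "restrict_coeffs S T c w' = (\<Sum>w | w \<in> permutations_of_set S \<and> filter (\<lambda>i. i \<in> T) w = w'. c w)"

lemma filter_in_permutations_of_set:
  assumes "w \<in> permutations_of_set S" "T \<subseteq> S"
  shows "filter (\<lambda>i. i \<in> T) w \<in> permutations_of_set T"
  using assms by (auto simp: permutations_of_set_def)

context unital_graded
begin

abbreviation carr where "carr \<equiv> alg_carrier A"
abbreviation scale (infixr "*\<^sub>A" 75) where "scale \<equiv> alg_scale A"
abbreviation mult (infixl "\<bullet>" 70) where "mult \<equiv> alg_mult A"
abbreviation hom where "hom \<equiv> homogeneous A"
abbreviation uprod where "uprod \<equiv> unital_prod A e"

lemma hom_carr: "x \<in> hom g \<Longrightarrow> x \<in> carr"
  using homogeneous_subset by blast

lemma unit_closed: "e \<in> carr"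
  using unit_homogeneous hom_carr by blast

lemma scale_zero_left: "x \<in> carr \<Longrightarrow> 0 *\<^sub>A x = 0"
  using scale_add_left[of x 0 0] by simp

lemma scale_zero_right [simp]: "c *\<^sub>A 0 = 0"
  using scale_add_right[OF zero_closed zero_closed, of c] by simp

lemma mult_zero_left: "x \<in> carr \<Longrightarrow> 0 \<bullet> x = 0"
  using mult_add_left[of 0 0 x] zero_closed by simp

lemma mult_zero_right: "x \<in> carr \<Longrightarrow> x \<bullet> 0 = 0"
  using mult_add_right[of x 0 0] zero_closed by simp

lemma scale_minus: "x \<in> carr \<Longrightarrow> (- c) *\<^sub>A x = - (c *\<^sub>A x)"
  using scale_add_left[of x "-c" c] scale_zero_left[of x] by (simp add: eq_neg_iff_add_eq_0)

lemma scale_cancel: "\<lbrakk>x \<in> carr; c *\<^sub>A x = 0; c \<noteq> 0\<rbrakk> \<Longrightarrow> x = 0"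
  using scale_scale[of x "inverse c" c] scale_one[of x] by simp

lemma sum_closed: "(\<And>i. i \<in> I \<Longrightarrow> f i \<in> carr) \<Longrightarrow> sum f I \<in> carr"
  by (induction I rule: infinite_finite_induct) (auto simp: zero_closed add_closed)

lemma sum_homogeneous: "(\<And>i. i \<in> I \<Longrightarrow> f i \<in> hom g) \<Longrightarrow> sum f I \<in> hom g"
  by (induction I rule: infinite_finite_induct) (auto simp: homogeneous_zero homogeneous_add)

lemma scale_sum: "(\<And>i. i \<in> I \<Longrightarrow> f i \<in> carr) \<Longrightarrow> c *\<^sub>A sum f I = (\<Sum>i\<in>I. c *\<^sub>A f i)"
  by (induction I rule: infinite_finite_induct) (auto simp: scale_add_right sum_closed)

lemma scale_sum_left: "x \<in> carr \<Longrightarrow> sum a I *\<^sub>A x = (\<Sum>i\<in>I. a i *\<^sub>A x)"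
  by (induction I rule: infinite_finite_induct) (auto simp: scale_add_left scale_zero_left)

lemma mult_sum_left:
  "\<lbrakk>\<And>i. i \<in> I \<Longrightarrow> f i \<in> carr; x \<in> carr\<rbrakk> \<Longrightarrow> sum f I \<bullet> x = (\<Sum>i\<in>I. f i \<bullet> x)"
  by (induction I rule: infinite_finite_induct) (auto simp: mult_zero_left mult_add_left sum_closed)

lemma mult_sum_right:
  "\<lbrakk>\<And>i. i \<in> I \<Longrightarrow> f i \<in> carr; x \<in> carr\<rbrakk> \<Longrightarrow> x \<bullet> sum f I = (\<Sum>i\<in>I. x \<bullet> f i)"
  by (induction I rule: infinite_finite_induct) (auto simp: mult_zero_right mult_add_right sum_closed)

lemma uprod_closed: "set xs \<subseteq> carr \<Longrightarrow> uprod xs \<in> carr"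
  by (induction xs) (auto simp: unit_closed mult_closed)

lemma alg_prod_list_eq_uprod: "\<lbrakk>xs \<noteq> []; set xs \<subseteq> carr\<rbrakk> \<Longrightarrow> alg_prod_list A xs = uprod xs"
proof (induction xs)
  case (Cons x xs)
  then show ?case by (cases xs) (auto simp: unit_right)
qed simp

lemma uprod_filter:
  assumes "\<And>i. i \<in> set w \<Longrightarrow> u i \<in> carr" and "\<And>i. i \<in> set w \<Longrightarrow> \<not> P i \<Longrightarrow> u i = e"
  shows "uprod (map u w) = uprod (map u (filter P w))"
  using assms
proof (induction w)
  case (Cons i w)
  have "uprod (map u w) \<in> carr"
    using Cons.prems by (intro uprod_closed) auto
  with Cons show ?case by (auto simp: unit_left)
qed simp

lemma uprod_zero:
  assumes "\<And>i. i \<in> set w \<Longrightarrow> u i \<in> carr" and "i \<in> set w" "u i = 0"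
  shows "uprod (map u w) = 0"
  using assms
proof (induction w)
  case (Cons j w)
  have *: "uprod (map u w) \<in> carr"
    using Cons.prems by (intro uprod_closed) auto
  show ?case
  proof (cases "i \<in> set w")
    case True
    then have "uprod (map u w) = 0" using Cons by auto
    then show ?thesis using Cons.prems by (simp add: mult_zero_right)
  next
    case False
    then show ?thesis using Cons.prems * by (simp add: mult_zero_left)
  qed
qed simp

lemma uprod_slot_add:
  assumes "distinct w" "i \<in> set w" "\<And>j. j \<in> set w \<Longrightarrow> j \<noteq> i \<Longrightarrow> u j \<in> carr" "x \<in> carr" "y \<in> carr"
  shows "uprod (map (u(i := x + y)) w) = uprod (map (u(i := x)) w) + uprod (map (u(i := y)) w)"
  using assms
proof (induction w)
  case (Cons j w)
  show ?case
  proof (cases "j = i")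
    case True
    then have "map (u(i := z)) (j # w) = z # map u w" for z using Cons.prems by auto
    moreover have "uprod (map u w) \<in> carr" using Cons.prems True by (intro uprod_closed) auto
    ultimately show ?thesis
      using Cons.prems by (simp only: unital_prod_Cons mult_add_left)
  next
    case False
    have "uprod (map (u(i := z)) w) \<in> carr" if "z \<in> carr" for z
      using Cons.prems that by (intro uprod_closed) auto
    moreover have "map (u(i := z)) (j # w) = u j # map (u(i := z)) w" for z using False by simp
    moreover have "i \<in> set w" "u j \<in> carr" using Cons.prems False by auto
    ultimately show ?thesis
      using Cons by (simp add: mult_add_right del: fun_upd_apply list.map)
  qed
qed simp

lemma uprod_slot_scale:
  assumes "distinct w" "i \<in> set w" "\<And>j. j \<in> set w \<Longrightarrow> j \<noteq> i \<Longrightarrow> u j \<in> carr" "x \<in> carr"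
  shows "uprod (map (u(i := c *\<^sub>A x)) w) = c *\<^sub>A uprod (map (u(i := x)) w)"
  using assms
proof (induction w)
  case (Cons j w)
  show ?case
  proof (cases "j = i")
    case True
    then have "map (u(i := z)) (j # w) = z # map u w" for z using Cons.prems by auto
    moreover have "uprod (map u w) \<in> carr" using Cons.prems True by (intro uprod_closed) auto
    ultimately show ?thesis
      using Cons.prems by (simp only: unital_prod_Cons mult_scale_left)
  next
    case False
    have "uprod (map (u(i := z)) w) \<in> carr" if "z \<in> carr" for z
      using Cons.prems that by (intro uprod_closed) auto
    moreover have "map (u(i := z)) (j # w) = u j # map (u(i := z)) w" for z using False by simp
    moreover have "i \<in> set w" "u j \<in> carr" using Cons.prems False by auto
    ultimately show ?thesis
      using Cons by (simp add: mult_scale_right del: fun_upd_apply list.map)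
  qed
qed simp

lemma uprod_perm_closed:
  "\<lbrakk>w \<in> permutations_of_set S; \<And>i. i \<in> S \<Longrightarrow> u i \<in> carr\<rbrakk> \<Longrightarrow> uprod (map u w) \<in> carr"
  by (rule uprod_closed) (auto simp: permutations_of_set_def)

lemma multilinear_eval_slot_add:
  assumes "i \<in> S" "\<And>j. j \<in> S \<Longrightarrow> j \<noteq> i \<Longrightarrow> u j \<in> carr" "x \<in> carr" "y \<in> carr"
  shows "multilinear_eval A e S c (u(i := x + y)) =
    multilinear_eval A e S c (u(i := x)) + multilinear_eval A e S c (u(i := y))"
  unfolding multilinear_eval_def sum.distrib[symmetric]
proof (rule sum.cong[OF refl])
  fix w assume w: "w \<in> permutations_of_set S"
  then have "uprod (map (u(i := x + y)) w) = uprod (map (u(i := x)) w) + uprod (map (u(i := y)) w)"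
    using assms by (intro uprod_slot_add) (auto simp: permutations_of_set_def)
  moreover have "uprod (map (u(i := z)) w) \<in> carr" if "z \<in> carr" for z
    using assms that by (intro uprod_perm_closed[OF w]) auto
  ultimately show "c w *\<^sub>A uprod (map (u(i := x + y)) w) =
      c w *\<^sub>A uprod (map (u(i := x)) w) + c w *\<^sub>A uprod (map (u(i := y)) w)"
    using assms by (simp add: scale_add_right)
qed

lemma multilinear_eval_slot_scale:
  assumes "i \<in> S" "\<And>j. j \<in> S \<Longrightarrow> j \<noteq> i \<Longrightarrow> u j \<in> carr" "x \<in> carr"
  shows "multilinear_eval A e S c (u(i := d *\<^sub>A x)) = d *\<^sub>A multilinear_eval A e S c (u(i := x))"
proof -
  have cl: "uprod (map (u(i := x)) w) \<in> carr" if "w \<in> permutations_of_set S" for w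
    using assms by (intro uprod_perm_closed[OF that]) auto
  have "uprod (map (u(i := d *\<^sub>A x)) w) = d *\<^sub>A uprod (map (u(i := x)) w)"
    if "w \<in> permutations_of_set S" for w
    using assms that by (intro uprod_slot_scale) (auto simp: permutations_of_set_def)
  then show ?thesis unfolding multilinear_eval_def
    by (subst scale_sum) (auto simp: cl scale_closed scale_scale mult.commute intro!: sum.cong)
qed

lemma multilinear_eval_zero:
  assumes "\<And>j. j \<in> S \<Longrightarrow> u j \<in> carr" "i \<in> S" "u i = 0"
  shows "multilinear_eval A e S c u = 0"
  unfolding multilinear_eval_def
proof (intro sum.neutral ballI)
  fix w assume w: "w \<in> permutations_of_set S"
  then have "uprod (map u w) = 0"
    using assms by (intro uprod_zero[of w u i]) (auto simp: permutations_of_set_def)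
  then show "c w *\<^sub>A uprod (map u w) = 0" by simp
qed

lemma multilinear_eval_restrict:
  assumes "finite S" "T \<subseteq> S" "\<And>i. i \<in> S \<Longrightarrow> u i \<in> carr" "\<And>i. i \<in> S - T \<Longrightarrow> u i = e"
  shows "multilinear_eval A e S c u = multilinear_eval A e T (restrict_coeffs S T c) u"
proof -
  let ?f = "filter (\<lambda>i. i \<in> T)"
  have "multilinear_eval A e S c u = (\<Sum>w\<in>permutations_of_set S. c w *\<^sub>A uprod (map u (?f w)))"
    unfolding multilinear_eval_def
  proof (rule sum.cong[OF refl])
    fix w assume "w \<in> permutations_of_set S"
    then have "set w = S" by (simp add: permutations_of_set_def)
    then show "c w *\<^sub>A uprod (map u w) = c w *\<^sub>A uprod (map u (?f w))"
      using assms by (subst uprod_filter[of w u "\<lambda>i. i \<in> T"]) auto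
  qed
  also have "\<dots> = (\<Sum>w'\<in>permutations_of_set T. \<Sum>w | w \<in> permutations_of_set S \<and> ?f w = w'.
      c w *\<^sub>A uprod (map u (?f w)))"
    using filter_in_permutations_of_set[OF _ assms(2)] by (subst sum.group) auto
  also have "\<dots> = multilinear_eval A e T (restrict_coeffs S T c) u"
    unfolding multilinear_eval_def
  proof (rule sum.cong[OF refl])
    fix w' assume "w' \<in> permutations_of_set T"
    then have "uprod (map u w') \<in> carr" using assms by (intro uprod_perm_closed[of w' T]) auto
    then show "(\<Sum>w | w \<in> permutations_of_set S \<and> ?f w = w'. c w *\<^sub>A uprod (map u (?f w))) =
        restrict_coeffs S T c w' *\<^sub>A uprod (map u w')"
      by (simp add: restrict_coeffs_def scale_sum_left)
  qed
  finally show ?thesis .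
qed

lemma multilinear_eval_empty: "multilinear_eval A e {} c u = c [] *\<^sub>A e"
  by (simp add: multilinear_eval_def)

lemma multilinear_eval_single: "u i \<in> carr \<Longrightarrow> multilinear_eval A e {i} c u = c [i] *\<^sub>A u i"
  by (simp add: multilinear_eval_def unit_right)

lemma multilinear_eval_pair:
  assumes "i \<noteq> j" "u i \<in> carr" "u j \<in> carr"
  shows "multilinear_eval A e {i, j} c u = c [i, j] *\<^sub>A (u i \<bullet> u j) + c [j, i] *\<^sub>A (u j \<bullet> u i)"
  using assms by (simp add: multilinear_eval_def permutations_of_set_doubleton unit_right)

end

section \<open>Polarization of graded identities\<close>

context unital_graded
begin

lemma alg_prod_list_closed: "set xs \<subseteq> carr \<Longrightarrow> alg_prod_list A xs \<in> carr"
  by (cases "xs = []") (auto simp: zero_closed alg_prod_list_eq_uprod uprod_closed)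

lemma poly_eval_superset:
  assumes "\<And>x. \<phi> x \<in> carr" "finite K" "Poly_Mapping.keys f \<subseteq> K"
  shows "poly_eval A \<phi> f = (\<Sum>w\<in>K. Poly_Mapping.lookup f w *\<^sub>A alg_prod_list A (map \<phi> w))"
  unfolding poly_eval_def
proof (rule sum.mono_neutral_left[OF assms(2,3)], rule ballI)
  fix w assume "w \<in> K - Poly_Mapping.keys f"
  moreover have "alg_prod_list A (map \<phi> w) \<in> carr"
    using assms(1) by (intro alg_prod_list_closed) auto
  ultimately show "Poly_Mapping.lookup f w *\<^sub>A alg_prod_list A (map \<phi> w) = 0"
    by (simp add: in_keys_iff scale_zero_left)
qed

text \<open>A substitute for the Vandermonde determinant. Subtracting 2^(d+1) times the relation at
  t from the relation at 2t removes the top coefficient and multiplies the n-th one by 2^n -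
  2^(d+1), which is nonzero in characteristic 0.\<close>

lemma vanishing_coefficients:
  assumes "\<And>n. a n \<in> carr" "\<And>t. (\<Sum>n\<le>d. t ^ n *\<^sub>A a n) = 0" "n \<le> d"
  shows "a n = 0"
  using assms
proof (induction d arbitrary: a n)
  case 0
  then show ?case by (simp add: scale_one)
next
  case (Suc d)
  let ?q = "\<lambda>n. (2::'a) ^ n - 2 ^ Suc d"
  have 0: "a n = 0" if "n \<le> d" for n
  proof -
    have "?q n *\<^sub>A a n = 0"
    proof (rule Suc.IH[of "\<lambda>n. ?q n *\<^sub>A a n"])
      fix t :: 'a
      have "(\<Sum>n\<le>d. t ^ n *\<^sub>A (?q n *\<^sub>A a n)) = (\<Sum>n\<le>Suc d. t ^ n *\<^sub>A (?q n *\<^sub>A a n))"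
        by (simp add: scale_zero_left Suc.prems)
      also have "\<dots> = (\<Sum>n\<le>Suc d. (2 * t) ^ n *\<^sub>A a n + (- (2 ^ Suc d)) *\<^sub>A (t ^ n *\<^sub>A a n))"
        by (intro sum.cong[OF refl])
           (simp add: scale_scale Suc.prems(1) scale_add_left[symmetric] algebra_simps power_mult_distrib)
      also have "\<dots> = (\<Sum>n\<le>Suc d. (2 * t) ^ n *\<^sub>A a n) + (- (2 ^ Suc d)) *\<^sub>A (\<Sum>n\<le>Suc d. t ^ n *\<^sub>A a n)"
        unfolding sum.distrib by (subst scale_sum) (auto intro: scale_closed Suc.prems)
      also have "\<dots> = 0"
        unfolding Suc.prems(2) by simp
      finally show "(\<Sum>n\<le>d. t ^ n *\<^sub>A (?q n *\<^sub>A a n)) = 0" .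
    qed (use that Suc.prems(1) in \<open>auto intro: scale_closed\<close>)
    moreover have "?q n \<noteq> 0"
    proof
      assume "?q n = 0"
      then have "of_nat (2 ^ n) = (of_nat (2 ^ Suc d) :: 'a)" by simp
      then have "(2::nat) ^ n = 2 ^ Suc d" unfolding of_nat_eq_iff .
      then have "n = Suc d" by (rule power_inject_exp[THEN iffD1, rotated]) simp
      then show False using that by simp
    qed
    ultimately show ?thesis using scale_cancel Suc.prems(1) by blast
  qed
  have "a (Suc d) = 0"
    using Suc.prems(2)[of 1] by (simp add: scale_one Suc.prems(1) 0)
  then show ?case using 0 Suc.prems(3) le_Suc_eq by blast
qed

lemma uprod_scale:
  assumes "\<And>x. x \<in> set w \<Longrightarrow> \<psi> x \<in> carr"
  shows "uprod (map (\<lambda>x. t *\<^sub>A \<psi> x) w) = t ^ length w *\<^sub>A uprod (map \<psi> w)"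
  using assms
proof (induction w)
  case (Cons x w)
  have "uprod (map \<psi> w) \<in> carr" using Cons.prems by (intro uprod_closed) auto
  then show ?case
    using Cons by (simp add: mult_scale_left mult_scale_right scale_closed mult_closed scale_scale mult.commute)
qed (simp add: scale_one unit_closed)

text \<open>Distributivity: picking one summand in every factor means picking a word over
  \<open>T\<close> that \<open>p\<close> maps letter by letter to \<open>xs\<close>.\<close>

lemma uprod_sum:
  assumes "finite T" "\<And>k. k \<in> T \<Longrightarrow> u k \<in> carr"
  shows "uprod (map (\<lambda>x. \<Sum>k | k \<in> T \<and> p k = x. u k) xs) =
    (\<Sum>w | set w \<subseteq> T \<and> map p w = xs. uprod (map u w))"
proof (induction xs)
  case Nil
  have "{w. set w \<subseteq> T \<and> map p w = []} = {[]}" by auto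
  then show ?case by simp
next
  case (Cons x xs)
  let ?W = "\<lambda>xs. {w. set w \<subseteq> T \<and> map p w = xs}" and ?T = "{k \<in> T. p k = x}"
  have cl: "uprod (map u w) \<in> carr" if "w \<in> ?W xs" for w
    using that assms by (intro uprod_closed) auto
  have "?W (x # xs) = (\<lambda>(k, w). k # w) ` (?T \<times> ?W xs)"
    by (auto simp: image_iff map_eq_Cons_conv)
  then have "(\<Sum>w\<in>?W (x # xs). uprod (map u w)) =
      (\<Sum>kw\<in>?T \<times> ?W xs. u (fst kw) \<bullet> uprod (map u (snd kw)))"
    by (simp add: sum.reindex inj_on_def case_prod_unfold)
  also have "\<dots> = (\<Sum>k\<in>?T. \<Sum>w\<in>?W xs. u k \<bullet> uprod (map u w))"
    by (simp add: sum.cartesian_product case_prod_unfold)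
  also have "\<dots> = (\<Sum>k\<in>?T. u k \<bullet> (\<Sum>w\<in>?W xs. uprod (map u w)))"
    by (intro sum.cong[OF refl] mult_sum_right[symmetric] cl) (auto simp: assms)
  also have "\<dots> = (\<Sum>k\<in>?T. u k) \<bullet> (\<Sum>w\<in>?W xs. uprod (map u w))"
    by (subst mult_sum_left) (auto intro: sum_closed cl assms)
  finally show ?case using Cons.IH by simp
qed

lemma permutations_of_lessThan:
  "permutations_of_set {..<n} = {w. set w = {..<n} \<and> length w = n}"
proof (intro set_eqI iffI)
  fix w assume "w \<in> permutations_of_set {..<n}"
  then show "w \<in> {w. set w = {..<n} \<and> length w = n}"
    using distinct_card[of w] by (auto simp: permutations_of_set_def)
next
  fix w assume "w \<in> {w. set w = {..<n} \<and> length w = n}"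
  then show "w \<in> permutations_of_set {..<n}"
    using card_distinct[of w] by (simp add: permutations_of_set_def)
qed

text \<open>
  Polarization: substitute for each variable \<open>x\<close> the sum of all \<open>t u\<^sub>k\<close> with \<open>v\<^sub>k = x\<close> and \<open>k \<in> T\<close>. Varying
  the scalar \<open>t\<close> isolates the words of length \<open>n\<close>, and varying the set \<open>T\<close> the permutations among them.
\<close>

lemma graded_identity_polarize:
  assumes f: "f \<in> graded_identities A"
    and u: "\<And>k. k < length v \<Longrightarrow> u k \<in> hom (snd (v ! k))"
  shows "multilinear_eval A e {..<length v} (\<lambda>w. Poly_Mapping.lookup f (map (nth v) w)) u = 0"
proof -
  define n where "n = length v"
  define K where "K = Poly_Mapping.keys f"
  have finK: "finite K" by (simp add: K_def)
  have ne: "w \<noteq> []" if "w \<in> K" for w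
    using f that by (auto simp: graded_identities_def free_graded_algebra_def K_def)
  define G where "G = (\<lambda>w. Poly_Mapping.lookup f (map (nth v) w) *\<^sub>A uprod (map u w))"
  have words: "(\<Sum>w | set w \<subseteq> T \<and> length w = n. G w) = 0" if T: "T \<subseteq> {..<n}" for T
  proof -
    have finT: "finite T" using T finite_subset by blast
    have uT: "u k \<in> carr" if "k \<in> T" for k using u[of k] that T hom_carr n_def by auto
    define \<psi> where "\<psi> = (\<lambda>x. \<Sum>k | k \<in> T \<and> v ! k = x. u k)"
    have \<psi>h: "\<psi> (i, g) \<in> hom g" for i g
      unfolding \<psi>_def using T u n_def by (intro sum_homogeneous) (auto, metis lessThan_iff snd_conv subsetD)
    have \<psi>: "\<psi> x \<in> carr" for x using hom_carr[OF \<psi>h[of "fst x" "snd x"]] by simp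
    \<comment> \<open>The bound has to cover n as well as the lengths of the monomials, since
      \<open>f\<close> need not contain a monomial of length n.\<close>
    obtain d where d: "n \<le> d" "length ` K \<subseteq> {..d}"
    proof
      show "n \<le> max n (Max (length ` K))" by simp
      show "length ` K \<subseteq> {..max n (Max (length ` K))}" using finK by (auto simp: le_max_iff_disj)
    qed
    define a where "a = (\<lambda>m. \<Sum>x | x \<in> K \<and> length x = m. Poly_Mapping.lookup f x *\<^sub>A uprod (map \<psi> x))"
    have cl: "Poly_Mapping.lookup f x *\<^sub>A uprod (map \<psi> x) \<in> carr" for x
      by (intro scale_closed uprod_closed) (auto simp: \<psi>)
    have "a n = 0"
    proof (rule vanishing_coefficients[of a d])
      fix t :: 'a
      let ?\<phi> = "\<lambda>x. t *\<^sub>A \<psi> x"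
      have "0 = poly_eval A ?\<phi> f"
        using f homogeneous_scale[OF \<psi>h] by (auto simp: graded_identities_def)
      also have "\<dots> = (\<Sum>x\<in>K. t ^ length x *\<^sub>A (Poly_Mapping.lookup f x *\<^sub>A uprod (map \<psi> x)))"
        unfolding poly_eval_def K_def[symmetric]
      proof (rule sum.cong[OF refl])
        fix x assume "x \<in> K"
        then have "alg_prod_list A (map ?\<phi> x) = t ^ length x *\<^sub>A uprod (map \<psi> x)"
          using ne \<psi> uprod_scale[of x \<psi> t] by (subst alg_prod_list_eq_uprod) (auto intro: scale_closed)
        then show "Poly_Mapping.lookup f x *\<^sub>A alg_prod_list A (map ?\<phi> x) =
            t ^ length x *\<^sub>A (Poly_Mapping.lookup f x *\<^sub>A uprod (map \<psi> x))"
          using \<psi> by (simp add: scale_scale uprod_closed image_subset_iff mult.commute)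
      qed
      also have "\<dots> = (\<Sum>m\<le>d. \<Sum>x | x \<in> K \<and> length x = m.
          t ^ length x *\<^sub>A (Poly_Mapping.lookup f x *\<^sub>A uprod (map \<psi> x)))"
        using d finK by (subst sum.group) auto
      also have "\<dots> = (\<Sum>m\<le>d. t ^ m *\<^sub>A a m)"
        unfolding a_def by (intro sum.cong[OF refl]) (subst scale_sum, auto simp: cl)
      finally show "(\<Sum>m\<le>d. t ^ m *\<^sub>A a m) = 0" by simp
    qed (use d in \<open>auto simp: a_def intro: sum_closed cl\<close>)
    \<comment> \<open>A word over \<open>T\<close> contributes only if \<open>v\<close> turns it
      into a monomial of \<open>f\<close>; grouping the contributing words by that monomial
      reassembles \<open>a n\<close>.\<close>
    define S where "S = {w. set w \<subseteq> T \<and> length w = n \<and> map (nth v) w \<in> K}"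
    have finS: "finite {w. set w \<subseteq> T \<and> length w = n}"
      by (rule finite_lists_length_eq[OF finT])
    then have "finite S" by (rule finite_subset[rotated]) (auto simp: S_def)
    have "(\<Sum>w | set w \<subseteq> T \<and> length w = n. G w) = (\<Sum>w\<in>S. G w)"
    proof (rule sum.mono_neutral_right[OF finS])
      show "\<forall>w\<in>{w. set w \<subseteq> T \<and> length w = n} - S. G w = 0"
      proof
        fix w assume w: "w \<in> {w. set w \<subseteq> T \<and> length w = n} - S"
        then have "uprod (map u w) \<in> carr" using uT by (intro uprod_closed) auto
        then show "G w = 0" using w by (auto simp: S_def G_def K_def in_keys_iff scale_zero_left)
      qed
    qed (auto simp: S_def)
    also have "\<dots> = (\<Sum>x | x \<in> K \<and> length x = n. \<Sum>w | w \<in> S \<and> map (nth v) w = x. G w)"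
      using \<open>finite S\<close> finK by (subst sum.group) (auto simp: S_def)
    also have "\<dots> = a n"
      unfolding a_def
    proof (rule sum.cong[OF refl])
      fix x assume x: "x \<in> {x. x \<in> K \<and> length x = n}"
      then have S: "{w. w \<in> S \<and> map (nth v) w = x} = {w. set w \<subseteq> T \<and> map (nth v) w = x}"
        by (auto simp: S_def)
      have "uprod (map \<psi> x) = (\<Sum>w | set w \<subseteq> T \<and> map (nth v) w = x. uprod (map u w))"
        unfolding \<psi>_def by (rule uprod_sum[OF finT uT])
      then have "Poly_Mapping.lookup f x *\<^sub>A uprod (map \<psi> x) =
          (\<Sum>w | set w \<subseteq> T \<and> map (nth v) w = x. Poly_Mapping.lookup f x *\<^sub>A uprod (map u w))"
        by (simp only:) (intro scale_sum uprod_closed, use uT in auto)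
      then show "(\<Sum>w | w \<in> S \<and> map (nth v) w = x. G w) = Poly_Mapping.lookup f x *\<^sub>A uprod (map \<psi> x)"
        unfolding S by (simp add: G_def)
    qed
    finally show ?thesis using \<open>a n = 0\<close> by simp
  qed
  \<comment> \<open>Induction over subsets takes the place of inclusion-exclusion: the words with
    letters in \<open>T\<close> are sorted by their exact letter set, and the proper subsets already
    contribute 0. For \<open>T\<close> all of \<open>{..<n}\<close>, the words of length n that
    remain are the permutations.\<close>
  have "(\<Sum>w | set w = T \<and> length w = n. G w) = 0" if T: "T \<subseteq> {..<n}" for T
  proof -
    have "finite T" using T finite_subset by blast
    then show ?thesis using T
    proof (induction T rule: finite_psubset_induct)
      case (psubset T)
      let ?a = "\<lambda>T. \<Sum>w | set w = T \<and> length w = n. G w"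
      have "0 = (\<Sum>w | set w \<subseteq> T \<and> length w = n. G w)" using words psubset.prems by simp
      also have "\<dots> = (\<Sum>T'\<in>Pow T. \<Sum>w | w \<in> {w. set w \<subseteq> T \<and> length w = n} \<and> set w = T'. G w)"
        using psubset.hyps finite_lists_length_eq[OF psubset.hyps(1)] by (subst sum.group) auto
      also have "\<dots> = (\<Sum>T'\<in>Pow T. ?a T')"
        by (intro sum.cong[OF refl]) (auto intro!: sum.cong)
      also have "\<dots> = ?a T + (\<Sum>T'\<in>Pow T - {T}. ?a T')"
        using psubset.hyps by (subst sum.remove[of _ T]) auto
      also have "(\<Sum>T'\<in>Pow T - {T}. ?a T') = 0"
        using psubset by (intro sum.neutral) auto
      finally show ?case by simp
    qed
  qed
  from this[of "{..<n}"] show ?thesis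
    by (simp add: multilinear_eval_def permutations_of_lessThan n_def G_def)
qed

text \<open>
  Averaging over all permutations of the positions recovers each homogeneous component of a polynomial from
  its polarizations.
\<close>

lemma graded_identity_from_polarizations:
  assumes f: "f \<in> free_graded_algebra"
    and pol: "\<And>v. v \<noteq> [] \<Longrightarrow> multilinear_identity A e {..<length v} (\<lambda>k. snd (v ! k))
        (\<lambda>w. Poly_Mapping.lookup f (map (nth v) w))"
  shows "f \<in> graded_identities A"
  unfolding graded_identities_def
proof (intro CollectI conjI f allI impI)
  fix \<phi> :: "nat \<times> 'g \<Rightarrow> 'v" assume \<phi>: "\<forall>i g. \<phi> (i, g) \<in> hom g"
  then have \<phi>c: "\<phi> x \<in> carr" for x by (cases x) (auto intro: hom_carr)
  define K where "K = Poly_Mapping.keys f"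
  have finK: "finite K" by (simp add: K_def)
  have ne: "w \<noteq> []" if "w \<in> K" for w
    using f that by (auto simp: graded_identities_def free_graded_algebra_def K_def)
  define X where "X = \<Union> (set ` K)"
  have finX: "finite X" using finK by (simp add: X_def)
  define G where "G = (\<lambda>x. Poly_Mapping.lookup f x *\<^sub>A uprod (map \<phi> x))"
  have Gc: "G x \<in> carr" for x unfolding G_def by (intro scale_closed uprod_closed) (auto simp: \<phi>c)
  have len: "(\<Sum>x | x \<in> K \<and> length x = n. G x) = 0" for n
  proof (cases "n = 0")
    case True
    then show ?thesis using ne by (intro sum.neutral) auto
  next
    case False
    \<comment> \<open>Unlike the set of monomials of \<open>f\<close>, the set \<open>L\<close> is
      closed under permuting positions. Each permutation therefore only reindexes the sum over
      \<open>L\<close>, and the double sum is n! times the simple one.\<close>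
    define L where "L = {x. set x \<subseteq> X \<and> length x = n}"
    define P where "P = permutations_of_set {..<n}"
    have finL: "finite L" unfolding L_def by (rule finite_lists_length_eq[OF finX])
    have "(\<Sum>w\<in>P. G (map (nth x) w)) = 0" if "x \<in> L" for x
    proof -
      have "length x = n" using that by (simp add: L_def)
      then have "multilinear_eval A e {..<n} (\<lambda>w. Poly_Mapping.lookup f (map (nth x) w)) (\<lambda>k. \<phi> (x ! k)) = 0"
        using pol[of x] False \<phi> by (auto simp: multilinear_identity_def) (metis prod.collapse)
      then show ?thesis by (simp add: multilinear_eval_def G_def P_def comp_def)
    qed
    then have "0 = (\<Sum>x\<in>L. \<Sum>w\<in>P. G (map (nth x) w))" by simp
    also have "\<dots> = (\<Sum>w\<in>P. \<Sum>x\<in>L. G (map (nth x) w))" by (rule sum.swap)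
    also have "\<dots> = (\<Sum>w\<in>P. \<Sum>x\<in>L. G x)"
    proof (rule sum.cong[OF refl])
      fix w assume "w \<in> P"
      then have w: "set w = {..<n}" "length w = n" by (simp_all add: P_def permutations_of_lessThan)
      have "inj_on (\<lambda>x. map (nth x) w) L"
      proof (rule inj_onI)
        fix x y assume "x \<in> L" "y \<in> L" "map (nth x) w = map (nth y) w"
        then show "x = y" using w(1) unfolding L_def map_eq_conv by (simp add: list_eq_iff_nth_eq)
      qed
      moreover have "(\<lambda>x. map (nth x) w) ` L \<subseteq> L"
      proof
        fix y assume "y \<in> (\<lambda>x. map (nth x) w) ` L"
        then obtain x where x: "x \<in> L" "y = map (nth x) w" by blast
        then have "x ! k \<in> X" if "k < n" for k
          using that nth_mem[of k x] unfolding L_def by blast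
        then show "y \<in> L" using w x by (simp add: L_def image_subset_iff)
      qed
      ultimately have "bij_betw (\<lambda>x. map (nth x) w) L L"
        using endo_inj_surj[OF finL] by (auto simp: bij_betw_def)
      then show "(\<Sum>x\<in>L. G (map (nth x) w)) = (\<Sum>x\<in>L. G x)"
        by (rule sum.reindex_bij_betw)
    qed
    also have "\<dots> = (\<Sum>w\<in>P. 1 *\<^sub>A (\<Sum>x\<in>L. G x))" by (simp add: scale_one sum_closed Gc)
    also have "\<dots> = (\<Sum>w\<in>P. 1) *\<^sub>A (\<Sum>x\<in>L. G x)" by (rule scale_sum_left[symmetric]) (simp add: sum_closed Gc)
    finally have "of_nat (fact n) *\<^sub>A (\<Sum>x\<in>L. G x) = 0" by (simp add: P_def)
    moreover have "(of_nat (fact n) :: 'a) \<noteq> 0" by simp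
    ultimately have "(\<Sum>x\<in>L. G x) = 0" using scale_cancel sum_closed Gc by meson
    moreover have "(\<Sum>x | x \<in> K \<and> length x = n. G x) = (\<Sum>x\<in>L. G x)"
    proof (rule sum.mono_neutral_left[OF finL])
      show "\<forall>x\<in>L - {x. x \<in> K \<and> length x = n}. G x = 0"
        by (auto simp: L_def G_def K_def in_keys_iff intro!: scale_zero_left uprod_closed \<phi>c)
    qed (auto simp: L_def X_def)
    ultimately show ?thesis by simp
  qed
  have "poly_eval A \<phi> f = (\<Sum>x\<in>K. G x)"
    unfolding poly_eval_def K_def[symmetric] G_def
    by (intro sum.cong[OF refl], subst alg_prod_list_eq_uprod) (auto simp: ne \<phi>c)
  also have "\<dots> = (\<Sum>n\<in>length ` K. \<Sum>x | x \<in> K \<and> length x = n. G x)"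
    using finK by (subst sum.group) auto
  also have "\<dots> = 0" using len by simp
  finally show "poly_eval A \<phi> f = 0" .
qed

end

subsection \<open>Algebras whose identities are determined in degree two\<close>

text \<open>A variable of nonzero degree cannot be replaced by the unit, so it always counts among
  the at most two exceptional positions.\<close>

definition determined_by_pairs :: "('g::zero, 'a, 'v::ab_group_add) graded_alg \<Rightarrow> 'v \<Rightarrow> bool" where
  "determined_by_pairs A e \<longleftrightarrow> (\<forall>n h c.
     (\<forall>u. (\<forall>i<n. u i \<in> homogeneous A (h i)) \<and> card {i. i < n \<and> (h i \<noteq> 0 \<or> u i \<noteq> e)} \<le> 2 \<longrightarrow>
        multilinear_eval A e {..<n} c u = 0) \<longrightarrow>
     multilinear_identity A e {..<n} h c)"

text \<open>After polarization and substitution of units in all but two places, only a bilinear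
  condition on the coefficients of \<open>f\<close> is left. It holds in every member of
  \<open>\<X>\<close>, hence in \<open>Y\<close>, and \<open>Y\<close> detects identities by such
  substitutions. With a single algebra as \<open>\<X>\<close> this passes to a summand; with a set
  of summands as \<open>\<X>\<close> it leads back.\<close>

lemma graded_identity_transfer:
  assumes Y: "unital_graded Y e" "determined_by_pairs Y e"
    and unital: "\<And>X. X \<in> \<X> \<Longrightarrow> \<exists>e. unital_graded X e"
    and bilinear: "\<And>g h a b. (\<And>X. X \<in> \<X> \<Longrightarrow> bilinear_identity X g h a b) \<Longrightarrow> bilinear_identity Y g h a b"
    and f: "\<And>X. X \<in> \<X> \<Longrightarrow> f \<in> graded_identities X" "f \<in> free_graded_algebra"
  shows "f \<in> graded_identities Y"
proof -
  interpret Y: unital_graded Y e by (rule Y)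
  show ?thesis
  proof (rule Y.graded_identity_from_polarizations[OF f(2)])
    fix v :: "(nat \<times> 'a) list" assume "v \<noteq> []"
    define n where "n = length v"
    define h where "h = (\<lambda>k. snd (v ! k))"
    define c where "c = (\<lambda>w. Poly_Mapping.lookup f (map (nth v) w))"
    have "multilinear_identity Y e {..<n} h c"
    proof (rule Y(2)[unfolded determined_by_pairs_def, rule_format])
      fix u assume u: "(\<forall>i<n. u i \<in> homogeneous Y (h i)) \<and> card {i. i < n \<and> (h i \<noteq> 0 \<or> u i \<noteq> e)} \<le> 2"
      define S where "S = {i. i < n \<and> (h i \<noteq> 0 \<or> u i \<noteq> e)}"
      have S: "S \<subseteq> {..<n}" "finite S" "card S \<le> 2" using u by (auto simp: S_def)
      have off_S: "h i = 0" "u i = e" if "i < n" "i \<notin> S" for i using that by (auto simp: S_def)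
      define cS where "cS = restrict_coeffs {..<n} S c"
      have uS: "u i \<in> homogeneous Y (h i)" if "i \<in> S" for i using that u S by auto
      \<comment> \<open>The set \<open>S\<close> was read off from a substitution in
        \<open>Y\<close>, but all degrees outside \<open>S\<close> are 0, so units may be
        substituted there in \<open>X\<close> too.\<close>
      have X0: "multilinear_eval X eX S cS u' = 0"
        if X: "X \<in> \<X>" "unital_graded X eX" and u': "\<And>i. i \<in> S \<Longrightarrow> u' i \<in> homogeneous X (h i)" for X eX u'
      proof -
        interpret X: unital_graded X eX by (rule X)
        let ?u = "\<lambda>i. if i \<in> S then u' i else eX"
        have uh: "?u i \<in> X.hom (h i)" if "i < n" for i
          using that off_S u' X.unit_homogeneous by auto
        have "0 = multilinear_eval X eX {..<n} c ?u"
          unfolding c_def n_def using uh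
          by (intro X.graded_identity_polarize[symmetric] f X) (auto simp: n_def h_def)
        also have "\<dots> = multilinear_eval X eX S cS ?u"
          unfolding cS_def using S X.hom_carr[OF uh] by (intro X.multilinear_eval_restrict) auto
        also have "\<dots> = multilinear_eval X eX S cS u'"
          unfolding multilinear_eval_def permutations_of_set_def
          by (intro sum.cong[OF refl] arg_cong[of _ _ "\<lambda>x. alg_scale X _ (unital_prod X eX x)"]) auto
        finally show ?thesis by simp
      qed
      have "multilinear_eval Y e {..<n} c u = multilinear_eval Y e S cS u"
        unfolding cS_def using S u off_S by (intro Y.multilinear_eval_restrict) (auto intro: Y.hom_carr)
      also have "\<dots> = 0"
      proof -
        have "card S = 0 \<or> card S = 1 \<or> card S = 2" using S by linarith
        then consider "S = {}" | i where "S = {i}" | i j where "i \<noteq> j" "S = {i, j}"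
          using S by (auto simp: card_1_singleton_iff card_2_iff)
        then show ?thesis
        proof cases
          \<comment> \<open>Constant and linear polynomials are brought under the bilinear
            hypothesis by taking second coefficient 0 and degree 0 for each missing factor, which is
            then specialized to the unit.\<close>
          case 1
          have "bilinear_identity Y 0 0 (cS []) 0"
          proof (rule bilinear)
            fix X assume X: "X \<in> \<X>"
            then obtain eX where eX: "unital_graded X eX" using unital by blast
            interpret X: unital_graded X eX by (rule eX)
            have 0: "alg_scale X (cS []) eX = 0" using X0[OF X eX, of "\<lambda>_. 0"] 1 by (simp add: X.multilinear_eval_empty)
            show "bilinear_identity X 0 0 (cS []) 0" unfolding bilinear_identity_def
            proof (intro ballI)
              fix x y assume "x \<in> X.hom 0" "y \<in> X.hom 0"
              then have c: "x \<in> X.carr" "y \<in> X.carr" by (auto intro: X.hom_carr)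
              have "alg_scale X (cS []) (alg_mult X x y) = alg_mult X (alg_scale X (cS []) eX) (alg_mult X x y)"
                using c by (simp add: X.mult_scale_left X.mult_closed X.unit_closed X.unit_left)
              then show "alg_scale X (cS []) (alg_mult X x y) + alg_scale X 0 (alg_mult X y x) = 0"
                using c 0 by (simp add: X.mult_zero_left X.mult_closed X.scale_zero_left)
            qed
          qed
          then show ?thesis using 1 Y.unit_homogeneous
            by (force simp: bilinear_identity_def Y.multilinear_eval_empty Y.unit_left Y.unit_closed Y.scale_zero_left)
        next
          case (2 i)
          have "bilinear_identity Y (h i) 0 (cS [i]) 0"
          proof (rule bilinear)
            fix X assume X: "X \<in> \<X>"
            then obtain eX where eX: "unital_graded X eX" using unital by blast
            interpret X: unital_graded X eX by (rule eX)
            show "bilinear_identity X (h i) 0 (cS [i]) 0" unfolding bilinear_identity_def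
            proof (intro ballI)
              fix x y assume x: "x \<in> X.hom (h i)" "y \<in> X.hom 0"
              then have c: "x \<in> X.carr" "y \<in> X.carr" by (auto intro: X.hom_carr)
              have "alg_scale X (cS [i]) x = 0"
                using X0[OF X eX, of "\<lambda>_. x"] 2 x c by (simp add: X.multilinear_eval_single)
              then show "alg_scale X (cS [i]) (alg_mult X x y) + alg_scale X 0 (alg_mult X y x) = 0"
                using c X.mult_scale_left[of x y "cS [i]"]
                by (simp add: X.mult_zero_left X.mult_closed X.scale_zero_left)
            qed
          qed
          then have "alg_scale Y (cS [i]) (alg_mult Y (u i) e) + alg_scale Y 0 (alg_mult Y e (u i)) = 0"
            using uS[of i] 2 Y.unit_homogeneous by (auto simp: bilinear_identity_def)
          then show ?thesis using 2 Y.hom_carr[OF uS[of i]]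
            by (simp add: Y.multilinear_eval_single Y.unit_left Y.unit_right Y.scale_zero_left)
        next
          case (3 i j)
          have "bilinear_identity Y (h i) (h j) (cS [i, j]) (cS [j, i])"
          proof (rule bilinear)
            fix X assume X: "X \<in> \<X>"
            then obtain eX where eX: "unital_graded X eX" using unital by blast
            interpret X: unital_graded X eX by (rule eX)
            show "bilinear_identity X (h i) (h j) (cS [i, j]) (cS [j, i])" unfolding bilinear_identity_def
            proof (intro ballI)
              fix x y assume x: "x \<in> X.hom (h i)" "y \<in> X.hom (h j)"
              then have c: "x \<in> X.carr" "y \<in> X.carr" by (auto intro: X.hom_carr)
              show "alg_scale X (cS [i, j]) (alg_mult X x y) + alg_scale X (cS [j, i]) (alg_mult X y x) = 0"
              proof -
                have "multilinear_eval X eX S cS (\<lambda>k. if k = i then x else y) = 0"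
                  using 3 x by (intro X0 X eX) auto
                then show ?thesis using 3 c by (simp add: X.multilinear_eval_pair)
              qed
            qed
          qed
          then show ?thesis using uS[of i] uS[of j] 3
            by (auto simp: bilinear_identity_def Y.multilinear_eval_pair Y.hom_carr)
        qed
      qed
      finally show "multilinear_eval Y e {..<n} c u = 0" .
    qed
    then show "multilinear_identity Y e {..<length v} (\<lambda>k. snd (v ! k)) (\<lambda>w. Poly_Mapping.lookup f (map (nth v) w))"
      by (simp add: n_def h_def c_def)
  qed
qed

section \<open>Algebras F + J with J^3 = 0, given by a basis\<close>

interpretation coeff: vector_space coeff_scale
  by unfold_locales (auto simp: coeff_scale_def fun_eq_iff algebra_simps)

text \<open>Here \<open>js\<close> is a homogeneous spanning list of J. Bilinearity is asked on the
  whole ambient type, so that for a concrete summand the remaining axioms reduce to finitely many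
  products of basis elements.\<close>

locale nilpotent_basis =
  fixes mul :: "(nat \<Rightarrow> nat \<Rightarrow> 'a::field_char_0) \<Rightarrow> (nat \<Rightarrow> nat \<Rightarrow> 'a) \<Rightarrow> nat \<Rightarrow> nat \<Rightarrow> 'a"
    and one :: "nat \<Rightarrow> nat \<Rightarrow> 'a"
    and js :: "((nat \<Rightarrow> nat \<Rightarrow> 'a) \<times> 'g::{group_add,finite}) list"
  assumes mul_add_left: "mul (x + y) z = mul x z + mul y z"
    and mul_add_right: "mul x (y + z) = mul x y + mul x z"
    and mul_scale_left: "mul (coeff_scale c x) y = coeff_scale c (mul x y)"
    and mul_scale_right: "mul x (coeff_scale c y) = coeff_scale c (mul x y)"
    and one_one: "mul one one = one"
    and one_left: "x \<in> fst ` set js \<Longrightarrow> mul one x = x"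
    and one_right: "x \<in> fst ` set js \<Longrightarrow> mul x one = x"
    and mul_span: "\<lbrakk>x \<in> fst ` set js; y \<in> fst ` set js\<rbrakk> \<Longrightarrow> mul x y \<in> coeff.span (fst ` set js)"
    and mul_nilpotent:
      "\<lbrakk>x \<in> fst ` set js; y \<in> fst ` set js; z \<in> fst ` set js\<rbrakk> \<Longrightarrow> mul x (mul y z) = 0"
begin

abbreviation bs where "bs \<equiv> (one, 0) # js"
abbreviation alg where "alg \<equiv> basis_algebra mul bs"

lemma mul_zero_right: "mul x 0 = 0"
  using mul_add_right[of x 0 0] by simp

lemma mul_zero_left: "mul 0 x = 0"
  using mul_add_left[of 0 0 x] by simp

lemma alg_simps [simp]:
  "alg_carrier alg = coeff.span (fst ` set bs)" "alg_scale alg = coeff_scale" "alg_mult alg = mul"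
  "homogeneous alg g = coeff.span {b. (b, g) \<in> set bs}"
  by (simp_all only: basis_algebra_def graded_alg.simps)

lemma subspace_mul_left: "coeff.subspace V \<Longrightarrow> coeff.subspace {x. mul x y \<in> V}"
  unfolding coeff.subspace_def by (auto simp: mul_zero_left mul_add_left mul_scale_left)

lemma subspace_mul_right: "coeff.subspace V \<Longrightarrow> coeff.subspace {y. mul x y \<in> V}"
  unfolding coeff.subspace_def by (auto simp: mul_zero_right mul_add_right mul_scale_right)

lemma unital_graded_alg: "unital_graded alg one"
proof
  have gen: "mul x y \<in> coeff.span (fst ` set bs)" if "x \<in> fst ` set bs" "y \<in> fst ` set bs" for x y
  proof -
    consider "x = one" "y = one" | "x = one" "y \<in> fst ` set js" | "x \<in> fst ` set js" "y = one"
      | "x \<in> fst ` set js" "y \<in> fst ` set js" using \<open>x \<in> _\<close> \<open>y \<in> _\<close> by auto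
    then show ?thesis
    proof cases
      case 4
      then show ?thesis using mul_span coeff.span_mono[of "fst ` set js" "fst ` set bs"] by auto
    qed (use that in \<open>simp_all only: one_one one_left one_right coeff.span_base\<close>)
  qed
  have gen2: "mul x y \<in> coeff.span (fst ` set bs)" if "x \<in> fst ` set bs" "y \<in> coeff.span (fst ` set bs)" for x y
    using coeff.span_induct[OF that(2) subspace_mul_right[OF coeff.subspace_span]] gen[OF that(1)] by blast
  show "alg_mult alg x y \<in> alg_carrier alg" if "x \<in> alg_carrier alg" "y \<in> alg_carrier alg" for x y
    using coeff.span_induct[OF that(1)[unfolded alg_simps] subspace_mul_left[OF coeff.subspace_span]]
      gen2 that(2) unfolding alg_simps by blast
  have sub: "coeff.subspace {x. mul one x = x}" "coeff.subspace {x. mul x one = x}"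
    by (auto simp: coeff.subspace_def mul_zero_left mul_zero_right mul_add_left mul_add_right
        mul_scale_left mul_scale_right)
  show "alg_mult alg one x = x" if "x \<in> alg_carrier alg" for x
    using coeff.span_induct[OF that[unfolded alg_simps] sub(1)] one_left one_one by auto
  show "alg_mult alg x one = x" if "x \<in> alg_carrier alg" for x
    using coeff.span_induct[OF that[unfolded alg_simps] sub(2)] one_right one_one by auto
  show "homogeneous alg g \<subseteq> alg_carrier alg" for g
    unfolding alg_simps by (rule coeff.span_mono) force
  show "one \<in> homogeneous alg 0" unfolding alg_simps by (rule coeff.span_base) simp
qed (simp_all only: alg_simps mul_add_left mul_add_right mul_scale_left mul_scale_right
     coeff.span_zero coeff.span_add coeff.span_scale coeff.scale_right_distrib coeff.scale_left_distrib
     coeff.scale_scale coeff.scale_one)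

sublocale unital_graded alg one
  by (rule unital_graded_alg)

lemma bilinear_identity_basis_iff:
  "bilinear_identity alg g h a b \<longleftrightarrow> (\<forall>x y. (x, g) \<in> set bs \<longrightarrow> (y, h) \<in> set bs \<longrightarrow>
     coeff_scale a (mul x y) + coeff_scale b (mul y x) = 0)" (is "_ \<longleftrightarrow> ?R")
proof
  assume "bilinear_identity alg g h a b"
  then show ?R by (auto simp: bilinear_identity_def coeff.span_base simp del: set_simps)
next
  assume R: ?R
  let ?q = "\<lambda>x y. coeff_scale a (mul x y) + coeff_scale b (mul y x)"
  have "?q x y = 0" if x: "(x, g) \<in> set bs" and y: "y \<in> coeff.span {b. (b, h) \<in> set bs}" for x y
  proof (rule coeff.span_induct[OF y])
    show "coeff.subspace {y. ?q x y = 0}"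
      unfolding coeff.subspace_def
    proof (safe, goal_cases)
      case (2 y z)
      have "?q x (y + z) = ?q x y + ?q x z"
        by (simp add: mul_add_left mul_add_right coeff.scale_right_distrib)
      then show ?case using 2 by simp
    next
      case (3 c y)
      have "?q x (coeff_scale c y) = coeff_scale c (?q x y)"
        by (simp add: mul_scale_left mul_scale_right coeff.scale_right_distrib mult.commute)
      then show ?case using 3 by simp
    qed (simp add: mul_zero_left mul_zero_right)
  qed (use R x in blast)
  then have *: "?q x y = 0" if x: "x \<in> coeff.span {b. (b, g) \<in> set bs}" and y: "y \<in> coeff.span {b. (b, h) \<in> set bs}" for x y
  proof (intro coeff.span_induct[OF x, of "\<lambda>x. ?q x y = 0"])
    show "coeff.subspace {x. ?q x y = 0}"
      unfolding coeff.subspace_def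
    proof (safe, goal_cases)
      case (2 x z)
      have "?q (x + z) y = ?q x y + ?q z y"
        by (simp add: mul_add_left mul_add_right coeff.scale_right_distrib)
      then show ?case using 2 by simp
    next
      case (3 c x)
      have "?q (coeff_scale c x) y = coeff_scale c (?q x y)"
        by (simp add: mul_scale_left mul_scale_right coeff.scale_right_distrib mult.commute)
      then show ?case using 3 by simp
    qed (simp add: mul_zero_left mul_zero_right)
  qed (use y in blast)
  show "bilinear_identity alg g h a b"
    unfolding bilinear_identity_def alg_simps using * by blast
qed

lemma uprod_nilpotent: "\<lbrakk>3 \<le> length xs; set xs \<subseteq> fst ` set js\<rbrakk> \<Longrightarrow> unital_prod alg one xs = 0"
proof (induction xs)
  case (Cons x xs)
  show ?case
  proof (cases "3 \<le> length xs")
    case True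
    have "unital_prod alg one xs = 0"
      by (rule Cons.IH) (use True Cons.prems in simp_all)
    then show ?thesis by (simp only: unital_prod_Cons alg_simps mul_zero_right)
  next
    case False
    then have "length xs = 2" using Cons.prems by simp
    then obtain y z where "xs = [y, z]" by (auto simp: length_Suc_conv numeral_2_eq_2)
    then show ?thesis using Cons.prems by (auto simp: one_right mul_nilpotent)
  qed
qed simp

text \<open>By multilinearity basis elements suffice. If at least three positions carry a basis
  element of J, every word contains a product of three of them and vanishes; all other cases are
  covered by the hypothesis.\<close>

lemma determined_by_pairs_alg: "determined_by_pairs alg one"
  unfolding determined_by_pairs_def
proof (intro allI impI)
  fix n and h :: "nat \<Rightarrow> 'g" and c
  assume small: "\<forall>u. (\<forall>i<n. u i \<in> homogeneous alg (h i)) \<and> card {i. i < n \<and> (h i \<noteq> 0 \<or> u i \<noteq> one)} \<le> 2 \<longrightarrow>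
        multilinear_eval alg one {..<n} c u = 0"
  have basis: "multilinear_eval alg one {..<n} c u = 0" if u: "\<And>i. i < n \<Longrightarrow> (u i, h i) \<in> set bs" for u
  proof (cases "card {i. i < n \<and> (h i \<noteq> 0 \<or> u i \<noteq> one)} \<le> 2")
    case True
    then show ?thesis using small u by (auto simp: coeff.span_base simp del: set_simps)
  next
    case False
    let ?P = "\<lambda>i. i < n \<and> (h i \<noteq> 0 \<or> u i \<noteq> one)"
    have uc: "u i \<in> carr" if "i < n" for i
      using u[OF that] unfolding alg_simps by (intro coeff.span_base) force
    have js: "u i \<in> fst ` set js" if "?P i" for i
      using that u[of i] by (auto simp: image_iff intro: bexI[of _ "(u i, h i)"])
    show ?thesis unfolding multilinear_eval_def
    proof (intro sum.neutral ballI)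
      fix w assume "w \<in> permutations_of_set {..<n}"
      then have w: "distinct w" "set w = {..<n}" by (auto simp: permutations_of_set_def)
      have "unital_prod alg one (map u w) = unital_prod alg one (map u (filter ?P w))"
        using w uc by (intro uprod_filter) auto
      also have "length (filter ?P w) = card (set (filter ?P w))"
        using w by (intro distinct_card[symmetric]) auto
      then have "3 \<le> length (map u (filter ?P w))"
        using False w by (simp add: Collect_conj_eq[symmetric] cong: conj_cong)
      then have "unital_prod alg one (map u (filter ?P w)) = 0"
        using js by (intro uprod_nilpotent) auto
      finally show "alg_scale alg (c w) (unital_prod alg one (map u w)) = 0" by simp
    qed
  qed
  \<comment> \<open>\<open>I\<close> is the set of positions with arbitrary homogeneous values, the
    others carrying basis elements. It is enlarged one position at a time: the values there that
    give 0 form a subspace, which contains the basis elements by induction.\<close>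
  have slots: "multilinear_eval alg one {..<n} c u = 0"
    if "finite I" "I \<subseteq> {..<n}" "\<And>i. i \<in> I \<Longrightarrow> u i \<in> homogeneous alg (h i)"
      "\<And>i. i < n \<Longrightarrow> i \<notin> I \<Longrightarrow> (u i, h i) \<in> set bs" for I u
    using that
  proof (induction I arbitrary: u rule: finite_induct)
    case empty
    then show ?case by (intro basis) auto
  next
    case (insert i I)
    have uc: "u j \<in> carr" if "j < n" for j
    proof (cases "j \<in> insert i I")
      case True
      then show ?thesis using insert.prems(2) hom_carr by blast
    next
      case False
      then have "u j \<in> homogeneous alg (h j)"
        using insert.prems(3)[OF that] unfolding alg_simps by (intro coeff.span_base) auto
      then show ?thesis by (rule hom_carr)
    qed
    have i: "i < n" "u i \<in> coeff.span {b. (b, h i) \<in> set bs}"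
      using insert.prems(1) insert.prems(2)[of i] by auto
    let ?m = "\<lambda>x. multilinear_eval alg one {..<n} c (u(i := x))"
    have "coeff.subspace {x \<in> carr. ?m x = 0}"
      unfolding coeff.subspace_def
    proof (intro conjI ballI allI)
      show "0 \<in> {x \<in> carr. ?m x = 0}"
        using i uc zero_closed by (auto intro!: multilinear_eval_zero[of _ _ i])
      fix x y assume xy: "x \<in> {x \<in> carr. ?m x = 0}" "y \<in> {x \<in> carr. ?m x = 0}"
      have "?m (x + y) = ?m x + ?m y"
        using i uc xy by (intro multilinear_eval_slot_add) auto
      then show "x + y \<in> {x \<in> carr. ?m x = 0}" using xy add_closed by auto
    next
      fix d x assume x: "x \<in> {x \<in> carr. ?m x = 0}"
      have "?m (alg_scale alg d x) = alg_scale alg d (?m x)"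
        using i uc x by (intro multilinear_eval_slot_scale) auto
      then show "coeff_scale d x \<in> {x \<in> carr. ?m x = 0}" using x scale_closed[of x d] by auto
    qed
    moreover have "x \<in> {x \<in> carr. ?m x = 0}" if x: "(x, h i) \<in> set bs" for x
    proof -
      have xc: "x \<in> carr" using x unfolding alg_simps by (intro coeff.span_base) force
      moreover have "?m x = 0"
        using insert.hyps insert.prems x by (intro insert.IH) auto
      ultimately show ?thesis by simp
    qed
    ultimately have "u i \<in> {x \<in> carr. ?m x = 0}"
      using coeff.span_induct[OF i(2), of "\<lambda>x. x \<in> {x \<in> carr. ?m x = 0}"] by auto
    then show ?case by simp
  qed
  show "multilinear_identity alg one {..<n} h c"
    unfolding multilinear_identity_def using slots[of "{..<n}"] by auto
qed

end

subsection \<open>Codimensions\<close>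

definition independent_modulo ::
  "('a::zero \<Rightarrow> 'p::comm_monoid_add \<Rightarrow> 'p) \<Rightarrow> 'p set \<Rightarrow> 'p set \<Rightarrow> bool" where
  "independent_modulo scale W B \<longleftrightarrow> (\<forall>c. (\<Sum>b\<in>B. scale (c b) b) \<in> W \<longrightarrow> (\<forall>b\<in>B. c b = 0))"

context
  fixes scale :: "'a::field \<Rightarrow> 'p::ab_group_add \<Rightarrow> 'p"
  assumes scale: "vector_space scale"
begin

interpretation V: vector_space scale by (rule scale)

lemma independent_Un_modulo:
  assumes "finite B" "independent_modulo scale W B" "V.subspace W" "BW \<subseteq> W" "\<not> V.dependent BW" "finite BW"
  shows "B \<inter> BW = {}" "\<not> V.dependent (B \<union> BW)"
proof -
  have B: "\<And>c b. (\<Sum>b\<in>B. scale (c b) b) \<in> W \<Longrightarrow> b \<in> B \<Longrightarrow> c b = 0"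
    using assms(2) by (auto simp: independent_modulo_def)
  show disj: "B \<inter> BW = {}"
  proof (rule ccontr)
    assume "B \<inter> BW \<noteq> {}"
    then obtain b where b: "b \<in> B" "b \<in> BW" by auto
    have "(\<Sum>x\<in>B. scale (if x = b then 1 else 0) x) = (\<Sum>x\<in>B. if x = b then x else 0)"
      by (rule sum.cong) auto
    then have "(\<Sum>x\<in>B. scale (if x = b then 1 else 0) x) = b"
      using b assms(1) by (simp add: sum.delta)
    then show False using B[of "\<lambda>x. if x = b then 1 else 0" b] b assms(4) by auto
  qed
  show "\<not> V.dependent (B \<union> BW)"
  proof
    assume "V.dependent (B \<union> BW)"
    then obtain u v where u: "v \<in> B \<union> BW" "u v \<noteq> 0" "(\<Sum>v\<in>B \<union> BW. scale (u v) v) = 0"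
      using V.dependent_finite[of "B \<union> BW"] assms by auto
    have "(\<Sum>v\<in>B. scale (u v) v) + (\<Sum>v\<in>BW. scale (u v) v) = 0"
      using u(3) disj assms by (simp add: sum.union_disjoint)
    moreover have "(\<Sum>v\<in>BW. scale (u v) v) \<in> W"
      using assms(3,4) by (intro V.subspace_sum V.subspace_scale) auto
    ultimately have "(\<Sum>v\<in>B. scale (u v) v) \<in> W"
      using V.subspace_neg[OF assms(3)] by (metis eq_neg_iff_add_eq_0)
    then have 0: "\<forall>b\<in>B. u b = 0" using B by blast
    then have "(\<Sum>v\<in>BW. scale (u v) v) = 0" using \<open>_ + _ = 0\<close> by simp
    then have "\<forall>v\<in>BW. u v = 0"
      using assms(5,6) V.dependent_finite by blast
    then show False using 0 u by auto
  qed
qed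

text \<open>Adjoining a basis of \<open>W\<close> to any admissible set of representatives yields a
  basis of \<open>V\<close>. So all such sets have the same size and the definite description in
  \<open>quotient_dim\<close> is justified; one of them is obtained by extending a basis of
  \<open>W\<close>.\<close>

lemma quotient_dim_eq:
  assumes V: "V = V.span S" "finite S" and W: "V.subspace W" "W \<subseteq> V"
  shows "quotient_dim scale V W + V.dim W = V.dim V"
proof -
  obtain BW where BW: "BW \<subseteq> W" "\<not> V.dependent BW" "W \<subseteq> V.span BW" "card BW = V.dim W"
    using V.basis_exists by blast
  have finBW: "finite BW"
    using V.independent_span_bound[OF V(2) BW(2)] BW W V by auto
  have WBW: "W = V.span BW" using BW W V.span_subspace by blast
  obtain BV where BV: "BW \<subseteq> BV" "BV \<subseteq> V" "\<not> V.dependent BV" "V \<subseteq> V.span BV"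
    using V.maximal_independent_subset_extend[of BW V] BW W by blast
  have finBV: "finite BV" using V.independent_span_bound[OF V(2) BV(3)] BV V by auto
  let ?P = "\<lambda>B. finite B \<and> B \<subseteq> V \<and> (\<forall>c. (\<Sum>b\<in>B. scale (c b) b) \<in> W \<longrightarrow> (\<forall>b\<in>B. c b = 0)) \<and>
     (\<forall>v\<in>V. \<exists>c. v - (\<Sum>b\<in>B. scale (c b) b) \<in> W)"
  have card: "card B + V.dim W = V.dim V" if "?P B" for B
  proof -
    have B: "finite B" "B \<subseteq> V" "independent_modulo scale W B" "\<forall>v\<in>V. \<exists>c. v - (\<Sum>b\<in>B. scale (c b) b) \<in> W"
      using that by (auto simp: independent_modulo_def)
    note U = independent_Un_modulo[OF B(1,3) W(1) BW(1,2) finBW]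
    have "V \<subseteq> V.span (B \<union> BW)"
    proof
      fix v assume "v \<in> V"
      then obtain c where c: "v - (\<Sum>b\<in>B. scale (c b) b) \<in> V.span BW" using B(4) WBW by blast
      then have "v - (\<Sum>b\<in>B. scale (c b) b) \<in> V.span (B \<union> BW)" using V.span_mono[of BW "B \<union> BW"] by auto
      moreover have "(\<Sum>b\<in>B. scale (c b) b) \<in> V.span (B \<union> BW)"
        by (intro V.span_sum V.span_scale V.span_base) auto
      ultimately show "v \<in> V.span (B \<union> BW)" using V.span_add by fastforce
    qed
    then have "card (B \<union> BW) = V.dim V"
      using U B BW W by (intro V.basis_card_eq_dim) auto
    then show ?thesis using U(1) B(1) finBW BW(4) by (simp add: card_Un_disjoint)
  qed
  let ?B = "BV - BW"
  have "?P ?B"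
  proof (intro conjI allI impI ballI)
    show "finite ?B" "?B \<subseteq> V" using finBV BV by auto
  next
    fix c b assume c: "(\<Sum>b\<in>?B. scale (c b) b) \<in> W" and b: "b \<in> ?B"
    then obtain u where u: "(\<Sum>b\<in>?B. scale (c b) b) = (\<Sum>b\<in>BW. scale (u b) b)"
      unfolding WBW V.span_finite[OF finBW] by auto
    let ?f = "\<lambda>b. if b \<in> BW then - u b else c b"
    have "(\<Sum>b\<in>BV. scale (?f b) b) = (\<Sum>b\<in>?B. scale (?f b) b) + (\<Sum>b\<in>BW. scale (?f b) b)"
      using BV(1) finBV by (rule sum.subset_diff)
    also have "\<dots> = (\<Sum>b\<in>?B. scale (c b) b) - (\<Sum>b\<in>BW. scale (u b) b)"
      by (simp add: sum_negf)
    finally have sum0: "(\<Sum>b\<in>BV. scale (?f b) b) = 0" using u by simp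
    show "c b = 0"
    proof (rule ccontr)
      assume "c b \<noteq> 0"
      then have "\<exists>v\<in>BV. ?f v \<noteq> 0" using b by (intro bexI[of _ b]) auto
      then have "V.dependent BV"
        unfolding V.dependent_finite[OF finBV] using sum0 by (intro exI[of _ ?f] conjI)
      then show False using BV(3) by simp
    qed
  next
    fix v assume "v \<in> V"
    then obtain u where "v = (\<Sum>b\<in>BV. scale (u b) b)"
      using BV(4) V.span_finite[OF finBV] by auto
    then have "v - (\<Sum>b\<in>?B. scale (u b) b) = (\<Sum>b\<in>BW. scale (u b) b)"
      using sum.subset_diff[OF BV(1) finBV, of "\<lambda>b. scale (u b) b"] by simp
    also have "\<dots> \<in> W" using W(1) BW(1) by (intro V.subspace_sum V.subspace_scale) auto
    finally show "\<exists>c. v - (\<Sum>b\<in>?B. scale (c b) b) \<in> W" by blast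
  qed
  then have "quotient_dim scale V W = card ?B"
    unfolding quotient_dim_def
  proof (intro the_equality)
    show "\<exists>B. finite B \<and> card B = card ?B \<and> B \<subseteq> V \<and>
        (\<forall>c. (\<Sum>b\<in>B. scale (c b) b) \<in> W \<longrightarrow> (\<forall>b\<in>B. c b = 0)) \<and>
        (\<forall>v\<in>V. \<exists>c. v - (\<Sum>b\<in>B. scale (c b) b) \<in> W)"
      using \<open>?P ?B\<close> by (intro exI[of _ ?B]) blast
  next
    fix d assume "\<exists>B. finite B \<and> card B = d \<and> B \<subseteq> V \<and>
        (\<forall>c. (\<Sum>b\<in>B. scale (c b) b) \<in> W \<longrightarrow> (\<forall>b\<in>B. c b = 0)) \<and>
        (\<forall>v\<in>V. \<exists>c. v - (\<Sum>b\<in>B. scale (c b) b) \<in> W)"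
    then obtain B where B: "?P B" "card B = d" by metis
    show "d = card ?B" using card[OF B(1)] card[OF \<open>?P ?B\<close>] B(2) by linarith
  qed
  then show ?thesis using card[OF \<open>?P ?B\<close>] by simp
qed

text \<open>This speaks of an indexed family because the polynomials it is meant for are not known
  to be distinct in advance; independence modulo \<open>W\<close> rules out repetitions.\<close>

lemma card_le_quotient_dim:
  assumes V: "V = V.span S" "finite S" and W: "V.subspace W" "W \<subseteq> V"
    and I: "finite I" "\<And>i. i \<in> I \<Longrightarrow> p i \<in> V"
    and ind: "\<And>c i. (\<Sum>i\<in>I. scale (c i) (p i)) \<in> W \<Longrightarrow> i \<in> I \<Longrightarrow> c i = 0"
  shows "card I \<le> quotient_dim scale V W"
proof -
  obtain BW where BW: "BW \<subseteq> W" "\<not> V.dependent BW" "W \<subseteq> V.span BW" "card BW = V.dim W"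
    using V.basis_exists by blast
  have finBW: "finite BW"
    using V.independent_span_bound[OF V(2) BW(2)] BW W V by auto
  obtain BV where BV: "BV \<subseteq> V" "\<not> V.dependent BV" "V \<subseteq> V.span BV" "card BV = V.dim V"
    using V.basis_exists by blast
  have finBV: "finite BV" using V.independent_span_bound[OF V(2) BV(2)] BV V by auto
  have inj: "inj_on p I"
  proof (rule inj_onI, rule ccontr)
    fix i j assume ij: "i \<in> I" "j \<in> I" "p i = p j" "i \<noteq> j"
    let ?c = "\<lambda>k. if k = i then 1 else if k = j then - 1 else (0::'a)"
    have "(\<Sum>k\<in>I. scale (?c k) (p k)) = (\<Sum>k\<in>I. (if k = i then p k else 0) + (if k = j then - p k else 0))"
      using ij(4) by (intro sum.cong) auto
    also have "\<dots> = 0" using I(1) ij by (simp add: sum.distrib sum.delta)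
    finally have "(\<Sum>k\<in>I. scale (?c k) (p k)) = 0" .
    then have "?c i = 0" using ind[of ?c i] ij V.subspace_0[OF W(1)] by simp
    then show False by simp
  qed
  have "independent_modulo scale W (p ` I)"
    unfolding independent_modulo_def using ind[of "\<lambda>i. c (p i)" for c] inj
    by (auto simp: sum.reindex)
  note U = independent_Un_modulo[OF finite_imageI[OF I(1)] this W(1) BW(1,2) finBW]
  have "card (p ` I \<union> BW) \<le> card BV"
    using V.independent_span_bound[OF finBV U(2)] BW W I BV by blast
  then show ?thesis
    using U(1) I(1) finBW BW(4) BV(4) quotient_dim_eq[OF V W]
    by (simp add: card_Un_disjoint card_image inj)
qed

text \<open>Modulo \<open>W\<close> every spanning vector is 0 or equal to a member of
  \<open>Z\<close>, so \<open>Z\<close> together with a basis of \<open>W\<close> spans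
  \<open>V\<close>.\<close>

lemma quotient_dim_le_card:
  assumes V: "V = V.span S" "finite S" and W: "V.subspace W" "W \<subseteq> V"
    and Z: "finite Z" "\<And>s. s \<in> S \<Longrightarrow> s \<in> W \<or> (\<exists>z\<in>Z. s - z \<in> W)"
  shows "quotient_dim scale V W \<le> card Z"
proof -
  obtain BW where BW: "BW \<subseteq> W" "\<not> V.dependent BW" "W \<subseteq> V.span BW" "card BW = V.dim W"
    using V.basis_exists by blast
  have finBW: "finite BW"
    using V.independent_span_bound[OF V(2) BW(2)] BW W V by auto
  have WU: "W \<subseteq> V.span (Z \<union> BW)" using BW V.span_mono[of BW "Z \<union> BW"] by auto
  have "S \<subseteq> V.span (Z \<union> BW)"
  proof
    fix s assume "s \<in> S"
    then consider "s \<in> W" | z where "z \<in> Z" "s - z \<in> W" using Z by blast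
    then show "s \<in> V.span (Z \<union> BW)"
    proof cases
      case 2
      then have "s - z + z \<in> V.span (Z \<union> BW)"
        using WU by (intro V.span_add V.span_base[of z]) auto
      then show ?thesis by simp
    qed (use WU in auto)
  qed
  then have "V \<subseteq> V.span (Z \<union> BW)" unfolding V(1) by (rule V.span_minimal) simp
  then have "V.dim V \<le> card (Z \<union> BW)" using Z finBW by (intro V.dim_le_card) auto
  also have "\<dots> \<le> card Z + card BW" by (rule card_Un_le)
  finally show ?thesis using quotient_dim_eq[OF V W] BW(4) by simp
qed

end

section \<open>The space of multilinear polynomials\<close>

lemma lookup_poly_scale [simp]: "Poly_Mapping.lookup (poly_scale c f) w = c * Poly_Mapping.lookup f w"
  by (simp add: poly_scale_def map.rep_eq when_def)

interpretation poly: vector_space poly_scale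
  by unfold_locales (auto intro!: poly_mapping_eqI simp: lookup_add algebra_simps)

definition multilinear_words :: "nat \<Rightarrow> (nat \<times> 'g) list set" where
  "multilinear_words n = {w. distinct (map fst w) \<and> fst ` set w = {1..n}}"

lemma multilinear_polys_eq:
  "(multilinear_polys n :: ('g, 'a::field) graded_poly set) =
     poly.span ((\<lambda>w. Poly_Mapping.single w 1) ` multilinear_words n)"
proof -
  have "{Poly_Mapping.single (map (\<lambda>i. (\<sigma> i, h i)) [1..<Suc n]) (1::'a) | \<sigma> (h :: nat \<Rightarrow> 'g). \<sigma> permutes {1..n}} =
     (\<lambda>w. Poly_Mapping.single w 1) ` multilinear_words n" (is "?L = ?R")
  proof (intro set_eqI iffI)
    fix p assume "p \<in> ?L"
    then obtain \<sigma> and h :: "nat \<Rightarrow> 'g"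
      where p: "p = Poly_Mapping.single (map (\<lambda>i. (\<sigma> i, h i)) [1..<Suc n]) 1" "\<sigma> permutes {1..n}" by blast
    have "map (\<lambda>i. (\<sigma> i, h i)) [1..<Suc n] \<in> multilinear_words n"
      using permutes_inj_on[OF p(2)] permutes_image[OF p(2)]
      by (simp add: multilinear_words_def comp_def image_image atLeastLessThanSuc_atLeastAtMost distinct_map[of \<sigma>]
          del: upt_Suc)
    then show "p \<in> ?R" using p by blast
  next
    fix p assume "p \<in> ?R"
    then obtain w where p: "p = Poly_Mapping.single w 1" and w: "distinct (map fst w)" "fst ` set w = {1..n}"
      by (auto simp: multilinear_words_def)
    have len: "length w = n" using distinct_card[OF w(1)] w(2) by simp
    \<comment> \<open>Positions run from 1 in \<open>multilinear_polys\<close> but from 0 in lists,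
      hence the shift; outside \<open>{1..n}\<close> a permutation of that set must be the
      identity.\<close>
    define \<sigma> where "\<sigma> = (\<lambda>i. if i \<in> {1..n} then fst (w ! (i - 1)) else i)"
    have "inj_on \<sigma> {1..n}"
    proof (rule inj_onI)
      fix i j assume "i \<in> {1..n}" "j \<in> {1..n}" "\<sigma> i = \<sigma> j"
      then have "fst (w ! (i - 1)) = fst (w ! (j - 1))" "i - 1 < length w" "j - 1 < length w" "1 \<le> i" "1 \<le> j"
        using len by (auto simp: \<sigma>_def)
      then have "i - 1 = j - 1" using nth_eq_iff_index_eq[OF w(1), of "i - 1" "j - 1"] by simp
      with \<open>1 \<le> i\<close> \<open>1 \<le> j\<close> show "i = j" by simp
    qed
    moreover have "\<sigma> ` {1..n} \<subseteq> {1..n}"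
    proof safe
      fix i assume "i \<in> {1..n}"
      then have "w ! (i - 1) \<in> set w" using len by (intro nth_mem) auto
      then have "fst (w ! (i - 1)) \<in> {1..n}" using w(2) by blast
      then show "\<sigma> i \<in> {1..n}" using \<open>i \<in> {1..n}\<close> by (simp add: \<sigma>_def)
    qed
    ultimately have "\<sigma> permutes {1..n}"
      using endo_inj_surj[of "{1..n}" \<sigma>]
      by (intro bij_imp_permutes) (auto simp: bij_betw_def, simp_all add: \<sigma>_def)
    moreover have "map (\<lambda>i. (\<sigma> i, snd (w ! (i - 1)))) [1..<Suc n] = w"
      using len by (intro nth_equalityI) (auto simp: \<sigma>_def simp del: upt_Suc)
    ultimately show "p \<in> ?L" unfolding p
      by (intro CollectI exI[of _ \<sigma>] exI[of _ "\<lambda>i. snd (w ! (i - 1))"]) simp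
  qed
  then show ?thesis by (simp add: multilinear_polys_def)
qed

lemma finite_multilinear_words: "finite (multilinear_words n :: (nat \<times> 'g::finite) list set)"
proof (rule finite_subset)
  show "multilinear_words n \<subseteq> {w :: (nat \<times> 'g) list. set w \<subseteq> {1..n} \<times> UNIV \<and> length w = n}"
  proof
    fix w :: "(nat \<times> 'g) list" assume "w \<in> multilinear_words n"
    then have w: "distinct (map fst w)" "fst ` set w = {1..n}" by (auto simp: multilinear_words_def)
    then have "length w = n" using distinct_card[OF w(1)] by simp
    moreover have "fst x \<in> {1..n}" if "x \<in> set w" for x using that w(2) by blast
    ultimately show "w \<in> {w. set w \<subseteq> {1..n} \<times> UNIV \<and> length w = n}" by (auto simp: mem_Times_iff)
  qed
qed (intro finite_lists_length_eq finite_cartesian_product, auto)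

text \<open>For n = 0 the only multilinear word is the empty one, and the free algebra has no
  constant terms; the codimension estimates are therefore made for n at least 1.\<close>

lemma multilinear_words_free:
  assumes "w \<in> multilinear_words n" "1 \<le> n"
  shows "Poly_Mapping.single w (1::'a::field) \<in> free_graded_algebra"
proof -
  have "i \<in> {1..n}" if "(i, g) \<in> set w" for i g
    using assms(1) image_eqI[of i fst "(i, g)" "set w"] that by (simp add: multilinear_words_def)
  moreover have "w \<noteq> []" using assms by (auto simp: multilinear_words_def)
  ultimately show ?thesis by (fastforce simp: free_graded_algebra_def)
qed

context unital_graded
begin

context
  fixes \<phi> :: "nat \<times> 'g \<Rightarrow> 'v" assumes \<phi>: "\<And>x. \<phi> x \<in> carr"
begin

lemma alg_prod_list_map_closed: "alg_prod_list A (map \<phi> w) \<in> carr"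
  using \<phi> by (intro alg_prod_list_closed) auto

lemma poly_eval_add: "poly_eval A \<phi> (f + g) = poly_eval A \<phi> f + poly_eval A \<phi> g"
proof -
  let ?K = "Poly_Mapping.keys f \<union> Poly_Mapping.keys g"
  have "Poly_Mapping.keys (f + g) \<subseteq> ?K" by (rule Poly_Mapping.keys_add)
  then show ?thesis
    by (simp add: poly_eval_superset[OF \<phi>, of ?K] lookup_add scale_add_left alg_prod_list_map_closed
        sum.distrib)
qed

lemma poly_eval_scale: "poly_eval A \<phi> (poly_scale c f) = c *\<^sub>A poly_eval A \<phi> f"
proof -
  have "Poly_Mapping.keys (poly_scale c f) \<subseteq> Poly_Mapping.keys f" by (auto simp: in_keys_iff)
  then have "poly_eval A \<phi> (poly_scale c f) =
      (\<Sum>w\<in>Poly_Mapping.keys f. c *\<^sub>A (Poly_Mapping.lookup f w *\<^sub>A alg_prod_list A (map \<phi> w)))"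
    by (simp add: poly_eval_superset[OF \<phi>, of "Poly_Mapping.keys f"] scale_scale alg_prod_list_map_closed)
  then show ?thesis unfolding poly_eval_def
    by (simp add: scale_sum scale_closed alg_prod_list_map_closed)
qed

lemma poly_eval_closed: "poly_eval A \<phi> f \<in> carr"
  unfolding poly_eval_def by (intro sum_closed scale_closed alg_prod_list_map_closed)

lemma poly_eval_zero: "poly_eval A \<phi> 0 = 0"
  by (simp add: poly_eval_def)

lemma poly_eval_sum: "poly_eval A \<phi> (sum f I) = (\<Sum>i\<in>I. poly_eval A \<phi> (f i))"
  by (induction I rule: infinite_finite_induct) (simp_all add: poly_eval_zero poly_eval_add)

lemma poly_eval_single: "poly_eval A \<phi> (Poly_Mapping.single w c) = c *\<^sub>A alg_prod_list A (map \<phi> w)"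
  by (simp add: poly_eval_superset[OF \<phi>, of "{w}"])

end

lemma subspace_free_graded_algebra: "poly.subspace (free_graded_algebra :: ('g, 'a) graded_poly set)"
proof -
  have "f + g \<in> free_graded_algebra" if "f \<in> free_graded_algebra" "g \<in> free_graded_algebra"
    for f g :: "('g, 'a) graded_poly"
    unfolding free_graded_algebra_def
  proof (rule CollectI, rule ballI)
    fix w assume "w \<in> Poly_Mapping.keys (f + g)"
    then have "w \<in> Poly_Mapping.keys f \<or> w \<in> Poly_Mapping.keys g"
      using Poly_Mapping.keys_add[of f g] by blast
    then show "w \<noteq> [] \<and> (\<forall>(i, g)\<in>set w. 1 \<le> i)"
      using that[unfolded free_graded_algebra_def mem_Collect_eq] bspec by metis
  qed
  moreover have "poly_scale c f \<in> free_graded_algebra" if "f \<in> free_graded_algebra"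
    for c and f :: "('g, 'a) graded_poly"
  proof -
    have "Poly_Mapping.keys (poly_scale c f) \<subseteq> Poly_Mapping.keys f" by (auto simp: in_keys_iff)
    then show ?thesis using that unfolding free_graded_algebra_def mem_Collect_eq by (metis subsetD)
  qed
  moreover have "0 \<in> free_graded_algebra" by (simp add: free_graded_algebra_def)
  ultimately show ?thesis by (intro poly.subspaceI)
qed

lemma subspace_graded_identities: "poly.subspace (graded_identities A)"
proof -
  have adm: "\<phi> x \<in> carr" if "\<forall>i g. \<phi> (i, g) \<in> hom g" for \<phi> and x :: "nat \<times> 'g"
    using that by (cases x) (auto intro: hom_carr)
  have ev_add: "poly_eval A \<phi> (f + g) = poly_eval A \<phi> f + poly_eval A \<phi> g"
    and ev_scale: "poly_eval A \<phi> (poly_scale c f) = c *\<^sub>A poly_eval A \<phi> f"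
    if "\<forall>i g. \<phi> (i, g) \<in> hom g" for \<phi> f g c
    using adm[OF that] by (rule poly_eval_add, rule poly_eval_scale)
  have "f + g \<in> graded_identities A" if "f \<in> graded_identities A" "g \<in> graded_identities A" for f g
    using that poly.subspace_add[OF subspace_free_graded_algebra, of f g] ev_add
    by (simp add: graded_identities_def)
  moreover have "poly_scale c f \<in> graded_identities A" if "f \<in> graded_identities A" for c f
    using that poly.subspace_scale[OF subspace_free_graded_algebra, of f c] ev_scale
    by (simp add: graded_identities_def)
  moreover have "0 \<in> graded_identities A"
    using poly.subspace_0[OF subspace_free_graded_algebra] by (simp add: graded_identities_def poly_eval_def)
  ultimately show ?thesis by (intro poly.subspaceI)
qed

lemma subspace_multilinear_identities: "poly.subspace (multilinear_polys n \<inter> graded_identities A)"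
  unfolding multilinear_polys_eq
  by (intro poly.subspace_inter poly.subspace_span subspace_graded_identities)

end

subsection \<open>Codimension growth\<close>

context unital_graded
begin

lemma foldr_mult_closed: "\<lbrakk>set r \<subseteq> carr; x \<in> carr\<rbrakk> \<Longrightarrow> foldr mult r x \<in> carr"
  by (induction r) (auto simp: mult_closed)

lemma foldr_mult_zero: "set r \<subseteq> carr \<Longrightarrow> foldr mult r 0 = 0"
  by (induction r) (auto simp: mult_zero_right)

lemma foldr_mult_unit: "\<lbrakk>set r \<subseteq> {e}; x \<in> carr\<rbrakk> \<Longrightarrow> foldr mult r x = x"
  by (induction r) (auto simp: unit_left)

lemma foldr_mult_sum:
  assumes "set r \<subseteq> carr" "\<And>i. i \<in> I \<Longrightarrow> f i \<in> carr"
  shows "foldr mult r (\<Sum>i\<in>I. c i *\<^sub>A f i) = (\<Sum>i\<in>I. c i *\<^sub>A foldr mult r (f i))"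
  using assms
proof (induction r)
  case (Cons x r)
  then have "foldr mult (x # r) (\<Sum>i\<in>I. c i *\<^sub>A f i) = (\<Sum>i\<in>I. x \<bullet> (c i *\<^sub>A foldr mult r (f i)))"
    by (simp add: mult_sum_right scale_closed foldr_mult_closed)
  also have "\<dots> = (\<Sum>i\<in>I. c i *\<^sub>A foldr mult (x # r) (f i))"
    using Cons.prems by (intro sum.cong[OF refl]) (simp add: mult_scale_right foldr_mult_closed)
  finally show ?case .
qed simp

text \<open>
  A multilinear polynomial that is annihilated by substituting the unit for any variable of degree 0 yields one
  polynomial for every choice of its variables, and these are independent: substituting the unit for all
  other variables kills all but one of them.
\<close>

lemma binomial_le_graded_codim:
  assumes S: "finite S" "1 \<le> card S" and n: "1 \<le> n"
    and proper: "\<And>u. (\<And>j. j \<in> S \<Longrightarrow> u j \<in> hom (h j)) \<Longrightarrow> \<exists>j\<in>S. h j = 0 \<and> u j = e \<Longrightarrow>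
      multilinear_eval A e S c u = 0"
    and u0: "\<And>j. j \<in> S \<Longrightarrow> u0 j \<in> hom (h j)" "multilinear_eval A e S c u0 \<noteq> 0"
  shows "n choose card S \<le> graded_codim A n"
proof -
  define I where "I = {T. T \<subseteq> {1..n} \<and> card T = card S}"
  have finI: "finite I" by (simp add: I_def)
  have finT: "finite T" if "T \<in> I" for T using that finite_subset by (auto simp: I_def)
  have "\<exists>b. bij_betw b S T" if "T \<in> I" for T
    using that S finT[OF that] by (intro finite_same_card_bij) (auto simp: I_def)
  then obtain b where b: "\<And>T. T \<in> I \<Longrightarrow> bij_betw (b T) S T" by metis
  \<comment> \<open>The additional variables get degree 0, so that the unit may replace them, and
    stand in front in increasing order, so that they factor out of every word of
    \<open>p T\<close>.\<close>
  define r where "r = (\<lambda>T. map (\<lambda>i. (i, 0::'g)) (sorted_list_of_set ({1..n} - T)))"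
  define word where "word = (\<lambda>T w. r T @ map (\<lambda>j. (b T j, h j)) w)"
  define p where "p = (\<lambda>T. \<Sum>w\<in>permutations_of_set S. poly_scale (c w) (Poly_Mapping.single (word T w) (1::'a)))"
  have word: "word T w \<in> multilinear_words n" if "T \<in> I" "w \<in> permutations_of_set S" for T w
  proof -
    have w: "distinct w" "set w = S" using that by (auto simp: permutations_of_set_def)
    have bT: "inj_on (b T) S" "b T ` S = T" using b[OF that(1)] by (auto simp: bij_betw_def)
    have "T \<subseteq> {1..n}" using that by (auto simp: I_def)
    moreover have "map fst (word T w) = sorted_list_of_set ({1..n} - T) @ map (b T) w"
      by (simp add: word_def r_def comp_def)
    then have "distinct (map fst (word T w))" "set (map fst (word T w)) = {1..n} - T \<union> T"
      using w bT by (simp_all add: distinct_map, blast)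
    ultimately show ?thesis by (auto simp: multilinear_words_def)
  qed
  have p: "p T \<in> multilinear_polys n" if "T \<in> I" for T
    unfolding p_def multilinear_polys_eq
    using word[OF that] by (intro poly.span_sum poly.span_scale poly.span_base) auto
  have eval_p: "poly_eval A \<phi> (p T) =
      foldr mult (map \<phi> (r T)) (multilinear_eval A e S c (\<lambda>j. \<phi> (b T j, h j)))"
    if "T \<in> I" and \<phi>: "\<And>x. \<phi> x \<in> carr" for \<phi> T
  proof -
    have "poly_eval A \<phi> (p T) = (\<Sum>w\<in>permutations_of_set S. c w *\<^sub>A alg_prod_list A (map \<phi> (word T w)))"
      unfolding p_def using \<phi>
      by (simp add: poly_eval_sum poly_eval_scale poly_eval_single scale_one alg_prod_list_map_closed)
    also have "\<dots> = (\<Sum>w\<in>permutations_of_set S. c w *\<^sub>A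
        foldr mult (map \<phi> (r T)) (uprod (map (\<lambda>j. \<phi> (b T j, h j)) w)))"
    proof (rule sum.cong[OF refl])
      fix w assume w: "w \<in> permutations_of_set S"
      then have "word T w \<noteq> []" using word[OF \<open>T \<in> I\<close> w] n by (auto simp: multilinear_words_def)
      then have "alg_prod_list A (map \<phi> (word T w)) = uprod (map \<phi> (word T w))"
        using \<phi> by (intro alg_prod_list_eq_uprod) auto
      then show "c w *\<^sub>A alg_prod_list A (map \<phi> (word T w)) =
          c w *\<^sub>A foldr mult (map \<phi> (r T)) (uprod (map (\<lambda>j. \<phi> (b T j, h j)) w))"
        by (simp add: word_def unital_prod_def comp_def)
    qed
    also have "\<dots> = foldr mult (map \<phi> (r T)) (multilinear_eval A e S c (\<lambda>j. \<phi> (b T j, h j)))"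
      unfolding multilinear_eval_def using \<phi>
      by (intro foldr_mult_sum[symmetric] uprod_closed) auto
    finally show ?thesis .
  qed
  have "card I \<le> graded_codim A n"
    unfolding graded_codim_def
  proof (rule card_le_quotient_dim[OF poly.vector_space_axioms multilinear_polys_eq _ _ _ finI, of n _ p])
    show "finite ((\<lambda>w. Poly_Mapping.single w (1::'a)) ` (multilinear_words n :: (nat \<times> 'g) list set))"
      by (intro finite_imageI finite_multilinear_words)
    show "module.subspace poly_scale (multilinear_polys n \<inter> graded_identities A)"
      by (rule subspace_multilinear_identities)
    show "p T \<in> multilinear_polys n" if "T \<in> I" for T by (rule p[OF that])
    fix d T0 assume d: "(\<Sum>T\<in>I. poly_scale (d T) (p T)) \<in> multilinear_polys n \<inter> graded_identities A" and T0: "T0 \<in> I"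
    define j0 where "j0 = inv_into S (b T0)"
    \<comment> \<open>A substitution has to treat every pair of an index and a degree. On
      \<open>T0\<close> it carries \<open>u0\<close> over along the bijection, elsewhere it takes
      the unit in degree 0, and every other pair is sent to 0.\<close>
    define \<phi> where "\<phi> = (\<lambda>(i, g). if i \<in> T0 then if g = h (j0 i) then u0 (j0 i) else 0 else if g = 0 then e else 0)"
    have j0: "j0 i \<in> S" if "i \<in> T0" for i
      using that b[OF T0] unfolding j0_def by (intro inv_into_into) (auto simp: bij_betw_def)
    have \<phi>h: "\<phi> (i, g) \<in> hom g" for i g
      using u0(1)[OF j0, of i] homogeneous_zero unit_homogeneous unfolding \<phi>_def by (cases "g = h (j0 i)") simp_all
    have \<phi>: "\<phi> x \<in> carr" for x using hom_carr[OF \<phi>h[of "fst x" "snd x"]] by simp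
    have eval_T0: "poly_eval A \<phi> (p T0) = multilinear_eval A e S c u0"
    proof -
      have "\<phi> (b T0 j, h j) = u0 j" if "j \<in> S" for j
      proof -
        have "b T0 j \<in> T0" "j0 (b T0 j) = j"
          using b[OF T0] that by (auto simp: bij_betw_def j0_def)
        then show ?thesis by (simp add: \<phi>_def)
      qed
      then have "multilinear_eval A e S c (\<lambda>j. \<phi> (b T0 j, h j)) = multilinear_eval A e S c u0"
        unfolding multilinear_eval_def permutations_of_set_def
        by (intro sum.cong[OF refl] arg_cong[of _ _ "\<lambda>x. alg_scale A _ (unital_prod A e x)"]) auto
      moreover have "set (map \<phi> (r T0)) \<subseteq> {e}" by (auto simp: r_def \<phi>_def)
      moreover have "multilinear_eval A e S c u0 \<in> carr"
        unfolding multilinear_eval_def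
        by (intro sum_closed scale_closed uprod_perm_closed[of _ S] hom_carr[OF u0(1)])
      ultimately show ?thesis using eval_p[OF T0, of \<phi>] \<phi> by (simp add: foldr_mult_unit)
    qed
    have eval_T: "poly_eval A \<phi> (p T) = 0" if T: "T \<in> I" "T \<noteq> T0" for T
    proof -
      \<comment> \<open>Sets of equal size are not nested unless equal, so one of the variables
        indexed by \<open>T\<close> receives the unit or 0. The first case is killed by properness,
        the second by multilinearity.\<close>
      have "\<not> T \<subseteq> T0" using T T0 card_subset_eq[OF finT[OF T0], of T] by (auto simp: I_def)
      then obtain i where i: "i \<in> T" "i \<notin> T0" by blast
      then have "i \<in> b T ` S" using bij_betw_imp_surj_on[OF b[OF T(1)]] by simp
      then obtain j where j: "j \<in> S" "b T j \<notin> T0" using i(2) by auto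
      have "multilinear_eval A e S c (\<lambda>j. \<phi> (b T j, h j)) = 0"
      proof (cases "h j = 0")
        case True
        then show ?thesis using j by (intro proper \<phi>h) (auto simp: \<phi>_def)
      next
        case False
        then have "\<phi> (b T j, h j) = 0" using j by (simp add: \<phi>_def)
        then show ?thesis using j(1) \<phi> by (intro multilinear_eval_zero[of _ _ j])
      qed
      then show ?thesis using eval_p[OF T(1), of \<phi>] \<phi> by (simp add: foldr_mult_zero image_subset_iff)
    qed
    have "0 = poly_eval A \<phi> (\<Sum>T\<in>I. poly_scale (d T) (p T))"
      using d \<phi>h by (auto simp: graded_identities_def)
    also have "\<dots> = (\<Sum>T\<in>I. d T *\<^sub>A poly_eval A \<phi> (p T))"
      using \<phi> by (simp add: poly_eval_sum poly_eval_scale)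
    also have "\<dots> = d T0 *\<^sub>A poly_eval A \<phi> (p T0)"
      using T0 finI eval_T by (subst sum.remove[of _ T0]) auto
    finally have "d T0 *\<^sub>A multilinear_eval A e S c u0 = 0" using eval_T0 by simp
    moreover have "multilinear_eval A e S c u0 \<in> carr" using poly_eval_closed[of \<phi> "p T0"] \<phi> eval_T0 by simp
    ultimately show "d T0 = 0" using u0(2) scale_cancel by blast
  qed simp
  then show ?thesis by (simp add: I_def n_subsets)
qed

text \<open>Induction on the number k of positions that do not hold a unit in degree 0. If the value
  is nonzero with k at least 3, the induction hypothesis says exactly that the polynomial restricted
  to these positions is proper, and \<open>binomial_le_graded_codim\<close> contradicts the growth
  condition.\<close>

lemma determined_by_pairsI:
  assumes growth: "\<And>k. 3 \<le> k \<Longrightarrow> \<exists>n\<ge>1. graded_codim A n < n choose k"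
  shows "determined_by_pairs A e"
  unfolding determined_by_pairs_def
proof (intro allI impI)
  fix n and h :: "nat \<Rightarrow> 'g" and c
  let ?S = "\<lambda>u. {i. i < n \<and> (h i \<noteq> 0 \<or> u i \<noteq> e)}"
  assume small: "\<forall>u. (\<forall>i<n. u i \<in> hom (h i)) \<and> card (?S u) \<le> 2 \<longrightarrow> multilinear_eval A e {..<n} c u = 0"
  have "multilinear_eval A e {..<n} c u = 0" if "\<forall>i<n. u i \<in> hom (h i)" for u
    using that
  proof (induction "card (?S u)" arbitrary: u rule: less_induct)
    case (less u)
    show ?case
    proof (cases "card (?S u) \<le> 2")
      case True
      then show ?thesis using small less.prems by blast
    next
      case False
      define S where "S = ?S u"
      have S: "finite S" "S \<subseteq> {..<n}" "3 \<le> card S" using False by (auto simp: S_def)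
      have off_S: "h i = 0" "u i = e" if "i < n" "i \<notin> S" for i using that by (auto simp: S_def)
      have restr: "multilinear_eval A e {..<n} c u' = multilinear_eval A e S (restrict_coeffs {..<n} S c) u'"
        if "\<forall>i<n. u' i \<in> hom (h i)" "\<And>i. i < n \<Longrightarrow> i \<notin> S \<Longrightarrow> u' i = e" for u'
        using that S hom_carr by (intro multilinear_eval_restrict) (simp, simp, blast, simp)
      show ?thesis
      proof (rule ccontr)
        assume "multilinear_eval A e {..<n} c u \<noteq> 0"
        then have ne: "multilinear_eval A e S (restrict_coeffs {..<n} S c) u \<noteq> 0"
          using restr[of u] less.prems off_S by simp
        have "m choose card S \<le> graded_codim A m" if "1 \<le> m" for m
        proof (rule binomial_le_graded_codim[OF S(1) _ that _ _ ne])
          show "u j \<in> hom (h j)" if "j \<in> S" for j using that S less.prems by auto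
          fix u' assume u': "\<And>j. j \<in> S \<Longrightarrow> u' j \<in> hom (h j)" "\<exists>j\<in>S. h j = 0 \<and> u' j = e"
          define u'' where "u'' = (\<lambda>j. if j \<in> S then u' j else e)"
          have u'': "\<forall>i<n. u'' i \<in> hom (h i)"
            using u'(1) off_S unit_homogeneous by (auto simp: u''_def)
          obtain j where j: "j \<in> S" "h j = 0" "u' j = e" using u'(2) by blast
          then have "?S u'' \<subseteq> S - {j}" using off_S by (auto simp: u''_def)
          then have "?S u'' \<subset> ?S u" using j by (auto simp: S_def)
          then have "card (?S u'') < card (?S u)" by (intro psubset_card_mono) auto
          then have "0 = multilinear_eval A e {..<n} c u''" using less.hyps u'' by simp
          also have "\<dots> = multilinear_eval A e S (restrict_coeffs {..<n} S c) u''"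
            using u'' by (intro restr) (auto simp: u''_def)
          also have "\<dots> = multilinear_eval A e S (restrict_coeffs {..<n} S c) u'"
            unfolding multilinear_eval_def permutations_of_set_def u''_def
            by (intro sum.cong[OF refl] arg_cong[of _ _ "\<lambda>x. alg_scale A _ (unital_prod A e x)"]) auto
          finally show "multilinear_eval A e S (restrict_coeffs {..<n} S c) u' = 0" by simp
        qed (use S in simp)
        then show False using growth[OF S(3)] by (auto simp: not_le[symmetric])
      qed
    qed
  qed
  then show "multilinear_identity A e {..<n} h c"
    by (simp add: multilinear_identity_def)
qed

text \<open>Commutation is known for the single factors only, so with the help of associativity each
  factor is moved to the front one transposition at a time.\<close>

lemma uprod_mset_cong:
  assumes comm: "\<And>x y. \<lbrakk>x \<in> X; y \<in> X\<rbrakk> \<Longrightarrow> x \<bullet> y = y \<bullet> x"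
    and assoc: "\<And>x y z. \<lbrakk>x \<in> carr; y \<in> carr; z \<in> carr\<rbrakk> \<Longrightarrow> (x \<bullet> y) \<bullet> z = x \<bullet> (y \<bullet> z)"
    and "X \<subseteq> carr" "set xs \<subseteq> X" "mset xs = mset ys"
  shows "uprod xs = uprod ys"
proof -
  have move: "uprod (us @ y # vs) = y \<bullet> uprod (us @ vs)" if "set us \<subseteq> X" "y \<in> X" "set vs \<subseteq> X" for us y vs
    using that
  proof (induction us)
    case (Cons x us)
    then have c: "uprod (us @ vs) \<in> carr" "x \<in> carr" "y \<in> carr"
      using assms(3) uprod_closed[of "us @ vs"] by auto
    have "uprod ((x # us) @ y # vs) = (x \<bullet> y) \<bullet> uprod (us @ vs)"
      using Cons c by (simp add: assoc)
    also have "x \<bullet> y = y \<bullet> x" using Cons.prems by (intro comm) auto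
    finally show ?case using c by (simp add: assoc)
  qed simp
  show ?thesis using assms(4,5)
  proof (induction xs arbitrary: ys)
    case (Cons x xs)
    then have "x \<in> set ys" by (metis list.set_intros(1) set_mset_mset)
    then obtain us vs where ys: "ys = us @ x # vs" by (meson split_list)
    have "set ys \<subseteq> X" using Cons.prems by (metis set_mset_mset)
    then have "uprod ys = x \<bullet> uprod (us @ vs)" unfolding ys by (intro move) auto
    also have "uprod (us @ vs) = uprod xs"
      using Cons.prems ys by (intro Cons.IH[symmetric]) auto
    finally show ?case by simp
  qed simp
qed

text \<open>Modulo identities the order of the letters is irrelevant, and a monomial with two
  letters of nonzero degree is 0. A surviving monomial is thus described by one index and its
  degree, which gives at most n |G| classes.\<close>

lemma graded_codim_le_linear:
  assumes comm: "\<And>g h x y. \<lbrakk>x \<in> hom g; y \<in> hom h\<rbrakk> \<Longrightarrow> x \<bullet> y = y \<bullet> x"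
    and nil: "\<And>g h x y. \<lbrakk>g \<noteq> 0; h \<noteq> 0; x \<in> hom g; y \<in> hom h\<rbrakk> \<Longrightarrow> x \<bullet> y = 0"
    and assoc: "\<And>x y z. \<lbrakk>x \<in> carr; y \<in> carr; z \<in> carr\<rbrakk> \<Longrightarrow> (x \<bullet> y) \<bullet> z = x \<bullet> (y \<bullet> z)"
    and n: "1 \<le> n"
  shows "graded_codim A n \<le> n * card (UNIV :: 'g set)"
proof -
  let ?single = "\<lambda>w :: (nat \<times> 'g) list. Poly_Mapping.single w (1::'a)"
  let ?w = "\<lambda>i g. map (\<lambda>j. (j, if j = i then g else 0)) [1..<Suc n]"
  define Z where "Z = (\<lambda>(i, g). ?single (?w i g)) ` ({1..n} \<times> (UNIV :: 'g set))"
  have w_words: "?w i g \<in> multilinear_words n" for i and g :: 'g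
    by (simp add: multilinear_words_def comp_def image_image atLeastLessThanSuc_atLeastAtMost del: upt_Suc)
  have uprod_eq: "uprod (map \<phi> v) = uprod (map \<phi> w)"
    if "\<forall>i g. \<phi> (i, g) \<in> hom g" "mset v = mset w" for \<phi> v w
    using that by (intro uprod_mset_cong[of "\<Union>g. hom g"]) (auto intro: comm assoc hom_carr)
  have eval: "poly_eval A \<phi> (?single w) = uprod (map \<phi> w)"
    if "\<forall>i g. \<phi> (i, g) \<in> hom g" "w \<in> multilinear_words n" for \<phi> w
  proof -
    have \<phi>: "\<phi> x \<in> carr" for x using that(1) hom_carr[of "\<phi> x" "snd x"] by (cases x) auto
    have "w \<noteq> []" using that(2) n by (auto simp: multilinear_words_def)
    then show ?thesis using \<phi> alg_prod_list_map_closed[of \<phi> w]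
      by (simp add: poly_eval_single scale_one alg_prod_list_eq_uprod image_subset_iff)
  qed
  have "graded_codim A n \<le> card Z"
    unfolding graded_codim_def
  proof (rule quotient_dim_le_card[OF poly.vector_space_axioms multilinear_polys_eq])
    show "finite (?single ` multilinear_words n)"
      by (intro finite_imageI finite_multilinear_words)
    show "module.subspace poly_scale (multilinear_polys n \<inter> graded_identities A)"
      by (rule subspace_multilinear_identities)
    show "finite Z" by (simp add: Z_def)
    fix s assume "s \<in> ?single ` multilinear_words n"
    then obtain w where w: "s = ?single w" "w \<in> multilinear_words n" by blast
    then have dw: "distinct w" "distinct (map fst w)" "fst ` set w = {1..n}"
      by (auto simp: multilinear_words_def distinct_map)
    have span: "?single v \<in> multilinear_polys n" if "v \<in> multilinear_words n" for v
      unfolding multilinear_polys_eq using that by (intro poly.span_base) auto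
    show "s \<in> multilinear_polys n \<inter> graded_identities A \<or>
        (\<exists>z\<in>Z. s - z \<in> multilinear_polys n \<inter> graded_identities A)"
    proof (cases "\<exists>x\<in>set w. \<exists>y\<in>set w. x \<noteq> y \<and> snd x \<noteq> 0 \<and> snd y \<noteq> 0")
      case True
      then obtain x y where xy: "x \<in> set w" "y \<in> set w" "x \<noteq> y" "snd x \<noteq> 0" "snd y \<noteq> 0" by blast
      have remove: "mset v = add_mset z (mset (remove1 z v))" if "z \<in> set v" for z and v :: "(nat \<times> 'g) list"
        using that by simp
      have "mset w = add_mset x (mset (remove1 x w))" using xy by (intro remove)
      moreover have "y \<in> set (remove1 x w)" using xy by (simp add: in_set_remove1)
      then have "mset (remove1 x w) = add_mset y (mset (remove1 y (remove1 x w)))" by (rule remove)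
      ultimately have "mset w = mset (x # y # remove1 y (remove1 x w))" by (simp only: mset.simps)
      then obtain v where v: "mset w = mset (x # y # v)" by blast
      have "poly_eval A \<phi> s = 0" if \<phi>: "\<forall>i g. \<phi> (i, g) \<in> hom g" for \<phi>
      proof -
        have h: "\<phi> z \<in> hom (snd z)" for z using \<phi> by (cases z) auto
        then have c: "\<phi> z \<in> carr" for z using hom_carr by blast
        then have "uprod (map \<phi> v) \<in> carr" by (intro uprod_closed) auto
        then have "uprod (map \<phi> (x # y # v)) = (\<phi> x \<bullet> \<phi> y) \<bullet> uprod (map \<phi> v)"
          using c by (simp add: assoc)
        also have "\<phi> x \<bullet> \<phi> y = 0" using xy h by (intro nil[of "snd x" "snd y"]) auto
        finally have "uprod (map \<phi> (x # y # v)) = 0"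
          using \<open>uprod (map \<phi> v) \<in> carr\<close> by (simp add: mult_zero_left)
        then show ?thesis using eval[OF \<phi> w(2)] uprod_eq[OF \<phi> v] w(1) by simp
      qed
      then have "s \<in> graded_identities A"
        using multilinear_words_free[OF w(2) n] w(1) by (simp add: graded_identities_def)
      then show ?thesis using span[OF w(2)] w(1) by simp
    next
      case False
      \<comment> \<open>This is the letter of nonzero degree; if all degrees are 0, any letter
        serves, because the normal form then does not depend on the choice.\<close>
      obtain x where x: "x \<in> set w" "\<And>y. y \<in> set w \<Longrightarrow> y \<noteq> x \<Longrightarrow> snd y = 0"
      proof (cases "\<exists>x\<in>set w. snd x \<noteq> 0")
        case True
        then show ?thesis using that False by blast
      next
        case all0: False
        have "w \<noteq> []" using dw(3) n by auto
        then show ?thesis using all0 by (intro that[of "hd w"]) auto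
      qed
      have inj: "inj_on fst (set w)" using dw(2) by (simp add: distinct_map)
      let ?v = "?w (fst x) (snd x)"
      have "set w = (\<lambda>j. (j, if j = fst x then snd x else 0)) ` (fst ` set w)"
      proof -
        have "y = (fst y, if fst y = fst x then snd x else 0)" if "y \<in> set w" for y
        proof (rule prod_eqI)
          show "snd y = snd (fst y, if fst y = fst x then snd x else 0)"
            using inj_onD[OF inj _ that x(1)] x(2)[OF that] by (cases "y = x") auto
        qed simp
        then show ?thesis by (force simp: image_image)
      qed
      then have "set w = set ?v" unfolding dw(3) by (simp add: atLeastLessThanSuc_atLeastAtMost del: upt_Suc)
      then have "mset w = mset ?v"
        using dw(1) by (intro set_eq_iff_mset_eq_distinct[THEN iffD1]) (auto simp: distinct_map inj_on_def simp del: upt_Suc)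
      then have "poly_eval A \<phi> (s - ?single ?v) = 0" if \<phi>: "\<forall>i g. \<phi> (i, g) \<in> hom g" for \<phi>
      proof -
        have \<phi>c: "\<phi> x \<in> carr" for x using \<phi> hom_carr[of "\<phi> x" "snd x"] by (cases x) auto
        have "poly_eval A \<phi> (s - ?single ?v + ?single ?v) =
            poly_eval A \<phi> (s - ?single ?v) + poly_eval A \<phi> (?single ?v)"
          using \<phi>c by (rule poly_eval_add)
        then show ?thesis
          using eval[OF \<phi> w(2)] eval[OF \<phi> w_words, of "fst x" "snd x"] uprod_eq[OF \<phi> \<open>mset w = mset ?v\<close>] w(1)
          by simp
      qed
      moreover have "s - ?single ?v \<in> free_graded_algebra"
        unfolding w(1)
        by (intro poly.subspace_diff[OF subspace_free_graded_algebra] multilinear_words_free[OF _ n] w(2) w_words)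
      ultimately have "s - ?single ?v \<in> graded_identities A"
        by (simp add: graded_identities_def)
      moreover have "s - ?single ?v \<in> multilinear_polys n"
        unfolding w(1) multilinear_polys_eq by (intro poly.span_diff poly.span_base imageI w(2) w_words)
      moreover have "fst x \<in> {1..n}" using x(1) dw(3) by blast
      then have "?single ?v \<in> Z" unfolding Z_def by (intro image_eqI[of _ _ x]) (simp_all only: case_prod_unfold mem_Times_iff UNIV_I simp_thms)
      ultimately show ?thesis by blast
    qed
  qed simp
  also have "card Z \<le> card ({1..n} \<times> (UNIV :: 'g set))"
    unfolding Z_def by (intro card_image_le) simp
  finally show ?thesis by (simp add: card_cartesian_product)
qed

end

lemma quadratic_growth_less_choose:
  assumes "quadratic_growth A" "3 \<le> k"
  shows "\<exists>n\<ge>1. graded_codim A n < n choose k"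
proof -
  obtain \<beta> :: real where \<beta>: "\<beta> > 0" "(\<lambda>n. real (graded_codim A n) - \<beta> * (real n)\<^sup>2) \<in> O(\<lambda>n. real n)"
    using assms(1) unfolding quadratic_growth_def by blast
  then obtain C where C: "eventually (\<lambda>n. norm (real (graded_codim A n) - \<beta> * (real n)\<^sup>2) \<le> C * norm (real n)) sequentially"
    by (auto elim!: landau_o.bigE)
  \<comment> \<open>The threshold is read off from the wanted chain
    \<open>(\<beta> + |C|) n^2 k^k < n^3 \<le> n^k\<close>, as the binomial coefficient is at least
    \<open>(n / k)^k\<close>. The absolute value is there because the constant \<open>C\<close> has
    no known sign.\<close>
  have "eventually (\<lambda>n. (real k ^ k) * (\<beta> + \<bar>C\<bar>) < real n) sequentially"
    by real_asymp
  moreover have "eventually (\<lambda>n. n \<ge> k) sequentially" by (rule eventually_ge_at_top)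
  ultimately have "eventually (\<lambda>n. n \<ge> 1 \<and> graded_codim A n < n choose k) sequentially"
    using C
  proof eventually_elim
    case (elim n)
    have n: "n \<ge> 1" "real n > 0" using elim assms(2) by auto
    have "real (graded_codim A n) \<le> \<beta> * (real n)\<^sup>2 + C * real n" using elim(3) by auto
    also have "C * real n \<le> \<bar>C\<bar> * (real n)\<^sup>2"
      using n by (intro mult_mono) (auto simp: power2_eq_square)
    finally have "real (graded_codim A n) * real k ^ k \<le> (\<beta> + \<bar>C\<bar>) * (real n)\<^sup>2 * real k ^ k"
      by (intro mult_right_mono) (auto simp: algebra_simps)
    also have "\<dots> < real n * (real n)\<^sup>2"
      using elim(1) n by (simp add: mult.commute mult.left_commute)
    also have "\<dots> = real n ^ 3" by (simp add: power3_eq_cube power2_eq_square)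
    also have "\<dots> \<le> real n ^ k" using n assms(2) by (intro power_increasing) auto
    finally have "real (graded_codim A n) < (real n / real k) ^ k"
      using assms(2) by (simp add: power_divide pos_less_divide_eq)
    also have "\<dots> \<le> real (n choose k)" using elim(2) by (rule binomial_ge_n_over_k_pow_k)
    finally show ?case using n by simp
  qed
  then show ?thesis by (auto dest: eventually_happens)
qed

lemma quadratic_growth_not_linear:
  assumes "quadratic_growth A"
  shows "\<exists>n\<ge>1. n * L < graded_codim A n"
proof -
  obtain \<beta> :: real where \<beta>: "\<beta> > 0" "(\<lambda>n. real (graded_codim A n) - \<beta> * (real n)\<^sup>2) \<in> O(\<lambda>n. real n)"
    using assms(1) unfolding quadratic_growth_def by blast
  then obtain C where C: "eventually (\<lambda>n. norm (real (graded_codim A n) - \<beta> * (real n)\<^sup>2) \<le> C * norm (real n)) sequentially"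
    by (auto elim!: landau_o.bigE)
  have "eventually (\<lambda>n. real L + C < \<beta> * real n) sequentially"
    using \<beta>(1) by real_asymp
  moreover have "eventually (\<lambda>n. n \<ge> (1::nat)) sequentially" by (rule eventually_ge_at_top)
  ultimately have "eventually (\<lambda>n. n \<ge> 1 \<and> n * L < graded_codim A n) sequentially"
    using C
  proof eventually_elim
    case (elim n)
    have "real n * (real L + C) < real n * (\<beta> * real n)"
      using elim by (intro mult_strict_left_mono) auto
    moreover have "\<beta> * (real n)\<^sup>2 - C * real n \<le> real (graded_codim A n)" using elim(3) by auto
    ultimately have "real (n * L) < real (graded_codim A n)"
      by (simp add: algebra_simps power2_eq_square)
    then have "n * L < graded_codim A n" by (simp only: of_nat_less_iff)
    then show ?case using elim by simp
  qed
  then show ?thesis by (auto dest: eventually_happens)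
qed

subsection \<open>The summands\<close>

lemma bilinear_identity_flip: "bilinear_identity X g h a b \<longleftrightarrow> bilinear_identity X h g b a"
  unfolding bilinear_identity_def by (metis add.commute)

context unital_graded
begin

lemma bilinear_identity_add:
  assumes "bilinear_identity A g h a b" "bilinear_identity A g h a' b'"
  shows "bilinear_identity A g h (a + a') (b + b')"
  unfolding bilinear_identity_def
proof (intro ballI)
  fix x y assume xy: "x \<in> hom g" "y \<in> hom h"
  then have c: "x \<bullet> y \<in> carr" "y \<bullet> x \<in> carr" by (auto intro: mult_closed hom_carr)
  have "(a + a') *\<^sub>A (x \<bullet> y) + (b + b') *\<^sub>A (y \<bullet> x) =
      (a *\<^sub>A (x \<bullet> y) + b *\<^sub>A (y \<bullet> x)) + (a' *\<^sub>A (x \<bullet> y) + b' *\<^sub>A (y \<bullet> x))"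
    using c by (simp add: scale_add_left)
  then show "(a + a') *\<^sub>A (x \<bullet> y) + (b + b') *\<^sub>A (y \<bullet> x) = 0"
    using assms xy by (simp add: bilinear_identity_def)
qed

lemma bilinear_identity_scale:
  assumes "bilinear_identity A g h a b"
  shows "bilinear_identity A g h (c * a) (c * b)"
  unfolding bilinear_identity_def
proof (intro ballI)
  fix x y assume xy: "x \<in> hom g" "y \<in> hom h"
  then have cl: "x \<bullet> y \<in> carr" "y \<bullet> x \<in> carr" by (auto intro: mult_closed hom_carr)
  have "(c * a) *\<^sub>A (x \<bullet> y) + (c * b) *\<^sub>A (y \<bullet> x) = c *\<^sub>A (a *\<^sub>A (x \<bullet> y) + b *\<^sub>A (y \<bullet> x))"
    using cl by (simp add: scale_add_right scale_scale scale_closed)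
  then show "(c * a) *\<^sub>A (x \<bullet> y) + (c * b) *\<^sub>A (y \<bullet> x) = 0"
    using assms xy by (simp add: bilinear_identity_def)
qed

lemma bilinear_identity_zero: "bilinear_identity A g h 0 0"
  by (simp add: bilinear_identity_def scale_zero_left mult_closed hom_carr)

lemma bilinear_identity_of_scale:
  assumes "bilinear_identity A g h (c * a) (c * b)" "c \<noteq> 0"
  shows "bilinear_identity A g h a b"
  using bilinear_identity_scale[OF assms(1), of "inverse c"] assms(2) by (simp add: mult.assoc[symmetric])

lemma bilinear_identity_trivial:
  assumes "hom g = {0} \<or> hom h = {0}"
  shows "bilinear_identity A g h a b"
  unfolding bilinear_identity_def
proof (intro ballI)
  fix x y assume xy: "x \<in> hom g" "y \<in> hom h"
  then have "x = 0 \<or> y = 0" using assms by blast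
  moreover have "x \<in> carr" "y \<in> carr" using xy hom_carr by blast+
  ultimately have "x \<bullet> y = 0" "y \<bullet> x = 0" using mult_zero_left mult_zero_right by blast+
  then show "a *\<^sub>A (x \<bullet> y) + b *\<^sub>A (y \<bullet> x) = 0" by simp
qed

lemma bilinear_identity_unit:
  assumes "bilinear_identity A 0 h a b" "x \<in> hom h" "x \<noteq> 0"
  shows "a + b = 0"
proof -
  have "(a + b) *\<^sub>A x = 0"
    using assms unit_homogeneous hom_carr
    by (force simp: bilinear_identity_def scale_add_left unit_left unit_right)
  then show ?thesis using assms hom_carr scale_cancel by blast
qed

end

context nilpotent_basis
begin

text \<open>Against the unit, \<open>a x y + b y x\<close> collapses to a + b times the other
  factor. So degree 0 on either side contributes only a + b = 0, and the last premise deals with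
  J.\<close>

lemma bilinear_identity_algI:
  assumes "\<And>x. (x, h) \<in> set js \<Longrightarrow> g = 0 \<Longrightarrow> a + b = 0" "\<And>x. (x, g) \<in> set js \<Longrightarrow> h = 0 \<Longrightarrow> a + b = 0"
    and "g = 0 \<Longrightarrow> h = 0 \<Longrightarrow> a + b = 0"
    and "\<And>x y. (x, g) \<in> set js \<Longrightarrow> (y, h) \<in> set js \<Longrightarrow> coeff_scale a (mul x y) + coeff_scale b (mul y x) = 0"
  shows "bilinear_identity alg g h a b"
  unfolding bilinear_identity_basis_iff
proof (intro allI impI)
  have unit: "coeff_scale a z + coeff_scale b z = 0" if "a + b = 0" for z
    using that by (metis coeff.scale_left_distrib coeff.scale_zero_left)
  fix x y assume xy: "(x, g) \<in> set bs" "(y, h) \<in> set bs"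
  then consider "x = one" "g = 0" "y = one" "h = 0" | "x = one" "g = 0" "(y, h) \<in> set js"
    | "(x, g) \<in> set js" "y = one" "h = 0" | "(x, g) \<in> set js" "(y, h) \<in> set js" by auto
  then show "coeff_scale a (mul x y) + coeff_scale b (mul y x) = 0"
  proof cases
    case 1
    then show ?thesis using unit assms(3) one_one by metis
  next
    case 2
    then have "y \<in> fst ` set js" by force
    then show ?thesis using 2 unit assms(1) one_left one_right by metis
  next
    case 3
    then have "x \<in> fst ` set js" by force
    then show ?thesis using 3 unit assms(2) one_left one_right by metis
  next
    case 4
    then show ?thesis using assms(4) by blast
  qed
qed

end

text \<open>The common shape of \<open>K\<^sub>7\<close>, \<open>\<G>\<^sub>2\<close> and \<open>W\<^sub>\<alpha>\<close>, with \<open>\<mu>\<close> equal to \<open>0\<close>, \<open>-1\<close> and \<open>\<alpha>\<close>.\<close>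

locale heisenberg_basis =
  fixes mul :: "(nat \<Rightarrow> nat \<Rightarrow> 'a::field_char_0) \<Rightarrow> (nat \<Rightarrow> nat \<Rightarrow> 'a) \<Rightarrow> nat \<Rightarrow> nat \<Rightarrow> 'a"
    and one b1 b2 b3 :: "nat \<Rightarrow> nat \<Rightarrow> 'a"
    and g1 g2 :: "'g::{group_add,finite}" and \<mu> :: 'a
  assumes mul_add_left: "mul (x + y) z = mul x z + mul y z"
    and mul_add_right: "mul x (y + z) = mul x y + mul x z"
    and mul_scale_left: "mul (coeff_scale c x) y = coeff_scale c (mul x y)"
    and mul_scale_right: "mul x (coeff_scale c y) = coeff_scale c (mul x y)"
    and units: "mul one one = one" "mul one b1 = b1" "mul one b2 = b2" "mul one b3 = b3"
      "mul b1 one = b1" "mul b2 one = b2" "mul b3 one = b3"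
    and products: "mul b1 b2 = b3" "mul b2 b1 = coeff_scale \<mu> b3"
    and squares: "mul b1 b1 = 0" "mul b2 b2 = 0"
    and annihilate: "mul b1 b3 = 0" "mul b2 b3 = 0" "mul b3 b1 = 0" "mul b3 b2 = 0" "mul b3 b3 = 0"
    and nonzero: "b3 \<noteq> 0"
begin

lemma nilpotent: "nilpotent_basis mul one [(b1, g1), (b2, g2), (b3, g1 + g2)]"
proof
  have z: "mul x 0 = 0" for x using mul_add_right[of x 0 0] by simp
  show "mul x (mul y w) = 0"
    if "x \<in> fst ` set [(b1, g1), (b2, g2), (b3, g1 + g2)]" "y \<in> fst ` set [(b1, g1), (b2, g2), (b3, g1 + g2)]"
      "w \<in> fst ` set [(b1, g1), (b2, g2), (b3, g1 + g2)]" for x y w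
    using that by (auto simp: products squares annihilate z mul_scale_right)
  show "mul x y \<in> coeff.span (fst ` set [(b1, g1), (b2, g2), (b3, g1 + g2)])"
    if "x \<in> fst ` set [(b1, g1), (b2, g2), (b3, g1 + g2)]" "y \<in> fst ` set [(b1, g1), (b2, g2), (b3, g1 + g2)]" for x y
  proof -
    have "b3 \<in> coeff.span (fst ` set [(b1, g1), (b2, g2), (b3, g1 + g2)])" by (intro coeff.span_base) simp
    then show ?thesis
      using that by (auto simp: products squares annihilate coeff.span_zero coeff.span_scale)
  qed
qed (auto simp: mul_add_left mul_add_right mul_scale_left mul_scale_right units)

sublocale nilpotent_basis mul one "[(b1, g1), (b2, g2), (b3, g1 + g2)]"
  by (rule nilpotent)

lemma bilinear_identity_eq:
  assumes "bilinear_identity alg g1 g2 a b"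
  shows "a + b * \<mu> = 0"
proof -
  have "coeff_scale a (mul b1 b2) + coeff_scale b (mul b2 b1) = 0"
    using assms unfolding bilinear_identity_basis_iff by (metis list.set_intros)
  then have "coeff_scale (a + b * \<mu>) b3 = 0"
    by (simp only: products coeff.scale_scale coeff.scale_left_distrib)
  then show ?thesis using nonzero coeff.scale_eq_0_iff by blast
qed

text \<open>The condition on the single pair \<open>g1\<close>, \<open>g2\<close> controls all
  pairs. It provides a nonzero product in \<open>U\<close>, so \<open>U\<close> has nonzero elements
  in degrees 0, \<open>g1\<close>, \<open>g2\<close> and \<open>g1 + g2\<close>, and a + b = 0 is
  forced wherever the unit of the summand meets one of its basis elements. The only other products
  that can be nonzero are those of \<open>b1\<close> and \<open>b2\<close> in the two orders, to
  which the condition applies directly.\<close>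

lemma bilinear_identity_inherited:
  assumes U: "unital_graded U e"
    and hom_mult: "\<And>g h x y. x \<in> homogeneous U g \<Longrightarrow> y \<in> homogeneous U h \<Longrightarrow> alg_mult U x y \<in> homogeneous U (g + h)"
    and orth: "\<And>a b. bilinear_identity U g1 g2 a b \<Longrightarrow> a + b * \<mu> = 0"
    and id: "bilinear_identity U g h a b"
  shows "bilinear_identity alg g h a b"
proof -
  interpret U: unital_graded U e by (rule U)
  \<comment> \<open>If all these products were 0, then (1, 0) would be an identity, although the
    left side of the required equation is 1 at (1, 0).\<close>
  have xy: "\<exists>x\<in>U.hom g1. \<exists>y\<in>U.hom g2. alg_mult U x y \<noteq> 0"
  proof (rule ccontr)
    assume "\<not> ?thesis"
    then have "bilinear_identity U g1 g2 1 0"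
      by (auto simp: bilinear_identity_def U.scale_zero_left U.mult_closed U.hom_carr)
    then show False using orth by fastforce
  qed
  have ne: "\<exists>x\<in>U.hom k. x \<noteq> 0" if "(z, k) \<in> set [(b1, g1), (b2, g2), (b3, g1 + g2)]" for z k
  proof -
    obtain x y where xy: "x \<in> U.hom g1" "y \<in> U.hom g2" "alg_mult U x y \<noteq> 0" using xy by blast
    then have "x \<noteq> 0" "y \<noteq> 0" using U.mult_zero_left U.mult_zero_right U.hom_carr by metis+
    then show ?thesis using xy hom_mult that by auto
  qed
  have e: "e \<noteq> 0" using ne[of b1 g1] U.unit_left U.mult_zero_left U.hom_carr by fastforce
  show ?thesis
  proof (rule bilinear_identity_algI)
    show "a + b = 0" if "(x, h) \<in> set [(b1, g1), (b2, g2), (b3, g1 + g2)]" "g = 0" for x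
      using ne[OF that(1)] U.bilinear_identity_unit[of h a b] id that(2) by blast
    show "a + b = 0" if "(x, g) \<in> set [(b1, g1), (b2, g2), (b3, g1 + g2)]" "h = 0" for x
      using ne[OF that(1)] U.bilinear_identity_unit[of g b a] id that(2) bilinear_identity_flip[of U g 0 a b]
      by (auto simp: add.commute)
    show "a + b = 0" if "g = 0" "h = 0"
      using U.bilinear_identity_unit[of h a b e] id that e U.unit_homogeneous by blast
    have 1: "a + b * \<mu> = 0" if "g = g1" "h = g2" using orth id that by blast
    have 2: "b + a * \<mu> = 0" if "g = g2" "h = g1" using orth[of b a] id bilinear_identity_flip[of U g h a b] that by simp
    fix x y assume xy: "(x, g) \<in> set [(b1, g1), (b2, g2), (b3, g1 + g2)]" "(y, h) \<in> set [(b1, g1), (b2, g2), (b3, g1 + g2)]"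
    consider "x = b1" "g = g1" "y = b2" "h = g2" | "x = b2" "g = g2" "y = b1" "h = g1"
      | "mul x y = 0" "mul y x = 0"
      using xy by (auto simp: squares annihilate)
    then show "coeff_scale a (mul x y) + coeff_scale b (mul y x) = 0"
    proof cases
      case 1
      then have "coeff_scale a (mul x y) + coeff_scale b (mul y x) = coeff_scale (a + b * \<mu>) b3"
        by (simp only: products coeff.scale_scale coeff.scale_left_distrib)
      then show ?thesis using \<open>\<lbrakk>g = g1; h = g2\<rbrakk> \<Longrightarrow> a + b * \<mu> = 0\<close> 1 by simp
    next
      case 2
      then have "coeff_scale a (mul x y) + coeff_scale b (mul y x) = coeff_scale (b + a * \<mu>) b3"
        by (simp only: products coeff.scale_scale coeff.scale_left_distrib add.commute)
      then show ?thesis using \<open>\<lbrakk>g = g2; h = g1\<rbrakk> \<Longrightarrow> b + a * \<mu> = 0\<close> 2 by simp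
    qed simp
  qed
qed

end

section \<open>Multiplication in the concrete summands\<close>

lemma mat_mult_add_left: "mat_mult m (x + y) z = mat_mult m x z + mat_mult m y z"
  and mat_mult_add_right: "mat_mult m x (y + z) = mat_mult m x y + mat_mult m x z"
  and mat_mult_scale_left: "mat_mult m (coeff_scale c x) y = coeff_scale c (mat_mult m x y)"
  and mat_mult_scale_right: "mat_mult m x (coeff_scale c y) = coeff_scale c (mat_mult m x y)"
  by (simp_all add: mat_mult_def fun_eq_iff coeff_scale_def sum.distrib sum_distrib_left algebra_simps)

lemma mat_mult_unit_at:
  "mat_mult m (unit_at i j) (unit_at k l) = (if j = k \<and> 1 \<le> j \<and> j \<le> m then unit_at i l else (0 :: nat \<Rightarrow> nat \<Rightarrow> 'a::field))"
proof (intro ext)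
  fix p q
  have "mat_mult m (unit_at i j) (unit_at k l) p q = (\<Sum>r=1..m. if r = j then (if p = i \<and> j = k \<and> q = l then (1::'a) else 0) else 0)"
    unfolding mat_mult_def unit_at_def by (intro sum.cong) auto
  then show "mat_mult m (unit_at i j) (unit_at k l) p q =
      (if j = k \<and> 1 \<le> j \<and> j \<le> m then unit_at i l else (0 :: nat \<Rightarrow> nat \<Rightarrow> 'a)) p q"
    by (auto simp: unit_at_def)
qed

lemma mat_mult_zero: "mat_mult m 0 x = 0" "mat_mult m x 0 = 0"
  by (simp_all add: mat_mult_def fun_eq_iff)

lemmas mat_mult_simps =
  mat_mult_zero
  mat_mult_add_left mat_mult_add_right mat_mult_scale_left mat_mult_scale_right mat_mult_unit_at

lemma unit_at_nonzero: "unit_at i j \<noteq> (0 :: nat \<Rightarrow> nat \<Rightarrow> 'a::field)"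
  by (auto simp: unit_at_def fun_eq_iff)

lemma grassmann_mult_add_left: "grassmann_mult (x + y) z = grassmann_mult x z + grassmann_mult y z"
  and grassmann_mult_add_right: "grassmann_mult x (y + z) = grassmann_mult x y + grassmann_mult x z"
  and grassmann_mult_scale_left: "grassmann_mult (coeff_scale c x) y = coeff_scale c (grassmann_mult x y)"
  and grassmann_mult_scale_right: "grassmann_mult x (coeff_scale c y) = coeff_scale c (grassmann_mult x y)"
  by (simp_all add: grassmann_mult_def fun_eq_iff coeff_scale_def sum.distrib sum_distrib_left algebra_simps)

text \<open>With the four coefficients written out, the products of basis elements become decidable
  by simplification.\<close>

lemma grassmann_mult_eq:
  "grassmann_mult X Y = (\<lambda>i j.
     if i = 0 \<and> j = 0 then X 0 0 * Y 0 0
     else if i = 1 \<and> j = 0 then X 0 0 * Y 1 0 + X 1 0 * Y 0 0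
     else if i = 0 \<and> j = 1 then X 0 0 * Y 0 1 + X 0 1 * Y 0 0
     else if i = 1 \<and> j = 1 then X 0 0 * Y 1 1 + X 1 0 * Y 0 1 - X 0 1 * Y 1 0 + X 1 1 * Y 0 0
     else 0)"
proof (intro ext)
  fix i j :: nat
  consider "i = 0" "j = 0" | "i = 1" "j = 0" | "i = 0" "j = 1" | "i = 1" "j = 1" | "\<not> (i \<le> 1 \<and> j \<le> 1)"
    by linarith
  then show "grassmann_mult X Y i j = (if i = 0 \<and> j = 0 then X 0 0 * Y 0 0
     else if i = 1 \<and> j = 0 then X 0 0 * Y 1 0 + X 1 0 * Y 0 0
     else if i = 0 \<and> j = 1 then X 0 0 * Y 0 1 + X 0 1 * Y 0 0
     else if i = 1 \<and> j = 1 then X 0 0 * Y 1 1 + X 1 0 * Y 0 1 - X 0 1 * Y 1 0 + X 1 1 * Y 0 0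
     else 0)"
    by cases (auto simp: grassmann_mult_def)
qed

lemma heisenberg_K7:
  "heisenberg_basis (mat_mult 3) (unit_at 1 1 + unit_at 2 2 + unit_at 3 3)
     (unit_at 1 2) (unit_at 2 3) (unit_at 1 3) (0 :: 'a::field_char_0)"
  by unfold_locales (simp_all add: mat_mult_simps unit_at_nonzero)

lemma heisenberg_W:
  "heisenberg_basis (mat_mult 4) (unit_at 1 1 + unit_at 2 2 + unit_at 3 3 + unit_at 4 4)
     (unit_at 1 2 + unit_at 3 4) (coeff_scale \<alpha> (unit_at 1 3) + unit_at 2 4) (unit_at 1 4) (\<alpha> :: 'a::field_char_0)"
  by unfold_locales (simp_all add: mat_mult_simps unit_at_nonzero)

lemma heisenberg_Grassmann:
  "heisenberg_basis grassmann_mult (unit_at 0 0) (unit_at 1 0) (unit_at 0 1) (unit_at 1 1) (- 1 :: 'a::field_char_0)"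
proof unfold_locales
  show "grassmann_mult (unit_at 0 0) (unit_at 0 0) = (unit_at 0 0 :: nat \<Rightarrow> nat \<Rightarrow> 'a)"
    "grassmann_mult (unit_at 0 0) (unit_at 1 0) = (unit_at 1 0 :: nat \<Rightarrow> nat \<Rightarrow> 'a)"
    "grassmann_mult (unit_at 0 0) (unit_at 0 1) = (unit_at 0 1 :: nat \<Rightarrow> nat \<Rightarrow> 'a)"
    "grassmann_mult (unit_at 0 0) (unit_at 1 1) = (unit_at 1 1 :: nat \<Rightarrow> nat \<Rightarrow> 'a)"
    "grassmann_mult (unit_at 1 0) (unit_at 0 0) = (unit_at 1 0 :: nat \<Rightarrow> nat \<Rightarrow> 'a)"
    "grassmann_mult (unit_at 0 1) (unit_at 0 0) = (unit_at 0 1 :: nat \<Rightarrow> nat \<Rightarrow> 'a)"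
    "grassmann_mult (unit_at 1 1) (unit_at 0 0) = (unit_at 1 1 :: nat \<Rightarrow> nat \<Rightarrow> 'a)"
    "grassmann_mult (unit_at 1 0) (unit_at 0 1) = (unit_at 1 1 :: nat \<Rightarrow> nat \<Rightarrow> 'a)"
    "grassmann_mult (unit_at 0 1) (unit_at 1 0) = (coeff_scale (- 1) (unit_at 1 1) :: nat \<Rightarrow> nat \<Rightarrow> 'a)"
    "grassmann_mult (unit_at 1 0) (unit_at 1 0) = (0 :: nat \<Rightarrow> nat \<Rightarrow> 'a)"
    "grassmann_mult (unit_at 0 1) (unit_at 0 1) = (0 :: nat \<Rightarrow> nat \<Rightarrow> 'a)"
    "grassmann_mult (unit_at 1 0) (unit_at 1 1) = (0 :: nat \<Rightarrow> nat \<Rightarrow> 'a)"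
    "grassmann_mult (unit_at 0 1) (unit_at 1 1) = (0 :: nat \<Rightarrow> nat \<Rightarrow> 'a)"
    "grassmann_mult (unit_at 1 1) (unit_at 1 0) = (0 :: nat \<Rightarrow> nat \<Rightarrow> 'a)"
    "grassmann_mult (unit_at 1 1) (unit_at 0 1) = (0 :: nat \<Rightarrow> nat \<Rightarrow> 'a)"
    "grassmann_mult (unit_at 1 1) (unit_at 1 1) = (0 :: nat \<Rightarrow> nat \<Rightarrow> 'a)"
    by (auto simp: grassmann_mult_eq fun_eq_iff unit_at_def coeff_scale_def)
qed (simp_all add: grassmann_mult_add_left grassmann_mult_add_right grassmann_mult_scale_left
    grassmann_mult_scale_right unit_at_nonzero)

lemma nilpotent_F: "nilpotent_basis (mat_mult 1) (unit_at 1 1 :: nat \<Rightarrow> nat \<Rightarrow> 'a::field_char_0) []"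
  by unfold_locales (simp_all add: mat_mult_simps)

lemma C_alg_2:
  "C_alg 2 q = basis_algebra (mat_mult 2) [(unit_at 1 1 + unit_at 2 2, 0), (unit_at 1 2 :: nat \<Rightarrow> nat \<Rightarrow> 'a::field, q)]"
proof -
  have "(id_mat (Suc (Suc 0)) :: nat \<Rightarrow> nat \<Rightarrow> 'a) = unit_at (Suc 0) (Suc 0) + unit_at (Suc (Suc 0)) (Suc (Suc 0))"
    by (simp add: id_mat_def)
  moreover have "[Suc 0..<Suc (Suc 0)] = [Suc 0]" by simp
  ultimately show ?thesis by (simp add: C_alg_def mat_mult_simps numeral_2_eq_2)
qed

lemma C_alg_3:
  "C_alg 3 q = basis_algebra (mat_mult 3)
     [(unit_at 1 1 + unit_at 2 2 + unit_at 3 3, 0), (unit_at 1 2 + unit_at 2 3, q),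
      (unit_at 1 3 :: nat \<Rightarrow> nat \<Rightarrow> 'a::field, q + q)]"
proof -
  have "(id_mat (Suc (Suc (Suc 0))) :: nat \<Rightarrow> nat \<Rightarrow> 'a) = unit_at (Suc 0) (Suc 0) +
      unit_at (Suc (Suc 0)) (Suc (Suc 0)) + unit_at (Suc (Suc (Suc 0))) (Suc (Suc (Suc 0)))"
    by (simp add: id_mat_def)
  moreover have "(\<Sum>i=Suc 0..Suc (Suc 0). unit_at i (Suc i)) =
      (unit_at (Suc 0) (Suc (Suc 0)) + unit_at (Suc (Suc 0)) (Suc (Suc (Suc 0))) :: nat \<Rightarrow> nat \<Rightarrow> 'a)"
    by simp
  moreover have "[Suc 0..<Suc (Suc (Suc 0))] = [Suc 0, Suc (Suc 0)]" by simp
  ultimately show ?thesis by (simp add: C_alg_def mat_mult_simps numeral_2_eq_2 numeral_3_eq_3 Let_def)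
qed

lemma nilpotent_C2:
  "nilpotent_basis (mat_mult 2) (unit_at 1 1 + unit_at 2 2) [(unit_at 1 2 :: nat \<Rightarrow> nat \<Rightarrow> 'a::field_char_0, q)]"
  by unfold_locales (simp_all add: mat_mult_simps coeff.span_zero)

lemma nilpotent_C3:
  "nilpotent_basis (mat_mult 3) (unit_at 1 1 + unit_at 2 2 + unit_at 3 3)
     [(unit_at 1 2 + unit_at 2 3 :: nat \<Rightarrow> nat \<Rightarrow> 'a::field_char_0, q), (unit_at 1 3, q + q)]"
  by unfold_locales (auto simp: mat_mult_simps coeff.span_zero intro: coeff.span_base)

lemma summand_determined_by_pairs:
  fixes X :: "('g::{group_add,finite}, 'a::field_char_0, nat \<Rightarrow> nat \<Rightarrow> 'a) graded_alg"
  assumes "X \<in> summands"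
  shows "\<exists>e. unital_graded X e \<and> determined_by_pairs X e"
proof -
  have nilpotent: "\<exists>e. unital_graded (basis_algebra mul ((one, 0) # js)) e \<and>
      determined_by_pairs (basis_algebra mul ((one, 0) # js)) e"
    if "nilpotent_basis mul one js" for mul one and js :: "((nat \<Rightarrow> nat \<Rightarrow> 'a) \<times> 'g) list"
    using nilpotent_basis.unital_graded_alg[OF that] nilpotent_basis.determined_by_pairs_alg[OF that] by blast
  show ?thesis
    using assms unfolding summands_def quadratic_summands_def
    by (auto simp only: Un_iff mem_Collect_eq singleton_iff F_alg_def C_alg_2 C_alg_3 K7_alg_def
        Grassmann_alg_def W_alg_def
        intro!: nilpotent nilpotent_F nilpotent_C2 nilpotent_C3
          heisenberg_basis.nilpotent heisenberg_K7 heisenberg_Grassmann heisenberg_W)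
qed

lemmas K7_identity_eq =
  heisenberg_basis.bilinear_identity_eq[OF heisenberg_K7, folded K7_alg_def]
lemmas W_identity_eq =
  heisenberg_basis.bilinear_identity_eq[OF heisenberg_W, folded W_alg_def]
lemmas Grassmann_identity_eq =
  heisenberg_basis.bilinear_identity_eq[OF heisenberg_Grassmann, folded Grassmann_alg_def]

lemma F_identity_eq:
  assumes "bilinear_identity (F_alg :: ('g::{group_add,finite}, 'a::field_char_0, _) graded_alg) 0 0 a b"
  shows "a + b = 0"
proof -
  interpret nilpotent_basis "mat_mult 1" "unit_at 1 1 :: nat \<Rightarrow> nat \<Rightarrow> 'a" "[] :: ((nat \<Rightarrow> nat \<Rightarrow> 'a) \<times> 'g) list"
    by (rule nilpotent_F)
  show ?thesis using bilinear_identity_unit[OF _ unit_homogeneous] assms unit_at_nonzero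
    unfolding F_alg_def by blast
qed

lemma C2_identity_eq:
  assumes "bilinear_identity (C_alg 2 q :: ('g::{group_add,finite}, 'a::field_char_0, _) graded_alg) 0 q a b"
  shows "a + b = 0"
proof -
  interpret nilpotent_basis "mat_mult 2" "unit_at 1 1 + unit_at 2 2" "[(unit_at 1 2 :: nat \<Rightarrow> nat \<Rightarrow> 'a, q)]"
    by (rule nilpotent_C2)
  have "unit_at 1 2 \<in> homogeneous alg q" unfolding alg_simps by (intro coeff.span_base) simp
  then show ?thesis using bilinear_identity_unit[of q a b "unit_at 1 2"] assms unit_at_nonzero
    unfolding C_alg_2 by blast
qed

lemma C3_identity_eq:
  assumes "bilinear_identity (C_alg 3 q :: ('g::{group_add,finite}, 'a::field_char_0, _) graded_alg) q q a b"
  shows "a + b = 0"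
proof -
  interpret nilpotent_basis "mat_mult 3" "unit_at 1 1 + unit_at 2 2 + unit_at 3 3"
    "[(unit_at 1 2 + unit_at 2 3 :: nat \<Rightarrow> nat \<Rightarrow> 'a, q), (unit_at 1 3, q + q)]"
    by (rule nilpotent_C3)
  let ?x = "unit_at 1 2 + unit_at 2 3 :: nat \<Rightarrow> nat \<Rightarrow> 'a"
  have "coeff_scale a (mat_mult 3 ?x ?x) + coeff_scale b (mat_mult 3 ?x ?x) = 0"
    using assms unfolding C_alg_3 bilinear_identity_basis_iff by (metis list.set_intros)
  moreover have "mat_mult 3 ?x ?x = unit_at 1 3" by (simp add: mat_mult_simps)
  ultimately have "coeff_scale (a + b) (unit_at 1 3 :: nat \<Rightarrow> nat \<Rightarrow> 'a) = 0"
    by (simp only: coeff.scale_left_distrib)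
  then show ?thesis using unit_at_nonzero coeff.scale_eq_0_iff by blast
qed

text \<open>These additions concern the algebra that generates the variety: associativity reorders
  products for the linear codimension bound, the degree of a product feeds the inheritance lemmas,
  and independence separates x y from y x when g + h \<noteq> h + g.\<close>

locale unital_associative_graded = unital_graded A e
  for A :: "('g::{group_add,finite}, 'a::field_char_0, 'v::ab_group_add) graded_alg" and e +
  assumes mult_assoc: "\<lbrakk>x \<in> alg_carrier A; y \<in> alg_carrier A; z \<in> alg_carrier A\<rbrakk> \<Longrightarrow>
      alg_mult A (alg_mult A x y) z = alg_mult A x (alg_mult A y z)"
    and homogeneous_mult: "\<lbrakk>x \<in> homogeneous A g; y \<in> homogeneous A h\<rbrakk> \<Longrightarrow>
      alg_mult A x y \<in> homogeneous A (g + h)"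
    and homogeneous_independent: "\<lbrakk>x \<in> homogeneous A g; y \<in> homogeneous A h; g \<noteq> h; x + y = 0\<rbrakk> \<Longrightarrow> x = 0"

section \<open>Homogeneity of the unit\<close>

context graded_algebra
begin

lemma homogeneous_components_unique:
  assumes "\<And>g. f g \<in> homogeneous A g" "\<And>g. f' g \<in> homogeneous A g" "(\<Sum>g\<in>UNIV. f g) = (\<Sum>g\<in>UNIV. f' g)"
  shows "f = f'"
proof -
  have "(\<Sum>g\<in>I. f g) \<in> alg_carrier A" for I
    using assms(1) homogeneous_subset
    by (induction I rule: infinite_finite_induct) (auto simp: zero_closed intro!: add_closed)
  then show ?thesis using homogeneous_decomposition[of "\<Sum>g\<in>UNIV. f g"] assms by blast
qed

lemma component_of_homogeneous:
  assumes "\<And>g. f g \<in> homogeneous A g" "x \<in> homogeneous A h" "(\<Sum>g\<in>UNIV. f g) = x"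
  shows "f h = x"
proof -
  have "f = (\<lambda>g. if g = h then x else 0)"
    using assms by (intro homogeneous_components_unique) (auto simp: homogeneous_zero)
  then show ?thesis by simp
qed

text \<open>Write e as the sum of its components \<open>f g\<close>. In e \<open>f h\<close> =
  \<open>f h\<close> the part of degree h is \<open>f 0\<close> times \<open>f h\<close>, so
  \<open>f 0\<close> fixes every component from the left. Summing over h gives \<open>f 0\<close> e
  = e, while \<open>f 0\<close> e = \<open>f 0\<close>.\<close>

lemma unit_is_homogeneous:
  assumes e: "e \<in> alg_carrier A" "\<And>x. x \<in> alg_carrier A \<Longrightarrow> alg_mult A e x = x"
    "\<And>x. x \<in> alg_carrier A \<Longrightarrow> alg_mult A x e = x"
  shows "e \<in> homogeneous A 0"
proof -
  obtain f where f: "\<And>g. f g \<in> homogeneous A g" "e = (\<Sum>g\<in>UNIV. f g)"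
    using homogeneous_decomposition[OF e(1)] by blast
  have fc: "f g \<in> alg_carrier A" for g using f homogeneous_subset by blast
  have sc: "(\<Sum>g\<in>I. f g) \<in> alg_carrier A" for I
    by (induction I rule: infinite_finite_induct) (auto simp: zero_closed fc intro!: add_closed)
  have zero: "alg_mult A 0 x = 0" "alg_mult A x 0 = 0" if "x \<in> alg_carrier A" for x
    using mult_add_left[of 0 0 x] mult_add_right[of x 0 0] zero_closed that by simp_all
  have suml: "alg_mult A (\<Sum>g\<in>I. f g) x = (\<Sum>g\<in>I. alg_mult A (f g) x)" if "x \<in> alg_carrier A" for I x
    using that by (induction I rule: infinite_finite_induct) (auto simp: zero mult_add_left fc sc)
  have sumr: "alg_mult A x (\<Sum>g\<in>I. f g) = (\<Sum>g\<in>I. alg_mult A x (f g))" if "x \<in> alg_carrier A" for I x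
    using that by (induction I rule: infinite_finite_induct) (auto simp: zero mult_add_right fc sc)
  have unit0: "alg_mult A (f 0) (f h) = f h" for h
  proof -
    have "(\<Sum>k\<in>UNIV. alg_mult A (f (k - h)) (f h)) = (\<Sum>g\<in>UNIV. alg_mult A (f g) (f h))"
      by (rule sum.reindex_bij_witness[of _ "\<lambda>g. g + h" "\<lambda>k. k - h"]) auto
    also have "\<dots> = f h" using suml[where I = UNIV, OF fc[of h]] f(2) e(2)[OF fc] by simp
    finally have sum: "(\<Sum>k\<in>UNIV. alg_mult A (f (k - h)) (f h)) = f h" .
    have "alg_mult A (f (k - h)) (f h) \<in> homogeneous A k" for k
      using homogeneous_mult[OF f(1) f(1), of "k - h" h] by simp
    from component_of_homogeneous[OF this f(1) sum] show ?thesis by simp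
  qed
  have "f 0 = alg_mult A (f 0) e" using e(3) fc by simp
  also have "\<dots> = (\<Sum>h\<in>UNIV. alg_mult A (f 0) (f h))" using sumr[where I = UNIV, OF fc[of 0]] f(2) by simp
  also have "\<dots> = e" using unit0 f(2) by simp
  finally show ?thesis using f(1) by metis
qed

end

lemma unital_associative_gradedI:
  fixes A :: "('g::{group_add,finite}, 'a::field_char_0, 'v::ab_group_add) graded_alg"
  assumes "graded_algebra A" "unitary A"
  shows "\<exists>e. unital_associative_graded A e"
proof -
  interpret graded_algebra A by (rule assms)
  obtain e where e: "e \<in> alg_carrier A" "\<And>x. x \<in> alg_carrier A \<Longrightarrow> alg_mult A e x = x"
    "\<And>x. x \<in> alg_carrier A \<Longrightarrow> alg_mult A x e = x"
    using assms unfolding unitary_def by blast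
  have indep: "x = 0" if "x \<in> homogeneous A g" "y \<in> homogeneous A h" "g \<noteq> h" "x + y = 0" for x y g h
  proof -
    define f where "f = (\<lambda>k. if k = g then x else if k = h then y else 0)"
    have "(\<Sum>k\<in>UNIV. f k) = (\<Sum>k\<in>UNIV. (if k = g then x else 0) + (if k = h then y else 0))"
      using that(3) by (intro sum.cong) (auto simp: f_def)
    also have "\<dots> = 0" using that(4) by (simp add: sum.distrib)
    finally have "(\<Sum>k\<in>UNIV. f k) = 0" .
    moreover have "f k \<in> homogeneous A k" for k using that(1,2) homogeneous_zero by (simp add: f_def)
    ultimately have "f g = 0" using component_of_homogeneous[of f 0 g] homogeneous_zero by simp
    then show ?thesis by (simp add: f_def)
  qed
  have e0: "e \<in> homogeneous A 0" using e by (rule unit_is_homogeneous)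
  have "unital_associative_graded A e"
    by unfold_locales
      (fact zero_closed add_closed scale_closed mult_closed scale_add_right scale_add_left scale_scale
        scale_one mult_add_left mult_add_right mult_scale_left mult_scale_right homogeneous_subset
        homogeneous_zero homogeneous_add homogeneous_scale mult_assoc homogeneous_mult e indep
        e0)+
  then show ?thesis by blast
qed

section \<open>Identities of direct sums\<close>

lemma direct_sum_simps:
  "alg_scale (direct_sum n B) c x i = (if i < n then alg_scale (B i) c (x i) else 0)"
  "alg_mult (direct_sum n B) x y i = (if i < n then alg_mult (B i) (x i) (y i) else 0)"
  "homogeneous (direct_sum n B) g = {x. (\<forall>i<n. x i \<in> homogeneous (B i) g) \<and> (\<forall>i\<ge>n. x i = 0)}"
  by (simp_all add: direct_sum_def)

lemma alg_prod_list_direct_sum: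
  "i < n \<Longrightarrow> alg_prod_list (direct_sum n B) xs i = alg_prod_list (B i) (map (\<lambda>x. x i) xs)"
  by (induction xs rule: induct_list012) (simp_all add: direct_sum_simps)

lemma sum_fun_at: "(\<Sum>x\<in>S. F x) i = (\<Sum>x\<in>S. F x i)" for F :: "'b \<Rightarrow> nat \<Rightarrow> 'c::ab_group_add"
  by (induction S rule: infinite_finite_induct) auto

lemma poly_eval_direct_sum:
  "poly_eval (direct_sum n B) \<phi> f i = (if i < n then poly_eval (B i) (\<lambda>x. \<phi> x i) f else 0)"
  by (simp add: poly_eval_def sum_fun_at direct_sum_simps alg_prod_list_direct_sum comp_def)

text \<open>Evaluation is componentwise, and a substitution in one summand extends by 0 to the
  others. For n = 0 the intersection would be the set of all polynomials, including those with a
  constant term.\<close>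

lemma graded_identities_direct_sum:
  assumes "0 < n" and zero: "\<And>i g. i < n \<Longrightarrow> 0 \<in> homogeneous (B i) g"
  shows "graded_identities (direct_sum n B) = (\<Inter>i<n. graded_identities (B i))"
proof (intro set_eqI iffI)
  fix f assume f: "f \<in> graded_identities (direct_sum n B)"
  have "poly_eval (B i) \<psi> f = 0" if i: "i < n" and \<psi>: "\<forall>j g. \<psi> (j, g) \<in> homogeneous (B i) g" for i \<psi>
  proof -
    let ?\<phi> = "\<lambda>x j. if j = i then \<psi> x else 0"
    have "\<forall>k g. ?\<phi> (k, g) \<in> homogeneous (direct_sum n B) g"
      using i \<psi> zero by (auto simp: direct_sum_simps)
    then have "poly_eval (direct_sum n B) ?\<phi> f = 0" using f by (simp add: graded_identities_def)
    then show ?thesis using poly_eval_direct_sum[of n B ?\<phi> f i] i by simp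
  qed
  then show "f \<in> (\<Inter>i<n. graded_identities (B i))" using f by (simp add: graded_identities_def)
next
  fix f assume f: "f \<in> (\<Inter>i<n. graded_identities (B i))"
  have "poly_eval (direct_sum n B) \<phi> f = 0" if \<phi>: "\<forall>j g. \<phi> (j, g) \<in> homogeneous (direct_sum n B) g" for \<phi>
  proof
    fix i
    have "poly_eval (B i) (\<lambda>x. \<phi> x i) f = 0" if "i < n"
      using f \<phi> that by (simp add: graded_identities_def direct_sum_simps)
    then show "poly_eval (direct_sum n B) \<phi> f i = 0 i" by (simp add: poly_eval_direct_sum)
  qed
  moreover have "f \<in> free_graded_algebra" using f assms(1) by (auto simp: graded_identities_def)
  ultimately show "f \<in> graded_identities (direct_sum n B)" by (simp add: graded_identities_def)
qed

subsection \<open>Separation by summands\<close>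

context unital_associative_graded
begin

text \<open>For a summand this condition in degree two amounts to membership in the variety of
  \<open>A\<close>, by \<open>graded_identity_transfer\<close>.\<close>

abbreviation inherited :: "('g, 'a, nat \<Rightarrow> nat \<Rightarrow> 'a) graded_alg \<Rightarrow> bool" where
  "inherited X \<equiv> (\<forall>g h a b. bilinear_identity A g h a b \<longrightarrow> bilinear_identity X g h a b)"

lemma inherited_K7:
  assumes "\<And>a b. bilinear_identity A g h a b \<Longrightarrow> a = 0"
  shows "inherited (K7_alg g h)"
  using heisenberg_basis.bilinear_identity_inherited[OF heisenberg_K7 unital_graded_axioms homogeneous_mult] assms
  unfolding K7_alg_def by fastforce

lemma inherited_W:
  assumes "\<And>a b. bilinear_identity A g h a b \<Longrightarrow> a + b * \<alpha> = 0"
  shows "inherited (W_alg \<alpha> g h)"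
  using heisenberg_basis.bilinear_identity_inherited[OF heisenberg_W unital_graded_axioms homogeneous_mult] assms
  unfolding W_alg_def by fastforce

lemma inherited_Grassmann:
  assumes "\<And>a b. bilinear_identity A g h a b \<Longrightarrow> a = b"
  shows "inherited (Grassmann_alg g h)"
  using heisenberg_basis.bilinear_identity_inherited[OF heisenberg_Grassmann unital_graded_axioms homogeneous_mult] assms
  unfolding Grassmann_alg_def by fastforce

lemma inherited_F:
  assumes "e \<noteq> 0"
  shows "inherited F_alg"
proof -
  have "a + b = 0" if "bilinear_identity A 0 0 a b" for a b
    using bilinear_identity_unit[OF that unit_homogeneous assms] .
  then show ?thesis unfolding F_alg_def
    by (intro allI impI nilpotent_basis.bilinear_identity_algI[OF nilpotent_F]) simp_all
qed

lemma inherited_C2: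
  assumes "q \<noteq> 0" "x \<in> hom q" "x \<noteq> 0"
  shows "inherited (C_alg 2 q)"
proof (intro allI impI)
  fix g h a b assume id: "bilinear_identity A g h a b"
  have "e \<noteq> 0" using assms unit_left[OF hom_carr[OF assms(2)]] mult_zero_left[OF hom_carr[OF assms(2)]] by metis
  then have "a + b = 0" if "g = 0" "h = 0"
    using bilinear_identity_unit[of h a b e] unit_homogeneous id that by blast
  moreover have "a + b = 0" if "g = 0" "h = q"
    using bilinear_identity_unit[of h a b x] assms id that by blast
  moreover have "a + b = 0" if "g = q" "h = 0"
    using bilinear_identity_unit[of g b a x] bilinear_identity_flip[of A g h a b] assms id that by (simp add: add.commute)
  ultimately show "bilinear_identity (C_alg 2 q) g h a b"
    unfolding C_alg_2
    by (intro nilpotent_basis.bilinear_identity_algI[OF nilpotent_C2]) (auto simp: mat_mult_simps)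
qed

text \<open>The argument of \<open>bilinear_identity_inherited\<close> with both generators merged
  into \<open>E_1\<close>: the condition on the pair q, q yields a nonzero product, hence nonzero
  components in degrees 0, q and q + q.\<close>

lemma inherited_C3:
  assumes "q \<noteq> 0" and sym: "\<And>a b. bilinear_identity A q q a b \<Longrightarrow> a + b = 0"
  shows "inherited (C_alg 3 q)"
proof (intro allI impI)
  fix g h a b assume id: "bilinear_identity A g h a b"
  obtain x y where xy: "x \<in> hom q" "y \<in> hom q" "x \<bullet> y \<noteq> 0"
  proof (rule ccontr)
    assume "\<not> thesis"
    then have "bilinear_identity A q q 1 0"
      using that by (force simp: bilinear_identity_def scale_zero_left scale_one mult_closed hom_carr)
    then show False using sym by fastforce
  qed
  then have x: "x \<noteq> 0" using mult_zero_left hom_carr by metis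
  have e: "e \<noteq> 0" using x unit_left[OF hom_carr[OF xy(1)]] mult_zero_left[OF hom_carr[OF xy(1)]] by metis
  have ne: "\<exists>z\<in>hom k. z \<noteq> 0" if "k \<in> {0, q, q + q}" for k
    using that x e xy unit_homogeneous homogeneous_mult by auto
  have unit: "a + b = 0" if "g = 0" "h \<in> {0, q, q + q}"
    using bilinear_identity_unit[of h a b] ne[OF that(2)] id that(1) by blast
  have unit': "a + b = 0" if "h = 0" "g \<in> {0, q, q + q}"
    using bilinear_identity_unit[of g b a] bilinear_identity_flip[of A g h a b] ne[OF that(2)] id that(1)
    by (auto simp: add.commute)
  have scale0: "coeff_scale a z + coeff_scale b z = 0" if "a + b = 0" for z
    using that by (metis coeff.scale_left_distrib coeff.scale_zero_left)
  show "bilinear_identity (C_alg 3 q) g h a b"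
    unfolding C_alg_3
  proof (rule nilpotent_basis.bilinear_identity_algI[OF nilpotent_C3])
    fix z w :: "nat \<Rightarrow> nat \<Rightarrow> 'a"
    assume "(z, g) \<in> set [(unit_at 1 2 + unit_at 2 3, q), (unit_at 1 3, q + q)]"
      "(w, h) \<in> set [(unit_at 1 2 + unit_at 2 3, q), (unit_at 1 3, q + q)]"
    \<comment> \<open>The square of \<open>E_1\<close> is the only nonzero product within J, and
      there the two orders agree.\<close>
    then consider "g = q" "h = q" "z = w" | "mat_mult 3 z w = 0" "mat_mult 3 w z = 0"
      by (auto simp: mat_mult_simps)
    then show "coeff_scale a (mat_mult 3 z w) + coeff_scale b (mat_mult 3 w z) = 0"
      by cases (use sym id scale0 in auto)
  qed (use unit unit' in auto)
qed

text \<open>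
  The identities of \<open>A\<close> of the form \<open>a x y + b y x\<close>, with \<open>x\<close> of degree \<open>g\<close> and \<open>y\<close> of degree \<open>h\<close>, form a
  subspace of \<open>F\<^sup>2\<close>; it is the intersection of the corresponding lines for the summands in \<open>\<X>\<close>.
\<close>

definition separates :: "'g \<Rightarrow> 'g \<Rightarrow> ('g, 'a, nat \<Rightarrow> nat \<Rightarrow> 'a) graded_alg set \<Rightarrow> bool" where
  "separates g h \<X> \<longleftrightarrow> finite \<X> \<and> \<X> \<subseteq> summands \<and> (\<forall>X\<in>\<X>. inherited X) \<and>
     (\<forall>a b. (\<forall>X\<in>\<X>. bilinear_identity X g h a b) \<longrightarrow> bilinear_identity A g h a b) \<and>
     ((\<exists>X\<in>\<X>. X \<in> quadratic_summands) \<or>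
       bilinear_identity A g h 1 (-1) \<and> (g \<noteq> 0 \<longrightarrow> h \<noteq> 0 \<longrightarrow> bilinear_identity A g h 1 0))"

text \<open>The second alternative in \<open>separates\<close> mentions x y only; after the exchange
  the vanishing of y x is needed, which follows from commutativity together with x y = 0.\<close>

lemma separates_flip:
  assumes "separates g h \<X>"
  shows "separates h g \<X>"
proof -
  have "bilinear_identity A h g 1 (-1)" if "bilinear_identity A g h 1 (-1)"
    using bilinear_identity_scale[OF that, of "-1"] bilinear_identity_flip[of A g h "-1" 1] by simp
  moreover have "bilinear_identity A h g 1 0"
    if "bilinear_identity A g h 1 (-1)" "bilinear_identity A g h 1 0"
    using bilinear_identity_add[OF bilinear_identity_scale[OF that(1), of "-1"] that(2)]
      bilinear_identity_flip[of A g h 0 1] by simp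
  moreover have "\<forall>a b. (\<forall>X\<in>\<X>. bilinear_identity X h g a b) \<longrightarrow> bilinear_identity A h g a b"
  proof (intro allI impI)
    fix a b assume "\<forall>X\<in>\<X>. bilinear_identity X h g a b"
    then have "\<forall>X\<in>\<X>. bilinear_identity X g h b a" by (simp add: bilinear_identity_flip[of _ g h b a])
    then show "bilinear_identity A h g a b"
      using assms bilinear_identity_flip[of A g h b a] by (simp add: separates_def)
  qed
  ultimately show ?thesis using assms unfolding separates_def by blast
qed

text \<open>If degree h is nonzero in \<open>A\<close>, the unit confines the identities to the line
  a + b = 0. They fill this line, which F or \<open>C_2\<close> cuts out, or they are 0; then the
  Grassmann algebra adds a = b, and the two lines meet in 0 because 2 is invertible.\<close>

lemma separates_unit:
  assumes "e \<noteq> 0"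
  shows "\<exists>\<X>. separates 0 h \<X>"
proof (cases "hom h = {0}")
  case True
  then have "bilinear_identity A 0 h a b" for a b by (intro bilinear_identity_trivial) simp
  then have "separates 0 h {}" by (simp add: separates_def)
  then show ?thesis ..
next
  case False
  then obtain x where x: "x \<in> hom h" "x \<noteq> 0" using homogeneous_zero by blast
  have sum0: "a + b = 0" if "bilinear_identity A 0 h a b" for a b
    using bilinear_identity_unit[OF that x] .
  define S :: "('g, 'a, nat \<Rightarrow> nat \<Rightarrow> 'a) graded_alg" where "S = (if h = 0 then F_alg else C_alg 2 h)"
  have S: "S \<in> summands" "inherited S" "\<And>a b. bilinear_identity S 0 h a b \<Longrightarrow> a + b = 0"
    using inherited_F[OF assms] inherited_C2[OF _ x] F_identity_eq C2_identity_eq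
    by (auto simp: S_def summands_def split: if_splits)
  show ?thesis
  proof (cases "bilinear_identity A 0 h 1 (-1)")
    case True
    have "bilinear_identity A 0 h a b" if "bilinear_identity S 0 h a b" for a b
      using bilinear_identity_scale[OF True, of a] S(3)[OF that] by (simp add: add_eq_0_iff2)
    then have "separates 0 h {S}" using S True by (simp add: separates_def)
    then show ?thesis ..
  next
    case False
    have zero: "a = 0 \<and> b = 0" if "bilinear_identity A 0 h a b" for a b
    proof -
      have "b = - a" using sum0[OF that] by (simp add: add_eq_0_iff)
      then show ?thesis using bilinear_identity_of_scale[of 0 h a 1 "-1"] that False by auto
    qed
    then have "inherited (Grassmann_alg 0 h)" by (intro inherited_Grassmann) metis
    moreover have "0 + h = h + 0" by simp
    then have "Grassmann_alg 0 h \<in> quadratic_summands" unfolding quadratic_summands_def by blast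
    moreover have "bilinear_identity A 0 h a b"
      if "bilinear_identity S 0 h a b" "bilinear_identity (Grassmann_alg 0 h) 0 h a b" for a b
    proof -
      have "a + b = 0" "a = b" using S(3)[OF that(1)] Grassmann_identity_eq[OF that(2)] by auto
      then show ?thesis using bilinear_identity_zero by simp
    qed
    ultimately have "separates 0 h {S, Grassmann_alg 0 h}"
      using S by (auto simp: separates_def summands_def)
    then show ?thesis ..
  qed
qed

text \<open>A nonempty \<open>\<X>\<close> supplies a quadratic summand outright. If it is empty,
  the last premise turns every pair of coefficients into an identity, in particular the two pairs in
  the second alternative.\<close>

lemma separates_nonunit:
  assumes "\<X> \<subseteq> quadratic_summands" "finite \<X>" "\<And>X. X \<in> \<X> \<Longrightarrow> inherited X"
    and "\<And>a b. (\<And>X. X \<in> \<X> \<Longrightarrow> bilinear_identity X g h a b) \<Longrightarrow> bilinear_identity A g h a b"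
  shows "separates g h \<X>"
proof -
  have "\<forall>a b. (\<forall>X\<in>\<X>. bilinear_identity X g h a b) \<longrightarrow> bilinear_identity A g h a b"
    using assms(4) by blast
  moreover have "(\<exists>X\<in>\<X>. X \<in> quadratic_summands) \<or>
      bilinear_identity A g h 1 (-1) \<and> (g \<noteq> 0 \<longrightarrow> h \<noteq> 0 \<longrightarrow> bilinear_identity A g h 1 0)"
  proof (cases "\<X> = {}")
    case True
    then have "bilinear_identity A g h a b" for a b by (intro assms(4)) simp
    then show ?thesis by simp
  qed (use assms(1) in blast)
  moreover have "\<X> \<subseteq> summands" using assms(1) by (auto simp: summands_def)
  moreover have "\<forall>X\<in>\<X>. inherited X" using assms(3) by simp
  ultimately show ?thesis
    unfolding separates_def using assms(2) by (intro conjI)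
qed

text \<open>The space of identities is invariant under swapping a and b. Since 2 is invertible, it
  is the direct sum of its parts on the lines through (1, 1) and (1, -1). If the first part is
  missing, \<open>C_3\<close> imposes a + b = 0; if the second is missing, the Grassmann algebra
  imposes a = b.\<close>

lemma separates_same_degree:
  assumes "g \<noteq> 0"
  shows "\<exists>\<X>. separates g g \<X>"
proof -
  let ?sym = "bilinear_identity A g g 1 1" and ?alt = "bilinear_identity A g g 1 (-1)"
  let ?X = "(if ?sym then {} else {C_alg 3 g}) \<union> (if ?alt then {} else {Grassmann_alg g g})"
  have comb: "bilinear_identity A g g (a + b) (a + b)" "bilinear_identity A g g (a - b) (- (a - b))"
    if "bilinear_identity A g g a b" for a b
    using bilinear_identity_add[OF that, of b a] bilinear_identity_flip[of A g g a b] that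
      bilinear_identity_add[OF that bilinear_identity_scale[of g g b a "-1"]]
    by (simp_all add: add.commute)
  have "inherited (C_alg 3 g)" if "\<not> ?sym"
  proof (rule inherited_C3[OF assms])
    fix a b assume "bilinear_identity A g g a b"
    then show "a + b = 0" using comb(1) bilinear_identity_of_scale[of g g "a + b" 1 1] that by auto
  qed
  moreover have "inherited (Grassmann_alg g g)" if "\<not> ?alt"
  proof (rule inherited_Grassmann)
    fix a b assume "bilinear_identity A g g a b"
    then show "a = b" using comb(2) bilinear_identity_of_scale[of g g "a - b" 1 "-1"] that by auto
  qed
  moreover have "bilinear_identity A g g a b" if X: "\<And>X. X \<in> ?X \<Longrightarrow> bilinear_identity X g g a b" for a b
  proof -
    have "a + b = 0 \<or> ?sym" using X[of "C_alg 3 g"] C3_identity_eq by auto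
    then have sym: "bilinear_identity A g g ((a + b) / 2) ((a + b) / 2)"
      using bilinear_identity_zero bilinear_identity_scale[of g g 1 1 "(a + b) / 2"] by auto
    have "a = b \<or> ?alt" using X[of "Grassmann_alg g g"] Grassmann_identity_eq[of g g a b] by auto
    then have "bilinear_identity A g g ((a - b) / 2) (- ((a - b) / 2))"
      using bilinear_identity_zero bilinear_identity_scale[of g g 1 "-1" "(a - b) / 2"] by auto
    from bilinear_identity_add[OF sym this] show ?thesis by (simp add: field_simps)
  qed
  moreover have "?X \<subseteq> quadratic_summands" using assms by (auto simp: quadratic_summands_def)
  ultimately have "separates g g ?X" by (intro separates_nonunit) (auto split: if_splits)
  then show ?thesis ..
qed

text \<open>As x y and y x lie in different components, the two terms of an identity vanish
  separately. Each coordinate is then either free or forced to be 0, the latter by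
  \<open>K_7\<close> with its degrees in the corresponding order.\<close>

lemma separates_noncommuting:
  assumes "g \<noteq> 0" "h \<noteq> 0" "g + h \<noteq> h + g"
  shows "\<exists>\<X>. separates g h \<X>"
proof -
  let ?l = "bilinear_identity A g h 1 0" and ?r = "bilinear_identity A g h 0 1"
  let ?X = "(if ?l then {} else {K7_alg g h}) \<union> (if ?r then {} else {K7_alg h g})"
  have split: "bilinear_identity A g h a 0" if "bilinear_identity A g h a b" for a b
    unfolding bilinear_identity_def
  proof (intro ballI)
    fix x y assume xy: "x \<in> hom g" "y \<in> hom h"
    then have "a *\<^sub>A (x \<bullet> y) \<in> hom (g + h)" "b *\<^sub>A (y \<bullet> x) \<in> hom (h + g)"
      by (auto intro: homogeneous_scale homogeneous_mult)
    moreover have "a *\<^sub>A (x \<bullet> y) + b *\<^sub>A (y \<bullet> x) = 0" using that xy by (simp add: bilinear_identity_def)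
    ultimately have "a *\<^sub>A (x \<bullet> y) = 0" using homogeneous_independent assms(3) by blast
    then show "a *\<^sub>A (x \<bullet> y) + 0 *\<^sub>A (y \<bullet> x) = 0"
      using xy by (simp add: scale_zero_left mult_closed hom_carr)
  qed
  have split': "bilinear_identity A g h 0 b" if "bilinear_identity A g h a b" for a b
    using bilinear_identity_add[OF that bilinear_identity_scale[OF split[OF that], of "-1"]] by simp
  have "g \<noteq> h" using assms(3) by auto
  have "inherited (K7_alg g h)" if "\<not> ?l"
  proof (rule inherited_K7)
    fix a b assume "bilinear_identity A g h a b"
    then show "a = 0" using split bilinear_identity_of_scale[of g h a 1 0] that by auto
  qed
  moreover have "inherited (K7_alg h g)" if "\<not> ?r"
  proof (rule inherited_K7)
    fix a b assume "bilinear_identity A h g a b"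
    then have "bilinear_identity A g h b a" using bilinear_identity_flip[of A h g a b] by simp
    then show "a = 0" using split' bilinear_identity_of_scale[of g h a 0 1] that by auto
  qed
  moreover have "bilinear_identity A g h a b" if X: "\<And>X. X \<in> ?X \<Longrightarrow> bilinear_identity X g h a b" for a b
  proof -
    have "a = 0 \<or> ?l" using X[of "K7_alg g h"] K7_identity_eq[of g h a b] by auto
    then have l: "bilinear_identity A g h a 0"
      using bilinear_identity_zero bilinear_identity_scale[of g h 1 0 a] by auto
    have "b = 0 \<or> ?r"
      using X[of "K7_alg h g"] K7_identity_eq[of h g b a] bilinear_identity_flip[of "K7_alg h g" g h a b] by auto
    then have "bilinear_identity A g h 0 b"
      using bilinear_identity_zero bilinear_identity_scale[of g h 0 1 b] by auto
    from bilinear_identity_add[OF l this] show ?thesis by simp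
  qed
  moreover have "?X \<subseteq> quadratic_summands" using assms \<open>g \<noteq> h\<close> by (auto simp: quadratic_summands_def)
  ultimately have "separates g h ?X" by (intro separates_nonunit) (auto split: if_splits)
  then show ?thesis ..
qed

text \<open>Every subspace of F^2 is cut out: the zero space by the two orders of \<open>K_7\<close>
  together, each axis by one of them, any other line by a single W, and the whole space by no
  summand at all.\<close>

lemma separates_commuting:
  assumes "g \<noteq> 0" "h \<noteq> 0" "g \<noteq> h" "g + h = h + g"
  shows "\<exists>\<X>. separates g h \<X>"
proof -
  have K: "K7_alg g h \<in> quadratic_summands" "K7_alg h g \<in> quadratic_summands"
    using assms by (auto simp: quadratic_summands_def)
  have W: "W_alg \<alpha> g h \<in> quadratic_summands" if "\<alpha> \<noteq> 0" for \<alpha>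
    using that assms unfolding quadratic_summands_def by blast
  have Kgh: "a = 0" if "bilinear_identity (K7_alg g h) g h a b" for a b :: 'a
    using K7_identity_eq[OF that] by simp
  have Khg: "b = 0" if "bilinear_identity (K7_alg h g) g h a b" for a b :: 'a
    using K7_identity_eq[of h g b a] that bilinear_identity_flip[of "K7_alg h g" g h a b] by simp
  consider (none) "\<And>a b. bilinear_identity A g h a b \<Longrightarrow> a = 0 \<and> b = 0"
    | (all) "\<And>a b. bilinear_identity A g h a b"
    | (line) c d where "c \<noteq> 0 \<or> d \<noteq> 0" "\<And>a b. bilinear_identity A g h a b \<longleftrightarrow> a * d = b * c"
  proof (cases "\<forall>a b. bilinear_identity A g h a b \<longrightarrow> a = 0 \<and> b = 0")
    case False
    then obtain c d where cd: "bilinear_identity A g h c d" "c \<noteq> 0 \<or> d \<noteq> 0" by blast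
    have "bilinear_identity A g h p q" if ab: "bilinear_identity A g h a b" "a * d \<noteq> b * c" for a b p q
    proof -
      \<comment> \<open>Cramer's rule: two independent identities span F^2, and these are the
        coefficients that express (p, q) by (a, b) and (c, d).\<close>
      let ?D = "a * d - b * c"
      have D: "?D \<noteq> 0" using ab by simp
      have "(p * d - q * c) * a + (a * q - b * p) * c = p * ?D"
        "(p * d - q * c) * b + (a * q - b * p) * d = q * ?D"
        by (simp_all add: algebra_simps)
      then have "(p * d - q * c) / ?D * a + (a * q - b * p) / ?D * c = p"
        "(p * d - q * c) / ?D * b + (a * q - b * p) / ?D * d = q"
        using D by (simp_all flip: add_divide_distrib)
      then show ?thesis
        using bilinear_identity_add[OF bilinear_identity_scale[OF ab(1), of "(p * d - q * c) / ?D"]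
            bilinear_identity_scale[OF cd(1), of "(a * q - b * p) / ?D"]] by simp
    qed
    moreover have "bilinear_identity A g h a b" if "a * d = b * c" for a b
    proof (cases "c = 0")
      case True
      then have "a = 0" using cd(2) that by simp
      then show ?thesis using bilinear_identity_scale[OF cd(1), of "b / d"] True cd(2) by simp
    next
      case False
      then have "a / c * d = b" using that by (simp add: field_simps)
      then show ?thesis using bilinear_identity_scale[OF cd(1), of "a / c"] False by simp
    qed
    ultimately show ?thesis using all line[OF cd(2)] by blast
  qed (use none in blast)
  then show ?thesis
  proof cases
    case none
    have "inherited (K7_alg g h)" by (rule inherited_K7) (use none in blast)
    moreover have "inherited (K7_alg h g)"
    proof (rule inherited_K7)
      fix a b assume "bilinear_identity A h g a b"
      then have "bilinear_identity A g h b a" using bilinear_identity_flip[of A h g a b] by simp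
      then show "a = 0" using none by blast
    qed
    moreover have "bilinear_identity A g h a b"
      if "\<And>X. X \<in> {K7_alg g h, K7_alg h g} \<Longrightarrow> bilinear_identity X g h a b" for a b
      using Kgh[of a b] Khg[of a b] that bilinear_identity_zero by simp
    ultimately have "separates g h {K7_alg g h, K7_alg h g}"
      using K by (intro separates_nonunit) auto
    then show ?thesis ..
  next
    case all
    then have "separates g h {}" by (intro separates_nonunit) auto
    then show ?thesis ..
  next
    case (line c d)
    consider "d = 0" | "c = 0" | "c \<noteq> 0" "d \<noteq> 0" by blast
    then show ?thesis
    proof cases
      case 1
      have "inherited (K7_alg h g)"
      proof (rule inherited_K7)
        fix a b assume "bilinear_identity A h g a b"
        then have "bilinear_identity A g h b a" using bilinear_identity_flip[of A h g a b] by simp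
        then show "a = 0" using line 1 by simp
      qed
      then have "separates g h {K7_alg h g}"
      proof (intro separates_nonunit)
        fix a b :: 'a assume "\<And>X. X \<in> {K7_alg h g} \<Longrightarrow> bilinear_identity X g h a b"
        then show "bilinear_identity A g h a b" using Khg[of a b] line(2)[of a b] 1 by simp
      qed (use K in simp_all)
      then show ?thesis ..
    next
      case 2
      have "inherited (K7_alg g h)"
      proof (rule inherited_K7)
        fix a b assume "bilinear_identity A g h a b"
        then show "a = 0" using line 2 by simp
      qed
      then have "separates g h {K7_alg g h}"
      proof (intro separates_nonunit)
        fix a b :: 'a assume "\<And>X. X \<in> {K7_alg g h} \<Longrightarrow> bilinear_identity X g h a b"
        then show "bilinear_identity A g h a b" using Kgh[of a b] line(2)[of a b] 2 by simp
      qed (use K in simp_all)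
      then show ?thesis ..
    next
      case 3
      \<comment> \<open>The parameter is the one for which the line of W passes through (c, d); it
        is nonzero because both coordinates are.\<close>
      let ?W = "W_alg (- c / d) g h"
      have eq: "a + b * (- c / d) = 0 \<longleftrightarrow> a * d = b * c" for a b
        using 3 by (simp add: field_simps)
      have "inherited ?W"
        by (rule inherited_W) (use line eq in blast)
      moreover have "bilinear_identity A g h a b" if "bilinear_identity ?W g h a b" for a b
        using W_identity_eq[OF that] eq line by blast
      ultimately have "separates g h {?W}"
        using W[of "- c / d"] 3 by (intro separates_nonunit) auto
      then show ?thesis ..
    qed
  qed
qed

lemma ex_separates:
  assumes "e \<noteq> 0"
  shows "\<exists>\<X>. separates g h \<X>"
  using separates_unit[OF assms] separates_flip separates_same_degree separates_noncommuting
    separates_commuting by (cases "g = 0"; cases "h = 0"; metis)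

text \<open>As G is finite, the separating sets for all pairs of degrees have a finite union.
  Pooling them is harmless, since each summand inherits the identities of \<open>A\<close> for all
  pairs and not only for the one it was chosen for.\<close>

lemma quadratic_growth_decomposition:
  assumes growth: "quadratic_growth A"
  shows "\<exists>\<X>. finite \<X> \<and> \<X> \<subseteq> summands \<and> (\<exists>X\<in>\<X>. X \<in> quadratic_summands) \<and>
    graded_identities A = (\<Inter>X\<in>\<X>. graded_identities X)"
proof -
  have not_linear: False
    if comm: "\<And>g h x y. x \<in> hom g \<Longrightarrow> y \<in> hom h \<Longrightarrow> x \<bullet> y = y \<bullet> x"
      and nil: "\<And>g h x y. g \<noteq> 0 \<Longrightarrow> h \<noteq> 0 \<Longrightarrow> x \<in> hom g \<Longrightarrow> y \<in> hom h \<Longrightarrow> x \<bullet> y = 0"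
  proof -
    have "graded_codim A n \<le> n * card (UNIV :: 'g set)" if "1 \<le> n" for n
      by (rule graded_codim_le_linear[OF _ _ _ that]) (fact comm nil mult_assoc)+
    then show False using quadratic_growth_not_linear[OF growth, of "card (UNIV :: 'g set)"] by (auto simp: not_le[symmetric])
  qed
  \<comment> \<open>In the zero algebra all products vanish, so both hypotheses of the linear bound
    hold and quadratic growth is excluded.\<close>
  have "e \<noteq> 0"
  proof
    assume "e = 0"
    then have "x = 0" if "x \<in> carr" for x using unit_left[OF that] mult_zero_left[OF that] by simp
    then have "x \<bullet> y = 0" if "x \<in> hom g" "y \<in> hom h" for x y g h
      using that mult_closed hom_carr by blast
    then show False using not_linear by (metis (full_types))
  qed
  then obtain \<X> where \<X>: "\<And>g h. separates g h (\<X> g h)" using ex_separates by metis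
  define \<Y> where "\<Y> = (\<Union>g. \<Union>h. \<X> g h)"
  have \<Y>: "finite \<Y>" "\<Y> \<subseteq> summands" "\<And>X. X \<in> \<Y> \<Longrightarrow> inherited X"
  proof -
    show "finite \<Y>" using \<X> by (simp add: \<Y>_def separates_def)
    show "\<Y> \<subseteq> summands" unfolding \<Y>_def
    proof (intro UN_least)
      show "\<X> g h \<subseteq> summands" for g h using \<X>[of g h] unfolding separates_def by (elim conjE)
    qed
    show "inherited X" if "X \<in> \<Y>" for X
    proof -
      obtain g h where "X \<in> \<X> g h" using \<open>X \<in> \<Y>\<close> by (auto simp: \<Y>_def)
      then show ?thesis using \<X>[of g h] by (simp add: separates_def)
    qed
  qed
  \<comment> \<open>Without a quadratic summand the second alternative of \<open>separates\<close>
    holds for all pairs of degrees; it is made to deliver the two hypotheses of the linear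
    bound.\<close>
  have quad: "\<exists>X\<in>\<Y>. X \<in> quadratic_summands"
  proof (rule ccontr)
    assume "\<not> ?thesis"
    then have id: "bilinear_identity A g h 1 (-1)" "g \<noteq> 0 \<Longrightarrow> h \<noteq> 0 \<Longrightarrow> bilinear_identity A g h 1 0" for g h
      using \<X>[of g h] by (auto simp: \<Y>_def separates_def)
    show False
    proof (rule not_linear)
      fix g h x y assume xy: "x \<in> hom g" "y \<in> hom h"
      then have c: "x \<bullet> y \<in> carr" "y \<bullet> x \<in> carr" by (auto intro: mult_closed hom_carr)
      show "x \<bullet> y = y \<bullet> x"
        using id(1)[of g h] xy c scale_minus[of "y \<bullet> x" 1]
        unfolding bilinear_identity_def by (fastforce simp: scale_one)
      show "x \<bullet> y = 0" if "g \<noteq> 0" "h \<noteq> 0"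
        using id(2)[OF that] xy c scale_zero_left[of "y \<bullet> x"]
        unfolding bilinear_identity_def by (fastforce simp: scale_one)
    qed
  qed
  have "f \<in> graded_identities X" if "X \<in> \<Y>" "f \<in> graded_identities A" for X f
  proof -
    obtain eX where eX: "unital_graded X eX" "determined_by_pairs X eX"
      using summand_determined_by_pairs[of X] \<open>X \<in> \<Y>\<close> \<Y>(2) by blast
    show ?thesis
      by (rule graded_identity_transfer[OF eX, of "{A}"])
        (use that \<Y>(3) unital_graded_axioms in \<open>auto simp: graded_identities_def\<close>)
  qed
  \<comment> \<open>For this inclusion \<open>A\<close> itself has to be determined by pairs, and
    this is where its growth enters through the binomial lower bounds.\<close>
  moreover have "f \<in> graded_identities A" if "\<And>X. X \<in> \<Y> \<Longrightarrow> f \<in> graded_identities X" for f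
  proof (rule graded_identity_transfer[OF unital_graded_axioms determined_by_pairsI, of \<Y>])
    show "\<exists>n\<ge>1. graded_codim A n < n choose k" if "3 \<le> k" for k
      by (rule quadratic_growth_less_choose[OF growth that])
    show "\<exists>e. unital_graded X e" if "X \<in> \<Y>" for X
      using summand_determined_by_pairs that \<Y>(2) by blast
    show "bilinear_identity A g h a b" if "\<And>X. X \<in> \<Y> \<Longrightarrow> bilinear_identity X g h a b" for g h a b
    proof -
      have "\<forall>X\<in>\<X> g h. bilinear_identity X g h a b" using that by (auto simp: \<Y>_def)
      moreover have "(\<forall>X\<in>\<X> g h. bilinear_identity X g h a b) \<longrightarrow> bilinear_identity A g h a b"
        using \<X>[of g h] by (simp add: separates_def)
      ultimately show ?thesis by blast
    qed
    show "f \<in> graded_identities X" if "X \<in> \<Y>" for X by (rule \<open>\<And>X. X \<in> \<Y> \<Longrightarrow> f \<in> graded_identities X\<close>[OF that])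
    show "f \<in> free_graded_algebra" using quad that by (auto simp: graded_identities_def)
  qed
  ultimately have "graded_identities A = (\<Inter>X\<in>\<Y>. graded_identities X)" by blast
  then show ?thesis using \<Y> quad by blast
qed

end

text \<open>A variety is unitary if some unitary algebra generates it, so the unit is asked of
  \<open>U\<close> and not of \<open>A\<close>. The two algebras may have different ambient types,
  whence the two memberships in place of an equality of varieties.\<close>

theorem theorem5p14:
  fixes A :: "('g::{group_add,finite}, 'a::field_char_0, 'v::ab_group_add) graded_alg"
    and U :: "('g, 'a, 'w::ab_group_add) graded_alg"
  assumes "graded_algebra A"
    and "graded_algebra U" and "unitary U"
    and "U \<in> graded_variety A" and "A \<in> graded_variety U"
    and "quadratic_growth A"
  shows "\<exists>n B. (\<forall>i<n. B i \<in> summands) \<and> (\<exists>i<n. B i \<in> quadratic_summands) \<and>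
               T_equivalent A (direct_sum n B)"
proof -
  \<comment> \<open>Codimensions depend on the identities alone, so growth carries over to
    \<open>U\<close> and the decomposition can be found there.\<close>
  have AU: "graded_identities A = graded_identities U"
    using assms(4,5) by (auto simp: graded_variety_def)
  then have growth: "quadratic_growth U"
    using assms(6) by (simp add: quadratic_growth_def graded_codim_def)
  obtain e where "unital_associative_graded U e"
    using unital_associative_gradedI[OF assms(2,3)] by blast
  from unital_associative_graded.quadratic_growth_decomposition[OF this growth]
  obtain \<X> :: "('g, 'a, nat \<Rightarrow> nat \<Rightarrow> 'a) graded_alg set" where \<X>: "finite \<X>" "\<X> \<subseteq> summands"
    "\<exists>X\<in>\<X>. X \<in> quadratic_summands" "graded_identities U = (\<Inter>X\<in>\<X>. graded_identities X)"
    by blast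
  obtain B where B: "bij_betw B {0..<card \<X>} \<X>" using ex_bij_betw_nat_finite[OF \<X>(1)] by blast
  define n where "n = card \<X>"
  have B: "B ` {..<n} = \<X>" using B by (simp add: bij_betw_def n_def lessThan_atLeast0)
  have summands: "B i \<in> summands" if "i < n" for i using B \<X>(2) that by blast
  have "0 \<in> homogeneous (B i) g" if i: "i < n" for i g
    using summand_determined_by_pairs[OF summands[OF i]] unital_graded.homogeneous_zero by blast
  moreover have "0 < n" using \<X>(1,3) by (auto simp: n_def card_gt_0_iff)
  ultimately have "graded_identities (direct_sum n B) = (\<Inter>i<n. graded_identities (B i))"
    by (intro graded_identities_direct_sum)
  also have "\<dots> = graded_identities A" using AU \<X>(4) B by (simp flip: image_image)
  finally have "T_equivalent A (direct_sum n B)" by (simp add: T_equivalent_def)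
  moreover have "\<exists>i<n. B i \<in> quadratic_summands" using \<X>(3) B by blast
  ultimately show ?thesis using summands by blast
qed

end
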